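(* Let $p$ be a prime and let $1\to C\to H\to G\to 1$ be a central extension of finite $p$-groups (so $C\leq Z(H)$). Let $G'$ and $H'$ be the derived subgroups of $G$ and $H$, let $p^n$ be the exponent of $C$ and $p^e$ the exponent of $G/G'$. Assume that $H'\cap C=\{1\}$. (i) Suppose $C$ is cyclic of order $p^n$ with $n\ge1$, and identify $C$ with its (isomorphic) image in $H/H'$. Let $m$ be the maximum of all integers $i$ such that $H/H'$ has a cyclic subgroup of order $p^i$ whose intersection with $C$ is nontrivial. Let $K$ be an infinite field with $\operatorname{char}K\ne p$ containing the $p^m$-th roots of unity (i.e. a primitive $p^m$-th root of unity). Then $K(H)$ is rational over $K(G)$. (ii) Let $K$ be an infinite field with $\operatorname{char}K\neq p$ containing the $p^{n+e}$-th roots of unity (i.e. a primitive $p^{n+e}$-th root of unity). Then $K(H)$ is rational over $K(G)$.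
   Context: For a field $K$ and a finite group $\Gamma$, let $\Gamma$ act on the rational function field $K(x(g):g\in \Gamma)$ (in $|\Gamma|$ independent variables) by $K$-automorphisms via $h\cdot x(g)=x(hg)$ for $h,g\in \Gamma$; $K(\Gamma)$ denotes the fixed field $K(x(g):g\in \Gamma)^\Gamma$. A field extension $L/F$ is called rational if $L$ is purely transcendental over $F$. For a surjection $\pi:H\to G$, $K(G)$ is regarded as a subfield of $K(H)$ via the $H$-equivariant embedding $K(x(g):g\in G)\hookrightarrow K(x(h):h\in H)$, $x(g)\mapsto\sum_{h\in\pi^{-1}(g)}x(h)$. *)

theory Defs
  imports
    "HOL-Library.Poly_Mapping"
    "HOL-Computational_Algebra.Computational_Algebra"
    "HOL-Algebra.Algebra"
    "HOL-Algebra.Algebraic_Closure_Type"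
begin

section \<open>Multivariate polynomials over a field with arbitrary variable type\<close>

text \<open>
  \<^typ>\<open>('v \<Rightarrow>\<^sub>0 nat) \<Rightarrow>\<^sub>0 'k\<close> is an integral domain by instantiation only for linearly ordered
  \<^typ>\<open>'v\<close>.  The type copy below carries the same ring structure and is an integral domain for every
  \<^typ>\<open>'v\<close>, so that group elements can serve as variables and fractions can be formed.
\<close>

definition monomial_eval :: "('v \<Rightarrow> 'l) \<Rightarrow> ('v \<Rightarrow>\<^sub>0 nat) \<Rightarrow> 'l::comm_ring_1" where
  "monomial_eval s m = (\<Prod>v\<in>Poly_Mapping.keys m. s v ^ Poly_Mapping.lookup m v)"

definition pm_eval ::
    "('k \<Rightarrow> 'l) \<Rightarrow> ('v \<Rightarrow> 'l) \<Rightarrow> (('v \<Rightarrow>\<^sub>0 nat) \<Rightarrow>\<^sub>0 'k::zero) \<Rightarrow> 'l::comm_ring_1" where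
  "pm_eval c s p = (\<Sum>m\<in>Poly_Mapping.keys p. c (Poly_Mapping.lookup p m) * monomial_eval s m)"

lemma monomial_eval_superset:
  assumes "finite A" "Poly_Mapping.keys m \<subseteq> A"
  shows "monomial_eval s m = (\<Prod>v\<in>A. s v ^ Poly_Mapping.lookup m v)"
  unfolding monomial_eval_def
  by (rule prod.mono_neutral_left) (use assms in \<open>auto simp: in_keys_iff\<close>)

lemma monomial_eval_add: "monomial_eval s (m + n) = monomial_eval s m * monomial_eval s n"
proof -
  let ?A = "Poly_Mapping.keys m \<union> Poly_Mapping.keys n"
  have sub: "Poly_Mapping.keys (m + n) \<subseteq> ?A"
    by (rule Poly_Mapping.keys_add)
  show ?thesis
    by (simp add: monomial_eval_superset[where A = ?A] sub lookup_add power_add prod.distrib)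
qed

lemma monomial_eval_0 [simp]: "monomial_eval s 0 = 1"
  by (simp add: monomial_eval_def)

lemma monomial_eval_single [simp]: "monomial_eval s (Poly_Mapping.single v k) = s v ^ k"
  by (cases "k = 0") (simp_all add: monomial_eval_def)

lemma poly_mapping_sum_monomials:
  fixes p :: "'m \<Rightarrow>\<^sub>0 'k::comm_monoid_add"
  shows "(\<Sum>m\<in>Poly_Mapping.keys p. Poly_Mapping.single m (Poly_Mapping.lookup p m)) = p"
  by (rule poly_mapping_eqI) (simp add: lookup_sum lookup_single when_def in_keys_iff)

context
  fixes c :: "'k::comm_ring_1 \<Rightarrow> 'l::comm_ring_1"
  assumes c0: "c 0 = 0" and cadd: "\<And>a b. c (a + b) = c a + c b"
begin

lemma pm_eval_superset:
  assumes "finite A" "Poly_Mapping.keys p \<subseteq> A"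
  shows "pm_eval c s p = (\<Sum>m\<in>A. c (Poly_Mapping.lookup p m) * monomial_eval s m)"
  unfolding pm_eval_def
  by (rule sum.mono_neutral_left) (use assms c0 in \<open>auto simp: in_keys_iff\<close>)

lemma pm_eval_add: "pm_eval c s (p + q) = pm_eval c s p + pm_eval c s q"
proof -
  let ?A = "Poly_Mapping.keys p \<union> Poly_Mapping.keys q"
  have sub: "Poly_Mapping.keys (p + q) \<subseteq> ?A"
    by (rule Poly_Mapping.keys_add)
  show ?thesis
    by (simp add: pm_eval_superset[where A = ?A] sub lookup_add cadd distrib_right sum.distrib)
qed

lemma pm_eval_0: "pm_eval c s 0 = 0"
  by (simp add: pm_eval_def)

lemma pm_eval_sum: "pm_eval c s (sum f I) = (\<Sum>i\<in>I. pm_eval c s (f i))"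
  by (induction I rule: infinite_finite_induct) (simp_all add: pm_eval_0 pm_eval_add)

lemma pm_eval_single: "pm_eval c s (Poly_Mapping.single m a) = c a * monomial_eval s m"
  by (cases "a = 0") (simp_all add: pm_eval_def c0)

lemma pm_eval_mult:
  assumes cmult: "\<And>a b. c (a * b) = c a * c b"
  shows "pm_eval c s (p * q) = pm_eval c s p * pm_eval c s q"
proof -
  let ?P = "\<Sum>m\<in>Poly_Mapping.keys p. Poly_Mapping.single m (Poly_Mapping.lookup p m)"
  let ?Q = "\<Sum>m\<in>Poly_Mapping.keys q. Poly_Mapping.single m (Poly_Mapping.lookup q m)"
  have "pm_eval c s (?P * ?Q) = pm_eval c s ?P * pm_eval c s ?Q"
    by (simp add: sum_product pm_eval_sum pm_eval_single mult_single monomial_eval_add cmult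
        mult_ac)
  then show ?thesis
    by (simp add: poly_mapping_sum_monomials)
qed

end

lemma pm_mult_neq_0:
  fixes p q :: "('v \<Rightarrow>\<^sub>0 nat) \<Rightarrow>\<^sub>0 'k::idom"
  assumes p: "p \<noteq> 0" and q: "q \<noteq> 0"
  shows "p * q \<noteq> 0"
proof -
  define V where "V = (\<Union>m\<in>Poly_Mapping.keys p \<union> Poly_Mapping.keys q. Poly_Mapping.keys m)"
  have "finite V" unfolding V_def by auto
  then obtain f :: "'v \<Rightarrow> nat" where f: "inj_on f V"
    using finite_imp_inj_to_nat_seg by blast
  let ?c = "Poly_Mapping.single 0 :: 'k \<Rightarrow> (nat \<Rightarrow>\<^sub>0 nat) \<Rightarrow>\<^sub>0 'k"
  let ?s = "\<lambda>v. Poly_Mapping.single (Poly_Mapping.single (f v) 1) (1::'k)"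
  let ?push = "\<lambda>m. \<Sum>v\<in>Poly_Mapping.keys m. Poly_Mapping.single (f v) (Poly_Mapping.lookup m v)"
  have pow: "Poly_Mapping.single (Poly_Mapping.single i 1) (1::'k) ^ k
      = Poly_Mapping.single (Poly_Mapping.single i k) 1" for i :: nat and k :: nat
    by (induction k) (simp_all add: mult_single single_add[symmetric])
  have prod_single: "(\<Prod>v\<in>I. Poly_Mapping.single (g v) (1::'k)) = Poly_Mapping.single (sum g I) 1"
    for I and g :: "'v \<Rightarrow> nat \<Rightarrow>\<^sub>0 nat"
    by (induction I rule: infinite_finite_induct) (simp_all add: mult_single)
  have mon: "monomial_eval ?s m = Poly_Mapping.single (?push m) 1" for m
    unfolding monomial_eval_def pow prod_single ..
  have lookup_push: "Poly_Mapping.lookup (?push m) (f v) = Poly_Mapping.lookup m v"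
    if "Poly_Mapping.keys m \<subseteq> V" "v \<in> V" for m v
  proof -
    have "Poly_Mapping.lookup (?push m) (f v)
        = (\<Sum>w\<in>Poly_Mapping.keys m. Poly_Mapping.lookup m w when f w = f v)"
      by (simp add: lookup_sum lookup_single)
    also have "\<dots> = (\<Sum>w\<in>Poly_Mapping.keys m. if w = v then Poly_Mapping.lookup m v else 0)"
    proof (rule sum.cong)
      fix w assume "w \<in> Poly_Mapping.keys m"
      then have "f w = f v \<longleftrightarrow> w = v" using inj_on_eq_iff[OF f, of w v] subsetD[OF that(1), of w] that(2) by simp
      then show "(Poly_Mapping.lookup m w when f w = f v)
          = (if w = v then Poly_Mapping.lookup m v else 0)" by (simp add: when_def)
    qed simp
    finally show ?thesis by (simp add: in_keys_iff)
  qed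
  have inj_push: "m = m'"
    if "Poly_Mapping.keys m \<subseteq> V" "Poly_Mapping.keys m' \<subseteq> V" "?push m = ?push m'" for m m'
  proof (rule poly_mapping_eqI)
    fix v
    show "Poly_Mapping.lookup m v = Poly_Mapping.lookup m' v"
    proof (cases "v \<in> V")
      case True
      show ?thesis
        by (simp only: lookup_push[OF that(1) True, symmetric]
            lookup_push[OF that(2) True, symmetric] that(3))
    next
      case False
      then have "v \<notin> Poly_Mapping.keys m" "v \<notin> Poly_Mapping.keys m'" using that by blast+
      then show ?thesis by (simp add: in_keys_iff)
    qed
  qed
  have nz: "pm_eval ?c ?s r \<noteq> 0"
    if r: "r \<noteq> 0" "Poly_Mapping.keys r \<subseteq> Poly_Mapping.keys p \<union> Poly_Mapping.keys q" for r
  proof -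
    obtain m where m: "m \<in> Poly_Mapping.keys r"
      using r(1) by (metis ex_in_conv keys_eq_empty)
    have "Poly_Mapping.lookup (pm_eval ?c ?s r) (?push m)
        = (\<Sum>m'\<in>Poly_Mapping.keys r. Poly_Mapping.lookup r m' when ?push m' = ?push m)"
      unfolding pm_eval_def mon by (simp add: lookup_sum mult_single lookup_single)
    also have "\<dots> = (\<Sum>m'\<in>Poly_Mapping.keys r. if m' = m then Poly_Mapping.lookup r m else 0)"
    proof (rule sum.cong)
      fix m' assume m': "m' \<in> Poly_Mapping.keys r"
      have "?push m' = ?push m \<longleftrightarrow> m' = m"
      proof
        assume eq: "?push m' = ?push m"
        have "Poly_Mapping.keys m' \<subseteq> V" "Poly_Mapping.keys m \<subseteq> V"
          using m m' r(2) unfolding V_def by blast+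
        then show "m' = m" using eq by (rule inj_push)
      qed simp
      then show "(Poly_Mapping.lookup r m' when ?push m' = ?push m)
          = (if m' = m then Poly_Mapping.lookup r m else 0)"
        by (simp add: when_def)
    qed simp
    also have "\<dots> = Poly_Mapping.lookup r m" using m by simp
    finally show ?thesis using m by (auto simp: in_keys_iff)
  qed
  have "pm_eval ?c ?s (p * q) = pm_eval ?c ?s p * pm_eval ?c ?s q"
    by (rule pm_eval_mult) (simp_all add: single_add mult_single)
  moreover have "\<dots> \<noteq> 0"
    using nz[OF p] nz[OF q] by simp
  ultimately show ?thesis by (auto simp: pm_eval_def)
qed

typedef (overloaded) ('v, 'k) mpoly = "UNIV :: (('v \<Rightarrow>\<^sub>0 nat) \<Rightarrow>\<^sub>0 'k::zero) set"
  morphisms mapping_of MPoly ..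

setup_lifting type_definition_mpoly

instantiation mpoly :: (type, comm_ring_1) comm_ring_1
begin

lift_definition zero_mpoly :: "('a, 'b) mpoly" is 0 .
lift_definition one_mpoly :: "('a, 'b) mpoly" is 1 .
lift_definition plus_mpoly :: "('a, 'b) mpoly \<Rightarrow> ('a, 'b) mpoly \<Rightarrow> ('a, 'b) mpoly" is "(+)" .
lift_definition minus_mpoly :: "('a, 'b) mpoly \<Rightarrow> ('a, 'b) mpoly \<Rightarrow> ('a, 'b) mpoly" is "(-)" .
lift_definition uminus_mpoly :: "('a, 'b) mpoly \<Rightarrow> ('a, 'b) mpoly" is uminus .
lift_definition times_mpoly :: "('a, 'b) mpoly \<Rightarrow> ('a, 'b) mpoly \<Rightarrow> ('a, 'b) mpoly" is "(*)" .

instance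
  by standard (transfer; simp add: algebra_simps)+

end

instance mpoly :: (type, idom) idom
  by standard (transfer; simp add: pm_mult_neq_0)

lift_definition mp_const :: "'k \<Rightarrow> ('v, 'k::comm_ring_1) mpoly"
  is "Poly_Mapping.single 0" .

lift_definition mp_var :: "'v \<Rightarrow> ('v, 'k::comm_ring_1) mpoly"
  is "\<lambda>v. Poly_Mapping.single (Poly_Mapping.single v 1) 1" .

lift_definition mp_coeffs :: "('v, 'k::comm_ring_1) mpoly \<Rightarrow> 'k set"
  is "\<lambda>p. Poly_Mapping.lookup p ` Poly_Mapping.keys p" .

lift_definition mp_vars :: "('v, 'k::comm_ring_1) mpoly \<Rightarrow> 'v set"
  is "\<lambda>p. \<Union>m\<in>Poly_Mapping.keys p. Poly_Mapping.keys m" .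

text \<open>
  \<^term>\<open>mp_eval c s p\<close> is the value of \<^term>\<open>p\<close> at \<^term>\<open>s\<close>, where the coefficients are transported
  along the ring homomorphism \<^term>\<open>c\<close>.
\<close>

lift_definition mp_eval ::
    "('k \<Rightarrow> 'l) \<Rightarrow> ('v \<Rightarrow> 'l) \<Rightarrow> ('v, 'k::comm_ring_1) mpoly \<Rightarrow> 'l::comm_ring_1"
  is pm_eval .

section \<open>Rational function fields\<close>

type_synonym ('v, 'k) ratfun = "('v, 'k) mpoly fract"

definition rf_const :: "'k::field \<Rightarrow> ('v, 'k) ratfun" where
  "rf_const a = Fract (mp_const a) 1"

definition rf_var :: "'v \<Rightarrow> ('v, 'k::field) ratfun" where
  "rf_var v = Fract (mp_var v) 1"

text \<open>
  Substitution of \<^term>\<open>s v\<close> for the variable \<^term>\<open>v\<close>: the value is computed from any representation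
  as a fraction whose denominator does not vanish at \<^term>\<open>s\<close>, and does not depend on that choice (see
  \<open>rf_subst_Fract\<close> below).  Where the values \<^term>\<open>s v\<close> of the variables \<^term>\<open>v \<in> V\<close> are
  algebraically independent over the constants, every rational function in the variables from
  \<^term>\<open>V\<close> has such a representation; this covers permutations of \<^term>\<open>V\<close> and nonempty sums of
  variables over disjoint index sets.
\<close>

definition rf_subst ::
    "('v \<Rightarrow> ('w, 'k) ratfun) \<Rightarrow> ('v, 'k::field) ratfun \<Rightarrow> ('w, 'k) ratfun" where
  "rf_subst s f = (THE y. \<exists>a b. f = Fract a b \<and> mp_eval rf_const s b \<noteq> 0 \<and>
     y = mp_eval rf_const s a / mp_eval rf_const s b)"

lemma rf_const_0: "rf_const 0 = 0"
  unfolding rf_const_def Zero_fract_def by (simp add: mp_const_def zero_mpoly_def)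

lemma rf_const_1: "rf_const 1 = 1"
  unfolding rf_const_def One_fract_def by (simp add: mp_const_def one_mpoly_def)

lemma mp_const_add: "mp_const (a + b) = mp_const a + mp_const b"
  by transfer (simp add: single_add)

lemma mp_const_mult: "mp_const (a * b) = mp_const a * mp_const b"
  by transfer (simp add: mult_single)

lemma rf_const_add: "rf_const (a + b) = rf_const a + rf_const b"
  by (simp add: rf_const_def mp_const_add)

lemma rf_const_mult: "rf_const (a * b) = rf_const a * rf_const b"
  by (simp add: rf_const_def mp_const_mult)

lemma mp_eval_rf_mult:
  "mp_eval rf_const s (p * q) = mp_eval rf_const s p * mp_eval rf_const s q"
  by (transfer fixing: s)
    (rule pm_eval_mult; simp add: rf_const_0 rf_const_add rf_const_mult)

lemma mp_eval_rf_1: "mp_eval rf_const s 1 = 1"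
  by (transfer fixing: s) (simp add: pm_eval_def rf_const_1)

lemma mp_eval_rf_0: "mp_eval rf_const s 0 = 0"
  by (transfer fixing: s) (simp add: pm_eval_def)

lemma rf_subst_Fract:
  assumes b: "mp_eval rf_const s b \<noteq> 0"
  shows "rf_subst s (Fract a b) = mp_eval rf_const s a / mp_eval rf_const s b"
  unfolding rf_subst_def
proof (rule the_equality)
  show "\<exists>a' b'. Fract a b = Fract a' b' \<and> mp_eval rf_const s b' \<noteq> 0 \<and>
      mp_eval rf_const s a / mp_eval rf_const s b = mp_eval rf_const s a' / mp_eval rf_const s b'"
    using b by blast
next
  fix y
  assume "\<exists>a' b'. Fract a b = Fract a' b' \<and> mp_eval rf_const s b' \<noteq> 0 \<and>
      y = mp_eval rf_const s a' / mp_eval rf_const s b'"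
  then obtain a' b' where *: "Fract a b = Fract a' b'" "mp_eval rf_const s b' \<noteq> 0"
      "y = mp_eval rf_const s a' / mp_eval rf_const s b'" by blast
  have "b \<noteq> 0" "b' \<noteq> 0" using b *(2) mp_eval_rf_0 by metis+
  then have "a * b' = a' * b" using *(1) by (simp add: eq_fract)
  then have "mp_eval rf_const s (a * b') = mp_eval rf_const s (a' * b)" by simp
  then show "y = mp_eval rf_const s a / mp_eval rf_const s b"
    using b *(2,3) by (simp add: mp_eval_rf_mult frac_eq_eq)
qed

lemma rf_subst_const: "rf_subst s (rf_const a) = rf_const a"
proof -
  have "mp_eval rf_const s (mp_const a) = rf_const a"
    by (transfer fixing: s) (simp add: pm_eval_single rf_const_0 rf_const_add)
  then show ?thesis
    using rf_subst_Fract[of s 1 "mp_const a"] by (simp add: rf_const_def[of a] mp_eval_rf_1)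
qed

lemma rf_subst_var: "rf_subst s (rf_var v) = s v"
proof -
  have "mp_eval rf_const s (mp_var v) = s v"
    by (transfer fixing: s) (simp add: pm_eval_single rf_const_0 rf_const_add rf_const_1)
  then show ?thesis
    using rf_subst_Fract[of s 1 "mp_var v"] by (simp add: rf_var_def mp_eval_rf_1)
qed

definition rf_field :: "'v set \<Rightarrow> ('v, 'k::field) ratfun set" where
  "rf_field V = generate_field ring_of_type_algebra (range rf_const \<union> rf_var ` V)"

section \<open>Purely transcendental extensions inside an ambient field\<close>

text \<open>
  The elements of \<^term>\<open>B\<close> serve as names of the polynomial variables, and the variable named
  \<^term>\<open>b\<close> is evaluated at \<^term>\<open>b\<close>.
\<close>

definition alg_independent :: "'l::field set \<Rightarrow> 'l set \<Rightarrow> bool" where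
  "alg_independent F B \<longleftrightarrow>
     (\<forall>q :: ('l, 'l) mpoly. mp_coeffs q \<subseteq> F \<and> mp_vars q \<subseteq> B \<and> mp_eval id id q = 0 \<longrightarrow> q = 0)"

text \<open>\<^term>\<open>rational_over L F\<close> says that \<^term>\<open>L\<close> is a purely transcendental extension of \<^term>\<open>F\<close>.\<close>

definition rational_over :: "'l::field set \<Rightarrow> 'l set \<Rightarrow> bool" where
  "rational_over L F \<longleftrightarrow> subfield F ring_of_type_algebra \<and>
     (\<exists>B. alg_independent F B \<and> L = generate_field ring_of_type_algebra (F \<union> B))"

section \<open>The fields \<open>K(\<Gamma>)\<close>\<close>

text \<open>
  The field \<open>K\<close> is the type \<^typ>\<open>'k\<close>, and \<open>K(x(g) : g \<in> \<Gamma>)\<close> is \<^term>\<open>rf_field (carrier \<Gamma>)\<close>,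
  on which \<open>h\<close> acts by \<open>x(g) \<mapsto> x(hg)\<close>.
\<close>

definition noether_field :: "('g, 'b) monoid_scheme \<Rightarrow> ('g, 'k::field) ratfun set" where
  "noether_field \<Gamma> = {f \<in> rf_field (carrier \<Gamma>).
     \<forall>h\<in>carrier \<Gamma>. rf_subst (\<lambda>g. rf_var (h \<otimes>\<^bsub>\<Gamma>\<^esub> g)) f = f}"

definition noether_embedding ::
    "('h, 'b) monoid_scheme \<Rightarrow> ('h \<Rightarrow> 'g) \<Rightarrow> ('g, 'k::field) ratfun \<Rightarrow> ('h, 'k) ratfun" where
  "noether_embedding H \<pi> = rf_subst (\<lambda>g. \<Sum>h\<in>{h \<in> carrier H. \<pi> h = g}. rf_var h)"

section \<open>Groups and roots of unity\<close>

text \<open>The order of an infinite group is 0 in the library, so a finite \<open>p\<close>-group is indeed finite.\<close>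

definition finite_p_group :: "nat \<Rightarrow> ('a, 'b) monoid_scheme \<Rightarrow> bool" where
  "finite_p_group p \<Gamma> \<longleftrightarrow> group \<Gamma> \<and> (\<exists>a. Coset.order \<Gamma> = p ^ a)"

definition group_center :: "('a, 'b) monoid_scheme \<Rightarrow> 'a set" where
  "group_center \<Gamma> = {z \<in> carrier \<Gamma>. \<forall>x\<in>carrier \<Gamma>. z \<otimes>\<^bsub>\<Gamma>\<^esub> x = x \<otimes>\<^bsub>\<Gamma>\<^esub> z}"

definition group_exponent :: "('a, 'b) monoid_scheme \<Rightarrow> nat" where
  "group_exponent \<Gamma> = (LEAST k. 0 < k \<and> (\<forall>x\<in>carrier \<Gamma>. x [^]\<^bsub>\<Gamma>\<^esub> k = \<one>\<^bsub>\<Gamma>\<^esub>))"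

abbreviation derived_subgroup :: "('a, 'b) monoid_scheme \<Rightarrow> 'a set" where
  "derived_subgroup \<Gamma> \<equiv> derived \<Gamma> (carrier \<Gamma>)"

abbreviation abelianization :: "('a, 'b) monoid_scheme \<Rightarrow> 'a set monoid" where
  "abelianization \<Gamma> \<equiv> \<Gamma> Mod derived_subgroup \<Gamma>"

definition abelianization_image :: "('a, 'b) monoid_scheme \<Rightarrow> 'a set \<Rightarrow> 'a set set" where
  "abelianization_image \<Gamma> S = (\<lambda>x. derived_subgroup \<Gamma> #>\<^bsub>\<Gamma>\<^esub> x) ` S"

definition primitive_root_of_unity :: "nat \<Rightarrow> 'k::field \<Rightarrow> bool" where
  "primitive_root_of_unity k z \<longleftrightarrow> 0 < k \<and> z ^ k = 1 \<and> (\<forall>j. 0 < j \<and> j < k \<longrightarrow> z ^ j \<noteq> 1)"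

end

theory Submission
  imports Defs
begin

text \<open>
  Write \<open>y(g)\<close> for the sum of the \<open>x(h)\<close> over the fibre \<open>\<pi> h = g\<close>, so that \<open>K(G)\<close> is the fixed field of
  \<open>L = K(y(g) : g \<in> G)\<close>.  As \<open>H' \<inter> C\<close> is trivial, \<open>C\<close> embeds into the abelianization of \<open>H\<close>, and the roots of
  unity in \<open>K\<close> suffice to separate the points of \<open>C\<close> by characters of \<open>H\<close> with values in \<open>K\<close>.  For each character
  \<open>\<chi>\<close> from a set representing the dual of \<open>C\<close>, \<open>\<chi> \<noteq> 1\<close>, and each \<open>j < |G|\<close>, the element
  \<open>f(\<chi>, j) = \<Sum>h. y(\<pi> h)\<^sup>j \<chi>(h)\<^sup>-\<^sup>1 x(h)\<close> is a semi-invariant: \<open>t \<in> H\<close> multiplies it by \<open>\<chi>(t)\<close>.  By character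
  orthogonality and Lagrange interpolation these elements generate \<open>K(x(h) : h \<in> H)\<close> over \<open>L\<close>, and they are
  algebraically independent over \<open>L\<close>.  Adjoining them one at a time, each step \<open>M \<subseteq> M(u)\<close> contributes one
  generator to the fixed field, an invariant monomial \<open>a u\<^sup>d\<close> with \<open>a \<in> M\<close> of least degree \<open>d > 0\<close>.
\<close>

section \<open>Subfields of a field\<close>

text \<open>Everything rests on a fact about A = H/H': if K has a primitive k-th root of unity, an
  element of A that is no k-th power takes a value other than 1 under some character into K. No
  nontrivial c in C is a k-th power in A. In (i), x^(p^m) = c would put c into the cyclic group of
  x, whose order is then at most p^m by the choice of m, so x^(p^m) = 1. In (ii), x^(p^e) lies in
  the image of C, which has exponent p^n, so x^(p^(n+e)) = 1. The obstacle is that G permutes the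
  y(g): the character components of the x(h) over single fibres are permuted up to scalars and are
  not semi-invariant one by one. The weight y(\<pi> h)^j moves along with h, so the weighted sums
  over all of H are semi-invariant, and as the y(g) are distinct, |G| exponents suffice to recover
  the components. Independence is not obtained by counting transcendence degrees. For each
  semi-invariant and each c in K there is an explicit automorphism that translates it by a multiple
  of c and fixes L and the others; infinitely many c give infinitely many conjugates.\<close>

locale field_subset =
  fixes F :: "'a::field set"
  assumes zero: "0 \<in> F" and one: "1 \<in> F"
    and add: "\<And>x y. x \<in> F \<Longrightarrow> y \<in> F \<Longrightarrow> x + y \<in> F"
    and mult: "\<And>x y. x \<in> F \<Longrightarrow> y \<in> F \<Longrightarrow> x * y \<in> F"
    and uminus: "\<And>x. x \<in> F \<Longrightarrow> - x \<in> F"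
    and inverse: "\<And>x. x \<in> F \<Longrightarrow> inverse x \<in> F"
begin

lemma minus: "x \<in> F \<Longrightarrow> y \<in> F \<Longrightarrow> x - y \<in> F"
  using add[of x "- y"] uminus[of y] by simp

lemma divide: "x \<in> F \<Longrightarrow> y \<in> F \<Longrightarrow> x / y \<in> F"
  using mult[of x "inverse y"] inverse[of y] by (simp add: divide_inverse)

lemma power: "x \<in> F \<Longrightarrow> x ^ k \<in> F"
  by (induction k) (auto intro: one mult)

lemma sum: "(\<And>i. i \<in> I \<Longrightarrow> f i \<in> F) \<Longrightarrow> sum f I \<in> F"
  by (induction I rule: infinite_finite_induct) (auto intro: zero add)

lemma prod: "(\<And>i. i \<in> I \<Longrightarrow> f i \<in> F) \<Longrightarrow> prod f I \<in> F"
  by (induction I rule: infinite_finite_induct) (auto intro: one mult)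

end

abbreviation adjoin :: "'a::field set \<Rightarrow> 'a set" where
  "adjoin S \<equiv> generate_field ring_of_type_algebra S"

lemma ring_of_type_algebra_simps [simp]:
  "carrier ring_of_type_algebra = UNIV"
  "\<one>\<^bsub>ring_of_type_algebra\<^esub> = 1"
  "\<zero>\<^bsub>ring_of_type_algebra\<^esub> = 0"
  "(x::'a::field) \<oplus>\<^bsub>ring_of_type_algebra\<^esub> y = x + y"
  "x \<otimes>\<^bsub>ring_of_type_algebra\<^esub> y = x * y"
  by (simp_all add: ring_of_type_algebra_def)

lemma a_inv_ring_of_type_algebra [simp]:
  "\<ominus>\<^bsub>ring_of_type_algebra\<^esub> (x::'a::field) = - x"
proof -
  interpret field "ring_of_type_algebra :: 'a ring" by (rule field_from_type_algebra)
  show ?thesis by (rule minus_equality) simp_all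
qed

lemma m_inv_ring_of_type_algebra [simp]:
  assumes "(x::'a::field) \<noteq> 0"
  shows "inv\<^bsub>ring_of_type_algebra\<^esub> x = inverse x"
proof -
  interpret field "ring_of_type_algebra :: 'a ring" by (rule field_from_type_algebra)
  show ?thesis by (rule inv_char) (use assms in simp_all)
qed

text \<open>Transfers between the carrier-based subfields of \<open>rational_over\<close> and plain
  closure conditions. Closure under \<open>inverse\<close> can be stated without excluding 0, as
  \<open>inverse 0 = 0\<close>.\<close>

lemma subfield_iff_field_subset:
  "subfield F (ring_of_type_algebra :: 'a::field ring) \<longleftrightarrow> field_subset F"
proof -
  interpret field "ring_of_type_algebra :: 'a ring" by (rule field_from_type_algebra)
  show ?thesis
  proof
    assume F: "subfield F (ring_of_type_algebra :: 'a ring)"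
    note sub = subringE[OF subfieldE(1)[OF F], simplified]
    show "field_subset F"
    proof
      fix x assume "x \<in> F"
      then show "inverse x \<in> F"
        using subfield_m_inv(1)[OF F, of x] sub(2) by (cases "x = 0") auto
    qed (use sub in auto)
  next
    assume "field_subset F"
    then interpret field_subset F .
    show "subfield F (ring_of_type_algebra :: 'a ring)"
      by (rule subfieldI', rule subringI) (auto intro: one uminus mult add inverse)
  qed
qed

lemma field_subset_adjoin: "field_subset (adjoin S)"
proof -
  interpret field "ring_of_type_algebra :: 'a ring" by (rule field_from_type_algebra)
  show ?thesis
    using generate_field_is_subfield[of S] by (simp add: subfield_iff_field_subset)
qed

lemma adjoin_superset: "S \<subseteq> adjoin S"
  by (auto intro: generate_field.incl)

lemma adjoin_least: "field_subset F \<Longrightarrow> S \<subseteq> F \<Longrightarrow> adjoin S \<subseteq> F"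
proof -
  interpret field "ring_of_type_algebra :: 'a ring" by (rule field_from_type_algebra)
  show "field_subset F \<Longrightarrow> S \<subseteq> F \<Longrightarrow> adjoin S \<subseteq> F"
    using generate_field_min_subfield1[of S F] by (simp add: subfield_iff_field_subset)
qed

lemma adjoin_mono: "S \<subseteq> T \<Longrightarrow> adjoin S \<subseteq> adjoin T"
  by (meson adjoin_least adjoin_superset field_subset_adjoin order_trans)

lemma adjoin_eq: "field_subset F \<Longrightarrow> adjoin F = F"
  by (simp add: adjoin_least adjoin_superset subset_antisym)

lemma adjoin_adjoin_Un: "adjoin (adjoin S \<union> T) = adjoin (S \<union> T)"
proof (rule antisym)
  show "adjoin (adjoin S \<union> T) \<subseteq> adjoin (S \<union> T)"
    using adjoin_mono[of S "S \<union> T"] adjoin_superset[of "S \<union> T"]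
    by (intro adjoin_least field_subset_adjoin) auto
  show "adjoin (S \<union> T) \<subseteq> adjoin (adjoin S \<union> T)"
    using adjoin_superset[of S] by (intro adjoin_mono) auto
qed

text \<open>Relative to a set because \<open>rf_subst\<close> is a homomorphism only where
  denominators survive. Preservation of 0, negatives and inverses follows on a subfield.\<close>

definition field_hom_on :: "'a::field set \<Rightarrow> ('a \<Rightarrow> 'b::field) \<Rightarrow> bool" where
  "field_hom_on F f \<longleftrightarrow> f 1 = 1 \<and>
     (\<forall>x\<in>F. \<forall>y\<in>F. f (x + y) = f x + f y \<and> f (x * y) = f x * f y)"

locale field_hom = dom: field_subset F for F :: "'a::field set" +
  fixes f :: "'a \<Rightarrow> 'b::field"
  assumes hom: "field_hom_on F f"
begin

lemma one: "f 1 = 1"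
  and add: "x \<in> F \<Longrightarrow> y \<in> F \<Longrightarrow> f (x + y) = f x + f y"
  and mult: "x \<in> F \<Longrightarrow> y \<in> F \<Longrightarrow> f (x * y) = f x * f y"
  using hom by (simp_all add: field_hom_on_def)

lemma zero: "f 0 = 0"
  using add[of 0 0] dom.zero by (metis add_cancel_right_right add_0)

lemma uminus: "x \<in> F \<Longrightarrow> f (- x) = - f x"
  using add[of x "- x"] dom.uminus[of x] zero by (simp add: eq_neg_iff_add_eq_0 add.commute)

lemma minus: "x \<in> F \<Longrightarrow> y \<in> F \<Longrightarrow> f (x - y) = f x - f y"
  using add[of x "- y"] uminus[of y] dom.uminus[of y] by simp

lemma inverse: "x \<in> F \<Longrightarrow> f (inverse x) = inverse (f x)"
proof (cases "x = 0")
  case False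
  moreover assume "x \<in> F"
  ultimately have "f x * f (inverse x) = 1"
    using mult[of x "inverse x"] dom.inverse[of x] one by simp
  then show ?thesis by (metis inverse_unique)
qed (simp add: zero)

lemma eq_0_iff: "x \<in> F \<Longrightarrow> f x = 0 \<longleftrightarrow> x = 0"
  using mult[of x "Fields.inverse x"] dom.inverse[of x] one zero
  by (metis mult_zero_left right_inverse zero_neq_one)

lemma inj_on: "inj_on f F"
  by (rule inj_onI) (metis dom.minus eq_0_iff minus right_minus_eq)

lemma sum: "(\<And>i. i \<in> I \<Longrightarrow> g i \<in> F) \<Longrightarrow> f (sum g I) = (\<Sum>i\<in>I. f (g i))"
  by (induction I rule: infinite_finite_induct) (auto simp: zero add dom.sum)

lemma prod: "(\<And>i. i \<in> I \<Longrightarrow> g i \<in> F) \<Longrightarrow> f (prod g I) = (\<Prod>i\<in>I. f (g i))"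
  by (induction I rule: infinite_finite_induct) (auto simp: one mult dom.prod)

lemma power: "x \<in> F \<Longrightarrow> f (x ^ k) = f x ^ k"
  by (induction k) (auto simp: one mult dom.power)

lemma field_subset_image: "field_subset (f ` F)"
proof
  show "0 \<in> f ` F" "1 \<in> f ` F"
    using zero one dom.zero dom.one by (metis imageI)+
qed (auto simp flip: add mult uminus inverse
      intro!: imageI dom.add dom.mult dom.uminus dom.inverse)

lemma field_subset_vimage:
  assumes "field_subset F'"
  shows "field_subset {x \<in> F. f x \<in> F'}"
proof -
  interpret F': field_subset F' by fact
  show ?thesis
    by standard (auto simp: zero one add mult uminus inverse
        intro: dom.zero dom.one dom.add dom.mult dom.uminus dom.inverse
          F'.zero F'.one F'.add F'.mult F'.uminus F'.inverse)
qed

lemma image_adjoin: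
  assumes "F = adjoin S"
  shows "f ` F = adjoin (f ` S)"
proof (rule antisym)
  have "S \<subseteq> F" using assms adjoin_superset by blast
  then have "F \<subseteq> {x \<in> F. f x \<in> adjoin (f ` S)}"
    unfolding assms
    by (intro adjoin_least field_subset_vimage[unfolded assms] field_subset_adjoin)
      (auto intro: generate_field.incl)
  then show "f ` F \<subseteq> adjoin (f ` S)" by auto
  show "adjoin (f ` S) \<subseteq> f ` F"
    using \<open>S \<subseteq> F\<close> by (intro adjoin_least field_subset_image) auto
qed

end

lemma field_subset_equalizer:
  assumes "field_hom F f" "field_hom F g"
  shows "field_subset {x \<in> F. f x = g x}"
proof -
  interpret f: field_hom F f by fact
  interpret g: field_hom F g by fact
  show ?thesis
    by standard (auto simp: f.zero f.one f.add f.mult f.uminus f.inverse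
        g.zero g.one g.add g.mult g.uminus g.inverse
        intro: f.dom.zero f.dom.one f.dom.add f.dom.mult f.dom.uminus f.dom.inverse)
qed

text \<open>The equalizer of two homomorphisms is a subfield, so agreement spreads from
  generators.\<close>

lemma field_hom_eqI:
  assumes "field_hom (adjoin S) f" "field_hom (adjoin S) g"
    and "\<And>x. x \<in> S \<Longrightarrow> f x = g x" and "x \<in> adjoin S"
  shows "f x = g x"
  using adjoin_least[OF field_subset_equalizer[OF assms(1,2)], of S] assms(3,4) adjoin_superset[of S]
  by blast

lemma field_hom_comp:
  assumes "field_hom F f" "field_hom F' g" "f ` F \<subseteq> F'"
  shows "field_hom F (\<lambda>x. g (f x))"
proof -
  interpret f: field_hom F f by fact
  interpret g: field_hom F' g by fact
  show ?thesis
    using assms(3)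
    by unfold_locales (auto simp: field_hom_on_def f.one f.add f.mult g.one intro: g.add g.mult)
qed

lemma field_hom_subset: "field_hom F f \<Longrightarrow> field_subset F' \<Longrightarrow> F' \<subseteq> F \<Longrightarrow> field_hom F' f"
  by (auto simp: field_hom_def field_hom_axioms_def field_hom_on_def)

lemma field_subset_UNIV: "field_subset UNIV"
  by standard auto

lemma field_hom_id: "field_subset F \<Longrightarrow> field_hom F (\<lambda>x. x)"
  by (auto simp: field_hom_def field_hom_axioms_def field_hom_on_def)

section \<open>Homomorphisms out of polynomial rings\<close>

definition ring_hom_type :: "('a::comm_ring_1 \<Rightarrow> 'b::comm_ring_1) \<Rightarrow> bool" where
  "ring_hom_type f \<longleftrightarrow> f 1 = 1 \<and> (\<forall>x y. f (x + y) = f x + f y \<and> f (x * y) = f x * f y)"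

lemma ring_hom_typeD:
  assumes "ring_hom_type f"
  shows "f 1 = 1" "f (x + y) = f x + f y" "f (x * y) = f x * f y" "f 0 = 0"
    "f (- x) = - f x" "f (x - y) = f x - f y" "f (x ^ k) = f x ^ k"
    "f (sum g I) = (\<Sum>i\<in>I. f (g i))" "f (prod g I) = (\<Prod>i\<in>I. f (g i))"
proof -
  show 1: "f 1 = 1" using assms by (simp add: ring_hom_type_def)
  show 2: "f (x + y) = f x + f y" for x y using assms by (simp add: ring_hom_type_def)
  show 3: "f (x * y) = f x * f y" for x y using assms by (simp add: ring_hom_type_def)
  show 4: "f 0 = 0" using 2[of 0 0] by simp
  show 5: "f (- x) = - f x" for x
    using 2[of x "- x"] 4 by (simp add: eq_neg_iff_add_eq_0 add.commute)
  show "f (x - y) = f x - f y" using 2[of x "- y"] 5 by simp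
  show "f (x ^ k) = f x ^ k" by (induction k) (auto simp: 1 3)
  show "f (sum g I) = (\<Sum>i\<in>I. f (g i))"
    by (induction I rule: infinite_finite_induct) (auto simp: 2 4)
  show "f (prod g I) = (\<Prod>i\<in>I. f (g i))"
    by (induction I rule: infinite_finite_induct) (auto simp: 1 3)
qed

lemma ring_hom_type_comp:
  "ring_hom_type f \<Longrightarrow> ring_hom_type g \<Longrightarrow> ring_hom_type (\<lambda>x. g (f x))"
  by (simp add: ring_hom_type_def)

lemma ring_hom_type_mp_const: "ring_hom_type mp_const"
  unfolding ring_hom_type_def
  by (intro conjI allI mp_const_add mp_const_mult) (simp add: mp_const_def one_mpoly_def)

lemma ring_hom_type_rf_const: "ring_hom_type rf_const"
  by (simp add: ring_hom_type_def rf_const_add rf_const_mult rf_const_1)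

lemma ring_hom_type_Fract: "ring_hom_type (\<lambda>p::'a::idom. Fract p 1)"
  by (simp add: ring_hom_type_def One_fract_def)

lemma ring_hom_type_mp_eval:
  assumes "ring_hom_type c"
  shows "ring_hom_type (mp_eval c s)"
proof -
  note c = ring_hom_typeD[OF assms]
  have "mp_eval c s (p + q) = mp_eval c s p + mp_eval c s q" for p q
    by (transfer fixing: c s) (rule pm_eval_add; simp add: c)
  moreover have "mp_eval c s (p * q) = mp_eval c s p * mp_eval c s q" for p q
    by (transfer fixing: c s) (rule pm_eval_mult; simp add: c)
  moreover have "mp_eval c s 1 = 1"
    by (transfer fixing: c s) (simp add: pm_eval_def c)
  ultimately show ?thesis by (simp add: ring_hom_type_def)
qed

lemma mp_eval_mp_const:
  assumes "ring_hom_type c"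
  shows "mp_eval c s (mp_const a) = c a"
  by (transfer fixing: c s) (simp add: pm_eval_single ring_hom_typeD[OF assms])

lemma mp_eval_mp_var:
  assumes "ring_hom_type c"
  shows "mp_eval c s (mp_var v) = s v"
  by (transfer fixing: c s) (simp add: pm_eval_single ring_hom_typeD[OF assms])

text \<open>Every polynomial is a sum of constants times products of powers of its variables. The
  work is done on the underlying finite maps, where \<open>Q\<close> is \<open>P\<close> read
  through the type copy.\<close>

lemma mpoly_induct [consumes 1, case_names const var add mult]:
  fixes q :: "('v, 'k::comm_ring_1) mpoly"
  assumes "mp_vars q \<subseteq> V"
    and const: "\<And>a. P (mp_const a)" and var: "\<And>v. v \<in> V \<Longrightarrow> P (mp_var v)"
    and add: "\<And>p q. P p \<Longrightarrow> P q \<Longrightarrow> P (p + q)" and mult: "\<And>p q. P p \<Longrightarrow> P q \<Longrightarrow> P (p * q)"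
  shows "P q"
proof -
  define mvar where "mvar v = Poly_Mapping.single (Poly_Mapping.single v (1::nat)) (1::'k)" for v :: 'v
  define Q where "Q p = P (MPoly p)" for p
  have c: "Q (Poly_Mapping.single 0 a)" for a
    using const[of a] by (simp add: Q_def mp_const_def)
  have v: "Q (mvar v)" if "v \<in> V" for v
    using var[OF that] by (simp add: Q_def mvar_def mp_var_def)
  have a: "Q (r + r')" if "Q r" "Q r'" for r r'
    using add[of "MPoly r" "MPoly r'"] that by (simp add: Q_def plus_mpoly.abs_eq)
  have m: "Q (r * r')" if "Q r" "Q r'" for r r'
    using mult[of "MPoly r" "MPoly r'"] that by (simp add: Q_def times_mpoly.abs_eq)
  have 0: "Q 0" and 1: "Q 1"
    using c[of 0] c[of 1] by simp_all
  have sumI: "Q (sum g I)" if "\<And>i. i \<in> I \<Longrightarrow> Q (g i)" for g and I :: "('v \<Rightarrow>\<^sub>0 nat) set"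
    using that by (induction I rule: infinite_finite_induct) (auto intro: 0 a)
  have prodI: "Q (prod g I)" if "\<And>i. i \<in> I \<Longrightarrow> Q (g i)" for g and I :: "'v set"
    using that by (induction I rule: infinite_finite_induct) (auto intro: 1 m)
  have powI: "Q (r ^ k)" if "Q r" for r and k :: nat
    using that by (induction k) (auto intro: 1 m)
  have pow: "mvar v ^ k = Poly_Mapping.single (Poly_Mapping.single v k) 1" for v and k :: nat
    by (induction k) (simp_all add: mvar_def mult_single single_add[symmetric])
  have prod_single: "(\<Prod>v\<in>I. Poly_Mapping.single (g v) (1::'k)) = Poly_Mapping.single (sum g I) 1"
    for I and g :: "'v \<Rightarrow> 'v \<Rightarrow>\<^sub>0 nat"
    by (induction I rule: infinite_finite_induct) (simp_all add: mult_single)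
  have mon: "(\<Prod>v\<in>Poly_Mapping.keys n. mvar v ^ Poly_Mapping.lookup n v) = Poly_Mapping.single n 1" for n
    unfolding pow prod_single by (simp add: poly_mapping_sum_monomials)
  define r where "r = mapping_of q"
  have vars: "Poly_Mapping.keys n \<subseteq> V" if "n \<in> Poly_Mapping.keys r" for n
    using assms(1) that by (auto simp: mp_vars.rep_eq r_def)
  have "Q (\<Sum>n\<in>Poly_Mapping.keys r. Poly_Mapping.single 0 (Poly_Mapping.lookup r n) *
          (\<Prod>v\<in>Poly_Mapping.keys n. mvar v ^ Poly_Mapping.lookup n v))"
    using vars by (intro sumI m c prodI powI v) auto
  then have "Q r"
    unfolding mon by (simp add: mult_single poly_mapping_sum_monomials)
  then show ?thesis by (simp add: Q_def r_def mapping_of_inverse)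
qed

text \<open>Uniqueness half of the universal property of the polynomial ring; many identities
  between substitutions below reduce to it.\<close>

lemma mpoly_hom_eqI:
  assumes "mp_vars q \<subseteq> V" "ring_hom_type f" "ring_hom_type g"
    and "\<And>a. f (mp_const a) = g (mp_const a)" "\<And>v. v \<in> V \<Longrightarrow> f (mp_var v) = g (mp_var v)"
  shows "f q = g q"
  using assms(1)
  by (induction rule: mpoly_induct) (simp_all add: assms ring_hom_typeD[OF assms(2)] ring_hom_typeD[OF assms(3)])

lemma mp_vars_const: "mp_vars (mp_const a) = {}"
  by transfer (simp split: if_splits)

lemma mp_vars_var: "mp_vars (mp_var v :: ('v, 'k::comm_ring_1) mpoly) \<subseteq> {v}"
  by transfer simp

lemma mp_vars_add: "mp_vars (p + q) \<subseteq> mp_vars p \<union> mp_vars q"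
  by transfer (use Poly_Mapping.keys_add in fastforce)

lemma mp_vars_uminus: "mp_vars (- p) = mp_vars p"
  by transfer simp

lemma mp_vars_mult: "mp_vars (p * q) \<subseteq> mp_vars p \<union> mp_vars q"
proof transfer
  fix p q :: "('v \<Rightarrow>\<^sub>0 nat) \<Rightarrow>\<^sub>0 'k::comm_ring_1"
  show "(\<Union>m\<in>Poly_Mapping.keys (p * q). Poly_Mapping.keys m)
      \<subseteq> (\<Union>m\<in>Poly_Mapping.keys p. Poly_Mapping.keys m) \<union> (\<Union>m\<in>Poly_Mapping.keys q. Poly_Mapping.keys m)"
  proof
    fix v assume "v \<in> (\<Union>m\<in>Poly_Mapping.keys (p * q). Poly_Mapping.keys m)"
    then obtain a b where "a \<in> Poly_Mapping.keys p" "b \<in> Poly_Mapping.keys q" "v \<in> Poly_Mapping.keys (a + b)"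
      using Poly_Mapping.keys_mult[of p q] by blast
    then show "v \<in> (\<Union>m\<in>Poly_Mapping.keys p. Poly_Mapping.keys m) \<union> (\<Union>m\<in>Poly_Mapping.keys q. Poly_Mapping.keys m)"
      using Poly_Mapping.keys_add[of a b] by blast
  qed
qed

section \<open>Substitution in rational functions\<close>

abbreviation of_mpoly :: "('v, 'k::field) mpoly \<Rightarrow> ('v, 'k) ratfun" where
  "of_mpoly p \<equiv> Fract p 1"

lemma of_mpoly_const: "of_mpoly (mp_const a) = rf_const a"
  by (simp add: rf_const_def)

lemma of_mpoly_var: "of_mpoly (mp_var v) = rf_var v"
  by (simp add: rf_var_def)

lemmas of_mpoly_hom = ring_hom_typeD[OF ring_hom_type_Fract]

lemma of_mpoly_eq_iff: "of_mpoly p = of_mpoly q \<longleftrightarrow> p = q"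
  by (simp add: eq_fract)

lemma of_mpoly_in_rf_field: "mp_vars p \<subseteq> V \<Longrightarrow> of_mpoly p \<in> rf_field V"
proof (induction rule: mpoly_induct)
  case (const a)
  show ?case by (auto simp: of_mpoly_const rf_field_def intro: generate_field.incl)
next
  case (var v)
  then show ?case by (auto simp: of_mpoly_var rf_field_def intro: generate_field.incl)
next
  case (add p q)
  then show ?case
    by (simp add: of_mpoly_hom(2) rf_field_def field_subset.add[OF field_subset_adjoin] del: add_fract)
next
  case (mult p q)
  then show ?case
    by (simp add: of_mpoly_hom(3) rf_field_def field_subset.mult[OF field_subset_adjoin] del: mult_fract)
qed

lemma field_subset_rf_field: "field_subset (rf_field V)"
  by (simp add: rf_field_def field_subset_adjoin)

text \<open>Turns substitutions with independent values at all variables of the type into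
  homomorphisms on \<open>UNIV\<close>, the form in which the group action and the conjugating
  automorphisms are used.\<close>

lemma rf_field_UNIV: "rf_field UNIV = UNIV"
proof -
  have "f \<in> rf_field UNIV" for f :: "('v, 'k::field) ratfun"
  proof (cases f)
    case (Fract a b)
    then have "f = of_mpoly a / of_mpoly b" by simp
    then show ?thesis
      by (simp only:) (intro field_subset.divide[OF field_subset_rf_field] of_mpoly_in_rf_field subset_UNIV)
  qed
  then show ?thesis by blast
qed

text \<open>Fractions of polynomials in \<open>V\<close> already form a field containing the
  generators. Bounding the variables of the denominator lets independence on \<open>V\<close> alone
  keep it from vanishing.\<close>

lemma rf_field_repr:
  fixes f :: "('v, 'k::field) ratfun"
  assumes "f \<in> rf_field V"
  obtains a b where "f = Fract a b" "b \<noteq> 0" "mp_vars a \<subseteq> V" "mp_vars b \<subseteq> V"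
proof -
  let ?R = "\<lambda>f. \<exists>a b :: ('v, 'k) mpoly. f = Fract a b \<and> b \<noteq> 0 \<and> mp_vars a \<subseteq> V \<and> mp_vars b \<subseteq> V"
  have 0: "mp_vars (0 :: ('v, 'k) mpoly) = {}" and 1: "mp_vars (1 :: ('v, 'k) mpoly) = {}"
    using mp_vars_const[of "0 :: 'k"] mp_vars_const[of "1 :: 'k"]
    by (metis ring_hom_typeD(1,4)[OF ring_hom_type_mp_const])+
  have "field_subset {f. ?R f}"
  proof
    show "0 \<in> {f. ?R f}"
      unfolding Zero_fract_def mem_Collect_eq by (intro exI[of _ 0] exI[of _ 1]) (simp add: 0 1)
    show "1 \<in> {f. ?R f}"
      unfolding One_fract_def mem_Collect_eq by (intro exI[of _ 1]) (simp add: 1)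
    fix x assume "x \<in> {f. ?R f}"
    then obtain a b where x: "x = Fract a b" "b \<noteq> 0" "mp_vars a \<subseteq> V" "mp_vars b \<subseteq> V" by blast
    show "- x \<in> {f. ?R f}"
      unfolding mem_Collect_eq by (intro exI[of _ "- a"] exI[of _ b]) (simp add: x mp_vars_uminus)
    show "inverse x \<in> {f. ?R f}"
    proof (cases "a = 0")
      case True
      then show ?thesis using \<open>0 \<in> {f. ?R f}\<close> x by (simp add: fract_collapse)
    next
      case False
      then show ?thesis
        unfolding mem_Collect_eq by (intro exI[of _ b] exI[of _ a]) (simp add: x)
    qed
    fix y assume "y \<in> {f. ?R f}"
    then obtain c d where y: "y = Fract c d" "d \<noteq> 0" "mp_vars c \<subseteq> V" "mp_vars d \<subseteq> V" by blast
    have "mp_vars (a * d + c * b) \<subseteq> V" "mp_vars (a * c) \<subseteq> V" "mp_vars (b * d) \<subseteq> V"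
      using x y mp_vars_add[of "a * d" "c * b"] mp_vars_mult[of a d] mp_vars_mult[of c b]
        mp_vars_mult[of a c] mp_vars_mult[of b d] by blast+
    then show "x + y \<in> {f. ?R f}" "x * y \<in> {f. ?R f}"
      unfolding mem_Collect_eq using x y
      by (intro exI[of _ "a * d + c * b"] exI[of _ "b * d"], simp,
          intro exI[of _ "a * c"] exI[of _ "b * d"], simp)
  qed
  moreover have "range rf_const \<union> rf_var ` V \<subseteq> {f. ?R f}"
  proof -
    have "?R (rf_const a)" for a
      unfolding rf_const_def by (intro exI[of _ "mp_const a"] exI[of _ 1]) (simp add: 1 mp_vars_const)
    moreover have "?R (rf_var v)" if "v \<in> V" for v
      unfolding rf_var_def using that mp_vars_var[of v]
      by (intro exI[of _ "mp_var v"] exI[of _ 1]) (auto simp: 1)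
    ultimately show ?thesis by auto
  qed
  ultimately have "adjoin (range rf_const \<union> rf_var ` V) \<subseteq> {f. ?R f}"
    by (rule adjoin_least)
  then have "?R f" using assms unfolding rf_field_def by (rule CollectD[OF subsetD])
  then show ?thesis by (elim exE conjE) (rule that)
qed

text \<open>Algebraic independence over the constants of a family rather than of a set, so equal
  values at different indices are excluded. It is the condition under which no nonzero denominator
  in variables from \<open>V\<close> vanishes under \<open>s\<close>.\<close>

definition independent_values :: "('v \<Rightarrow> ('w, 'k::field) ratfun) \<Rightarrow> 'v set \<Rightarrow> bool" where
  "independent_values s V \<longleftrightarrow>
     (\<forall>q :: ('v, 'k) mpoly. mp_vars q \<subseteq> V \<longrightarrow> mp_eval rf_const s q = 0 \<longrightarrow> q = 0)"

lemmas mp_eval_rf_hom = ring_hom_type_mp_eval[OF ring_hom_type_rf_const]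
lemmas mp_eval_mp_hom = ring_hom_type_mp_eval[OF ring_hom_type_mp_const]
lemmas mp_eval_simps =
  mp_eval_mp_const[OF ring_hom_type_rf_const] mp_eval_mp_var[OF ring_hom_type_rf_const]
  mp_eval_mp_const[OF ring_hom_type_mp_const] mp_eval_mp_var[OF ring_hom_type_mp_const]

lemma mp_eval_of_mpoly:
  "mp_eval rf_const (\<lambda>v. of_mpoly (P v)) q = of_mpoly (mp_eval mp_const P q)"
  by (rule mpoly_hom_eqI[of q UNIV])
    (simp_all add: mp_eval_rf_hom ring_hom_type_comp[OF mp_eval_mp_hom ring_hom_type_Fract]
      mp_eval_simps of_mpoly_const)

lemma rf_subst_of_mpoly: "rf_subst s (of_mpoly q) = mp_eval rf_const s q"
  using rf_subst_Fract[of s 1 q] by (simp add: mp_eval_rf_1)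

text \<open>A left inverse suffices: substituting \<open>s'\<close> after \<open>P\<close> returns
  \<open>q\<close>, so \<open>q\<close> can be recovered from its value at \<open>s\<close>.\<close>

lemma independent_valuesI:
  fixes P :: "'v \<Rightarrow> ('w, 'k::field) mpoly" and s' :: "'w \<Rightarrow> ('v, 'k) ratfun"
  assumes s: "\<And>v. v \<in> V \<Longrightarrow> s v = of_mpoly (P v)"
    and inv: "\<And>v. v \<in> V \<Longrightarrow> mp_eval rf_const s' (P v) = rf_var v"
  shows "independent_values s V"
  unfolding independent_values_def
proof (intro allI impI)
  fix q :: "('v, 'k) mpoly"
  assume V: "mp_vars q \<subseteq> V" and "mp_eval rf_const s q = 0"
  moreover have "mp_eval rf_const s q = mp_eval rf_const (\<lambda>v. of_mpoly (P v)) q"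
    using V by (rule mpoly_hom_eqI) (simp_all add: mp_eval_rf_hom mp_eval_simps s)
  ultimately have "of_mpoly (mp_eval mp_const P q) = of_mpoly 0"
    by (simp add: mp_eval_of_mpoly fract_collapse)
  then have "mp_eval mp_const P q = 0" by (simp only: of_mpoly_eq_iff)
  moreover have "mp_eval rf_const s' (mp_eval mp_const P q) = of_mpoly q"
    using V by (rule mpoly_hom_eqI)
      (simp_all add: ring_hom_type_comp[OF mp_eval_mp_hom mp_eval_rf_hom] ring_hom_type_Fract
        mp_eval_simps inv of_mpoly_const of_mpoly_var)
  ultimately have "of_mpoly q = of_mpoly 0"
    by (simp add: mp_eval_rf_0 fract_collapse)
  then show "q = 0" by (simp only: of_mpoly_eq_iff)
qed

lemma independent_values_cong:
  fixes s s' :: "'v \<Rightarrow> ('w, 'k::field) ratfun"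
  assumes "\<And>v. v \<in> V \<Longrightarrow> s v = s' v" "independent_values s V"
  shows "independent_values s' V"
proof -
  have "mp_eval rf_const s q = mp_eval rf_const s' q" if "mp_vars q \<subseteq> V" for q :: "('v, 'k) mpoly"
    using that by (rule mpoly_hom_eqI) (simp_all add: mp_eval_rf_hom mp_eval_simps assms)
  then show ?thesis using assms(2) by (simp add: independent_values_def)
qed

lemma field_hom_rf_subst:
  fixes s :: "'v \<Rightarrow> ('w, 'k::field) ratfun"
  assumes s: "independent_values s V"
  shows "field_hom (rf_field V) (rf_subst s)"
proof -
  note h = ring_hom_typeD[OF mp_eval_rf_hom, of s]
  have "rf_subst s (x + y) = rf_subst s x + rf_subst s y \<and> rf_subst s (x * y) = rf_subst s x * rf_subst s y"
    if xy: "x \<in> rf_field V" "y \<in> rf_field V" for x y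
  proof -
    obtain a b where x: "x = Fract a b" "b \<noteq> 0" "mp_vars b \<subseteq> V"
      using xy(1) by (rule rf_field_repr)
    obtain c d where y: "y = Fract c d" "d \<noteq> 0" "mp_vars d \<subseteq> V"
      using xy(2) by (rule rf_field_repr)
    have "mp_eval rf_const s b \<noteq> 0" "mp_eval rf_const s d \<noteq> 0"
      using s x y by (auto simp: independent_values_def)
    with x y show ?thesis
      by (simp add: rf_subst_Fract h add_frac_eq)
  qed
  moreover have "rf_subst s 1 = 1"
    using rf_subst_const[of s 1] by (simp add: rf_const_1)
  ultimately show ?thesis
    by (simp add: field_hom_def field_hom_axioms_def field_hom_on_def field_subset_rf_field)
qed

lemma rf_subst_image:
  fixes s :: "'v \<Rightarrow> ('w, 'k::field) ratfun"
  assumes "independent_values s V"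
  shows "rf_subst s ` rf_field V = adjoin (range rf_const \<union> s ` V)"
proof -
  have "rf_subst s ` rf_field V = adjoin (rf_subst s ` (range rf_const \<union> rf_var ` V))"
    by (rule field_hom.image_adjoin[OF field_hom_rf_subst[OF assms]]) (simp add: rf_field_def)
  also have "rf_subst s ` (range rf_const \<union> rf_var ` V) = range rf_const \<union> s ` V"
    by (simp add: image_Un image_image rf_subst_const rf_subst_var)
  finally show ?thesis .
qed

lemma rf_field_hom_eqI:
  fixes f g :: "('v, 'k::field) ratfun \<Rightarrow> 'b::field"
  assumes "field_hom (rf_field V) f" "field_hom (rf_field V) g"
    and "\<And>a. f (rf_const a) = g (rf_const a)" "\<And>v. v \<in> V \<Longrightarrow> f (rf_var v) = g (rf_var v)"
    and "x \<in> rf_field V"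
  shows "f x = g x"
  using assms unfolding rf_field_def by (intro field_hom_eqI[of _ f g x]) auto

lemma rf_subst_cong:
  fixes s :: "'v \<Rightarrow> ('w, 'k::field) ratfun"
  assumes "independent_values s V" "\<And>v. v \<in> V \<Longrightarrow> s v = s' v" "x \<in> rf_field V"
  shows "rf_subst s x = rf_subst s' x"
  using field_hom_rf_subst[OF assms(1)]
    field_hom_rf_subst[OF independent_values_cong[OF assms(2,1)]]
  by (rule rf_field_hom_eqI) (simp_all add: rf_subst_const rf_subst_var assms)

section \<open>Transcendental elements and algebraic independence\<close>

definition transcendental_over :: "'a::field set \<Rightarrow> 'a \<Rightarrow> bool" where
  "transcendental_over F u \<longleftrightarrow> (\<forall>q. (\<forall>i. coeff q i \<in> F) \<longrightarrow> poly q u = 0 \<longrightarrow> q = 0)"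

lemma transcendental_over_subset:
  "transcendental_over F u \<Longrightarrow> F' \<subseteq> F \<Longrightarrow> transcendental_over F' u"
  unfolding transcendental_over_def by (meson subsetD)

lemma (in field_hom) poly:
  assumes "\<And>i. coeff q i \<in> F" "x \<in> F"
  shows "f (poly q x) = (\<Sum>i\<le>degree q. f (coeff q i) * f x ^ i)"
  unfolding poly_altdef using assms by (simp add: sum mult power dom.mult dom.power)

text \<open>A polynomial killing \<open>u\<close> would have all the conjugates \<open>\<tau> c u\<close> as roots.\<close>

lemma transcendental_over_if_conjugates:
  assumes \<tau>: "\<And>c. c \<in> S \<Longrightarrow> field_hom UNIV (\<tau> c)"
    and fixes_A: "\<And>c x. c \<in> S \<Longrightarrow> x \<in> A \<Longrightarrow> \<tau> c x = x"
    and inj: "inj_on (\<lambda>c. \<tau> c u) S" and S: "infinite S"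
  shows "transcendental_over (adjoin A) (u::'a::field)"
  unfolding transcendental_over_def
proof (intro allI impI)
  fix q :: "'a poly"
  assume q: "\<forall>i. coeff q i \<in> adjoin A" "poly q u = 0"
  have "poly q (\<tau> c u) = 0" if c: "c \<in> S" for c
  proof -
    interpret field_hom UNIV "\<tau> c" by (rule \<tau>[OF c])
    have "\<tau> c x = x" if "x \<in> adjoin A" for x
      by (rule field_hom_eqI[of A "\<tau> c" "\<lambda>x. x"])
        (use that in \<open>auto intro: field_hom_subset[OF \<tau>[OF c]] field_hom_id field_subset_adjoin fixes_A[OF c]\<close>)
    then have "\<tau> c (poly q u) = poly q (\<tau> c u)"
      using q(1) by (subst poly) (auto simp: poly_altdef)
    then show ?thesis using q zero by simp
  qed
  then have "(\<lambda>c. \<tau> c u) ` S \<subseteq> {x. poly q x = 0}" by auto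
  moreover have "infinite ((\<lambda>c. \<tau> c u) ` S)" using S inj by (simp add: finite_image_iff)
  ultimately show "q = 0" using poly_roots_finite[of q] finite_subset by blast
qed

lemma coeff_in_subset_mult:
  assumes "field_subset F" "\<And>i. coeff p i \<in> F" "\<And>i. coeff q i \<in> F"
  shows "coeff (p * q) i \<in> F"
  unfolding coeff_mult by (intro field_subset.sum[OF assms(1)] field_subset.mult[OF assms(1)] assms)

lemma coeff_in_subset_pcompose:
  assumes F: "field_subset F" and p: "\<And>i. coeff p i \<in> F" and q: "\<And>i. coeff q i \<in> F"
  shows "coeff (pcompose p q) i \<in> F"
  using p
proof (induction p arbitrary: i)
  case 0
  then show ?case using field_subset.zero[OF F] by simp
next
  case (pCons a p)
  have a: "a \<in> F" using pCons(3)[of 0] by simp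
  have "coeff p i \<in> F" for i using pCons(3)[of "Suc i"] by simp
  then have "coeff (pcompose p q) i \<in> F" for i by (rule pCons(2))
  then have "coeff (q * pcompose p q) i \<in> F" by (intro coeff_in_subset_mult F q)
  moreover have "coeff [:a:] i \<in> F"
    using a field_subset.zero[OF F] by (cases i) auto
  ultimately show ?case by (simp add: pcompose_pCons field_subset.add[OF F])
qed

text \<open>Composing a relation for \<open>a * u ^ d\<close> with \<open>monom a d\<close> gives
  one for \<open>u\<close> over the same field, and composition with a nonconstant polynomial kills
  no nonzero polynomial.\<close>

lemma transcendental_over_monomial:
  assumes F: "field_subset F" and u: "transcendental_over F u"
    and a: "a \<in> F" "a \<noteq> 0" and d: "d > 0"
  shows "transcendental_over F (a * u ^ d)"
  unfolding transcendental_over_def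
proof (intro allI impI)
  fix q assume q: "\<forall>i. coeff q i \<in> F" "poly q (a * u ^ d) = 0"
  have "poly (pcompose q (monom a d)) u = 0"
    using q by (simp add: poly_pcompose poly_monom)
  moreover have "coeff (pcompose q (monom a d)) i \<in> F" for i
    using q a field_subset.zero[OF F] by (intro coeff_in_subset_pcompose F) auto
  ultimately have "pcompose q (monom a d) = 0"
    using u by (simp add: transcendental_over_def)
  then show "q = 0"
    by (rule pcompose_eq_0) (use a d in \<open>simp add: degree_monom_eq\<close>)
qed

lemma pm_eval_id:
  "pm_eval id id q = (\<Sum>m\<in>Poly_Mapping.keys q. Poly_Mapping.lookup q m * monomial_eval id m)"
  by (simp add: pm_eval_def)

text \<open>A relation in \<theta> and \<open>B\<close> is read as a polynomial in \<theta> over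
  \<open>M\<close>. Its coefficients vanish as \<theta> is transcendental, and each of them is a
  relation over \<open>F\<close> among elements of \<open>B\<close>.\<close>

lemma alg_independent_insert:
  fixes F :: "'l::field set"
  assumes B: "alg_independent F B" and M: "field_subset M" "F \<subseteq> M" "B \<subseteq> M"
    and \<theta>: "transcendental_over M \<theta>" and F: "field_subset F"
  shows "alg_independent F (insert \<theta> B)"
  unfolding alg_independent_def
proof (intro allI impI)
  fix q' :: "('l, 'l) mpoly"
  assume q': "mp_coeffs q' \<subseteq> F \<and> mp_vars q' \<subseteq> insert \<theta> B \<and> mp_eval id id q' = 0"
  define q where "q = mapping_of q'"
  let ?K = "Poly_Mapping.keys q" and ?a = "Poly_Mapping.lookup q"
  have co: "?a m \<in> F" for m
    using q' field_subset.zero[OF F]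
    by (cases "m \<in> ?K") (auto simp: mp_coeffs.rep_eq q_def in_keys_iff)
  have vars: "Poly_Mapping.keys m \<subseteq> insert \<theta> B" if "m \<in> ?K" for m
    using q' that by (auto simp: mp_vars.rep_eq q_def)
  have eval: "(\<Sum>m\<in>?K. ?a m * monomial_eval id m) = 0"
    using q' by (simp add: mp_eval.rep_eq q_def pm_eval_id)
  \<comment> \<open>Each monomial splits into its power of \<theta> and the part
    \<open>red m\<close> in the other variables; \<open>P\<close> below collects the terms by that
    power.\<close>
  define deg where "deg m = Poly_Mapping.lookup m \<theta>" for m :: "'l \<Rightarrow>\<^sub>0 nat"
  define red where "red m = m - Poly_Mapping.single \<theta> (deg m)" for m :: "'l \<Rightarrow>\<^sub>0 nat"
  have split: "m = red m + Poly_Mapping.single \<theta> (deg m)" for m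
    by (rule poly_mapping_eqI) (auto simp: red_def deg_def lookup_add lookup_minus lookup_single when_def)
  have keys_red: "Poly_Mapping.keys (red m) \<subseteq> Poly_Mapping.keys m - {\<theta>}" for m
    by (auto simp: red_def deg_def in_keys_iff lookup_minus lookup_single when_def split: if_splits)
  have red_B: "Poly_Mapping.keys (red m) \<subseteq> B" if "m \<in> ?K" for m
    using keys_red[of m] vars[OF that] by blast
  define c where "c m = ?a m * monomial_eval id (red m)" for m
  define P where "P = (\<Sum>m\<in>?K. monom (c m) (deg m))"
  have mon: "monomial_eval id m = monomial_eval id (red m) * \<theta> ^ deg m" for m
    by (subst split[of m]) (simp add: monomial_eval_add)
  have "poly P \<theta> = (\<Sum>m\<in>?K. ?a m * monomial_eval id m)"
    unfolding P_def poly_sum poly_monom c_def by (intro sum.cong refl) (subst mon, simp)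
  then have "poly P \<theta> = 0" using eval by simp
  moreover have "coeff P i \<in> M" for i
  proof -
    have "monomial_eval id (red m) \<in> M" if "m \<in> ?K" for m
      unfolding monomial_eval_def using red_B[OF that] M
      by (auto intro!: field_subset.prod[OF M(1)] field_subset.power[OF M(1)])
    then have "c m \<in> M" if "m \<in> ?K" for m
      unfolding c_def using that co M by (intro field_subset.mult[OF M(1)]) auto
    then show ?thesis
      unfolding P_def coeff_sum using field_subset.zero[OF M(1)]
      by (intro field_subset.sum[OF M(1)]) auto
  qed
  ultimately have P0: "P = 0" using \<theta> by (simp add: transcendental_over_def)
  have "?a m0 = 0" for m0
  proof (rule ccontr)
    assume "?a m0 \<noteq> 0"
    then have m0: "m0 \<in> ?K" by (simp add: in_keys_iff)
    \<comment> \<open>The terms with the \<theta>-degree of \<open>m0\<close>. On them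
      \<open>red\<close> is injective, so \<open>r\<close> inherits the coefficients of
      \<open>q\<close> without cancellation, and its value is the coefficient of \<open>P\<close> at
      that degree.\<close>
    define Ki where "Ki = {m \<in> ?K. deg m = deg m0}"
    define r where "r = (\<Sum>m\<in>Ki. Poly_Mapping.single (red m) (?a m))"
    have inj: "m = m'" if "m \<in> Ki" "m' \<in> Ki" "red m = red m'" for m m'
      using that split[of m] split[of m'] by (simp add: Ki_def)
    have look: "Poly_Mapping.lookup r (red m) = ?a m" if "m \<in> Ki" for m
    proof -
      have "Poly_Mapping.lookup r (red m) = (\<Sum>m'\<in>Ki. ?a m' when red m' = red m)"
        by (simp add: r_def lookup_sum lookup_single)
      also have "\<dots> = (\<Sum>m'\<in>Ki. if m' = m then ?a m else 0)"
        using inj that by (intro sum.cong) (auto simp: when_def)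
      also have "\<dots> = ?a m" using that by (simp add: Ki_def)
      finally show ?thesis .
    qed
    have keys_r: "Poly_Mapping.keys r \<subseteq> red ` Ki"
    proof
      fix n assume "n \<in> Poly_Mapping.keys r"
      then have "(\<Sum>m'\<in>Ki. ?a m' when red m' = n) \<noteq> 0"
        by (simp add: r_def lookup_sum lookup_single in_keys_iff)
      then obtain m' where "m' \<in> Ki" "(?a m' when red m' = n) \<noteq> 0"
        by (meson sum.neutral)
      then show "n \<in> red ` Ki" by (auto simp: when_def split: if_splits)
    qed
    have "mp_coeffs (MPoly r) \<subseteq> F"
      using keys_r look co by (fastforce simp: mp_coeffs.rep_eq MPoly_inverse)
    moreover have "mp_vars (MPoly r) \<subseteq> B"
      using keys_r red_B by (fastforce simp: mp_vars.rep_eq MPoly_inverse Ki_def)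
    moreover have "mp_eval id id (MPoly r) = 0"
    proof -
      have "mp_eval id id (MPoly r) = (\<Sum>m\<in>Ki. c m)"
        by (simp add: mp_eval.rep_eq MPoly_inverse r_def pm_eval_sum pm_eval_single c_def)
      also have "\<dots> = (\<Sum>m\<in>?K. if deg m = deg m0 then c m else 0)"
        by (simp add: Ki_def sum.inter_filter)
      also have "\<dots> = coeff P (deg m0)"
        by (simp add: P_def coeff_sum)
      finally show ?thesis using P0 by simp
    qed
    ultimately have "MPoly r = 0" using B by (simp add: alg_independent_def)
    then have "r = 0" by (simp add: zero_mpoly_def MPoly_inject)
    then show False using look[of m0] m0 \<open>?a m0 \<noteq> 0\<close> by (simp add: Ki_def)
  qed
  then have "q = 0" by (intro poly_mapping_eqI) simp
  then show "q' = 0" by (metis q_def mapping_of_inverse zero_mpoly_def)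
qed

section \<open>Fixed fields of semi-invariant extensions\<close>

locale field_action = group H for H :: "('h, 'b) monoid_scheme" (structure) +
  fixes \<sigma> :: "'h \<Rightarrow> 'a::field \<Rightarrow> 'a"
  assumes finite_group: "finite (carrier H)"
    and action_hom: "\<And>t. t \<in> carrier H \<Longrightarrow> field_hom UNIV (\<sigma> t)"
    and action_comp: "\<And>s t x. s \<in> carrier H \<Longrightarrow> t \<in> carrier H \<Longrightarrow> \<sigma> s (\<sigma> t x) = \<sigma> (s \<otimes> t) x"
    and action_one: "\<And>x. \<sigma> \<one> x = x"
begin

definition fixed_field :: "'a set \<Rightarrow> 'a set" where
  "fixed_field M = {x \<in> M. \<forall>t\<in>carrier H. \<sigma> t x = x}"

lemma field_subset_fixed_field:
  assumes "field_subset M"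
  shows "field_subset (fixed_field M)"
proof -
  interpret field_subset M by fact
  note h = field_hom.zero[OF action_hom] field_hom.one[OF action_hom] field_hom.add[OF action_hom]
    field_hom.mult[OF action_hom] field_hom.uminus[OF action_hom] field_hom.inverse[OF action_hom]
  show ?thesis
    by standard (auto simp: fixed_field_def h intro: zero one add mult uminus inverse)
qed

text \<open>Left translation by \<open>s\<close> permutes the factors. The norm of a semi-invariant
  yields a first invariant monomial, and the norm of a denominator is an invariant
  denominator.\<close>

lemma norm_fixed:
  assumes "s \<in> carrier H"
  shows "\<sigma> s (\<Prod>t\<in>carrier H. \<sigma> t x) = (\<Prod>t\<in>carrier H. \<sigma> t x)"
proof -
  interpret s: field_hom UNIV "\<sigma> s" using assms by (rule action_hom)
  have "\<sigma> s (\<Prod>t\<in>carrier H. \<sigma> t x) = (\<Prod>t\<in>carrier H. \<sigma> (s \<otimes> t) x)"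
    using assms by (simp add: s.prod action_comp)
  also have "\<dots> = (\<Prod>t\<in>carrier H. \<sigma> t x)"
    by (rule prod.reindex_bij_witness[of _ "\<lambda>t. inv s \<otimes> t" "\<lambda>t. s \<otimes> t"])
      (use assms in \<open>auto simp: m_assoc[symmetric]\<close>)
  finally show ?thesis .
qed

end

text \<open>
  The invariants of \<open>M[u]\<close> are spanned by invariant monomials \<open>a u\<^sup>i\<close>, and these are the multiples of
  the powers of the invariant monomial \<open>\<theta>\<close> of least positive degree.  Every invariant of \<open>M(u)\<close> is a
  quotient of invariants of \<open>M[u]\<close>, as its denominator may be replaced by its norm.
\<close>

lemma (in field_action) fixed_field_semi_invariant:
  assumes M: "field_subset M" and stable: "\<And>t x. t \<in> carrier H \<Longrightarrow> x \<in> M \<Longrightarrow> \<sigma> t x \<in> M"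
    and u: "transcendental_over M u"
    and semi: "\<And>t. t \<in> carrier H \<Longrightarrow> \<sigma> t u = \<chi> t * u" and \<chi>: "\<And>t. t \<in> carrier H \<Longrightarrow> \<chi> t \<in> M"
  obtains \<theta> where "\<theta> \<in> adjoin (M \<union> {u})" "transcendental_over M \<theta>"
    "fixed_field (adjoin (M \<union> {u})) = adjoin (fixed_field M \<union> {\<theta>})"
proof -
  interpret M: field_subset M by fact
  define Mu where "Mu = adjoin (M \<union> {u})"
  interpret Mu: field_subset Mu unfolding Mu_def by (rule field_subset_adjoin)
  have M_Mu: "M \<subseteq> Mu" and u_Mu: "u \<in> Mu"
    unfolding Mu_def using adjoin_superset by blast+
  \<comment> \<open>The ring M[u].\<close>
  define R where "R = {poly P u | P. \<forall>i. coeff P i \<in> M}"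
  have u0: "u \<noteq> 0"
  proof
    assume "u = 0"
    then have "poly [:0, 1:] u = 0" by simp
    moreover have "\<forall>i. coeff [:0, 1:] i \<in> M"
      by (auto simp: coeff_pCons M.zero M.one split: nat.splits)
    ultimately have "[:0, 1::'a:] = 0" using u unfolding transcendental_over_def by blast
    then show False by simp
  qed
  have R_add: "x + y \<in> R" if xy: "x \<in> R" "y \<in> R" for x y
  proof -
    obtain P Q where "x = poly P u" "y = poly Q u" "\<forall>i. coeff P i \<in> M" "\<forall>i. coeff Q i \<in> M"
      using xy unfolding R_def by blast
    then show ?thesis unfolding R_def by (intro CollectI exI[of _ "P + Q"]) (auto intro: M.add)
  qed
  have R_mult: "x * y \<in> R" if xy: "x \<in> R" "y \<in> R" for x y
  proof -
    obtain P Q where "x = poly P u" "y = poly Q u" "\<forall>i. coeff P i \<in> M" "\<forall>i. coeff Q i \<in> M"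
      using xy unfolding R_def by blast
    then show ?thesis
      unfolding R_def by (intro CollectI exI[of _ "P * Q"]) (auto intro: coeff_in_subset_mult[OF M])
  qed
  have R_M: "x \<in> R" if "x \<in> M" for x
    unfolding R_def using that
    by (intro CollectI exI[of _ "[:x:]"]) (auto simp: coeff_pCons M.zero split: nat.splits)
  have R_u: "u \<in> R"
    unfolding R_def
    by (intro CollectI exI[of _ "[:0, 1:]"]) (auto simp: coeff_pCons M.zero M.one split: nat.splits)
  have R_prod: "prod f I \<in> R" if "\<And>i. i \<in> I \<Longrightarrow> f i \<in> R" for f and I :: "'h set"
    using that by (induction I rule: infinite_finite_induct) (auto intro: R_M M.one R_mult)
  have R_Mu: "R \<subseteq> Mu"
    using M_Mu u_Mu by (auto simp: R_def poly_altdef intro!: Mu.sum Mu.mult Mu.power)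
  have \<sigma>_poly: "\<sigma> t (poly P u) = (\<Sum>i\<le>degree P. (\<sigma> t (coeff P i) * \<chi> t ^ i) * u ^ i)"
    if "t \<in> carrier H" for t P
    using that by (simp add: field_hom.poly[OF action_hom] semi power_mult_distrib mult.assoc)
  have R_sum: "(\<Sum>i\<le>n. a i * u ^ i) \<in> R" if "\<And>i. i \<le> n \<Longrightarrow> a i \<in> M" for a and n :: nat
  proof -
    have pw: "u ^ i \<in> R" for i by (induction i) (auto intro: R_M M.one R_mult R_u)
    have sum: "sum f I \<in> R" if "\<And>i. i \<in> I \<Longrightarrow> f i \<in> R" for f and I :: "nat set"
      using that by (induction I rule: infinite_finite_induct) (auto intro: R_M M.zero R_add)
    show ?thesis by (intro sum R_mult R_M pw that) auto
  qed
  have R_\<sigma>: "\<sigma> t x \<in> R" if t: "t \<in> carrier H" and "x \<in> R" for t x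
  proof -
    obtain P where P: "x = poly P u" "\<forall>i. coeff P i \<in> M" using \<open>x \<in> R\<close> unfolding R_def by blast
    then show ?thesis
      unfolding P(1) \<sigma>_poly[OF t] by (intro R_sum M.mult M.power stable \<chi> t) auto
  qed
  \<comment> \<open>Quotients of elements of M[u] form a field containing \<open>M\<close> and
    \<open>u\<close>, hence exhaust \<open>Mu\<close>.\<close>
  have frac: "\<exists>x\<in>R. \<exists>y\<in>R. y \<noteq> 0 \<and> z = x / y" if "z \<in> Mu" for z
  proof -
    let ?Q = "{z. \<exists>x\<in>R. \<exists>y\<in>R. y \<noteq> 0 \<and> z = x / y}"
    have R0: "0 \<in> R" and R1: "1 \<in> R" by (auto intro: R_M M.zero M.one)
    have QI: "x / y \<in> ?Q" if "x \<in> R" "y \<in> R" "y \<noteq> 0" for x y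
      using that by blast
    have RQ: "x \<in> ?Q" if "x \<in> R" for x using QI[OF that R1] by simp
    have "field_subset ?Q"
    proof
      show "0 \<in> ?Q" by (rule RQ[OF R0])
      show "1 \<in> ?Q" by (rule RQ[OF R1])
      fix z assume "z \<in> ?Q"
      then obtain x y where z: "x \<in> R" "y \<in> R" "y \<noteq> 0" "z = x / y" by blast
      have "- 1 * x \<in> R" by (intro R_mult z R_M M.uminus M.one)
      then show "- z \<in> ?Q" using QI[of "- 1 * x" y] z by simp
      show "inverse z \<in> ?Q"
        using QI[of y x] RQ[OF R0] z by (cases "x = 0") auto
      fix z' assume "z' \<in> ?Q"
      then obtain x' y' where z': "x' \<in> R" "y' \<in> R" "y' \<noteq> 0" "z' = x' / y'" by blast
      have "z + z' = (x * y' + x' * y) / (y * y')"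
        using z z' by (simp add: add_frac_eq)
      moreover have "(x * y' + x' * y) / (y * y') \<in> ?Q"
        using z z' by (intro QI R_add R_mult) auto
      ultimately show "z + z' \<in> ?Q" by simp
      have "(x * x') / (y * y') \<in> ?Q"
        using z z' by (intro QI R_mult) auto
      then show "z * z' \<in> ?Q" using z z' by simp
    qed
    moreover have "M \<union> {u} \<subseteq> ?Q" using RQ[OF R_M] RQ[OF R_u] by (intro subsetI) auto
    ultimately have "Mu \<subseteq> ?Q" unfolding Mu_def by (rule adjoin_least)
    then show ?thesis using that by blast
  qed
  \<comment> \<open>The coefficient 0 is allowed, so that all coefficients of an invariant
    polynomial qualify; the search for the least degree therefore asks for
    \<open>a \<noteq> 0\<close> separately.\<close>
  define inv_mono where "inv_mono i a \<longleftrightarrow> a \<in> M \<and> (\<forall>t\<in>carrier H. \<sigma> t (a * u ^ i) = a * u ^ i)" for i a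
  \<comment> \<open>The norm of \<open>u\<close> is such a monomial, its factors being
    \<open>\<chi> t * u\<close>.\<close>
  have "\<exists>d>0. \<exists>a. a \<noteq> 0 \<and> inv_mono d a"
  proof (intro exI[of _ "card (carrier H)"] conjI exI[of _ "\<Prod>t\<in>carrier H. \<chi> t"])
    show "card (carrier H) > 0" using finite_group by (auto simp: card_gt_0_iff)
    have "\<chi> t \<noteq> 0" if "t \<in> carrier H" for t
      using semi[OF that] field_hom.eq_0_iff[OF action_hom[OF that], of u] u0 by auto
    then show "(\<Prod>t\<in>carrier H. \<chi> t) \<noteq> 0" using finite_group by simp
    have "(\<Prod>t\<in>carrier H. \<chi> t) * u ^ card (carrier H) = (\<Prod>t\<in>carrier H. \<sigma> t u)"
      by (simp add: semi prod.distrib)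
    then show "inv_mono (card (carrier H)) (\<Prod>t\<in>carrier H. \<chi> t)"
      by (auto simp: inv_mono_def norm_fixed intro: M.prod \<chi>)
  qed
  then obtain d where d: "d > 0" "\<exists>a. a \<noteq> 0 \<and> inv_mono d a"
    and d_min: "\<And>i. i < d \<Longrightarrow> \<not> (i > 0 \<and> (\<exists>a. a \<noteq> 0 \<and> inv_mono i a))"
    using exists_least_iff[of "\<lambda>d. d > 0 \<and> (\<exists>a. a \<noteq> 0 \<and> inv_mono d a)"] by blast
  obtain b where b: "b \<noteq> 0" "inv_mono d b" using d(2) by blast
  define \<theta> where "\<theta> = b * u ^ d"
  have b_M: "b \<in> M" and \<theta>_fixed: "\<And>t. t \<in> carrier H \<Longrightarrow> \<sigma> t \<theta> = \<theta>"
    using b by (auto simp: inv_mono_def \<theta>_def)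
  have \<theta>_Mu: "\<theta> \<in> Mu" unfolding \<theta>_def using b_M M_Mu u_Mu by (auto intro: Mu.mult Mu.power)
  define N where "N = adjoin (fixed_field M \<union> {\<theta>})"
  interpret N: field_subset N unfolding N_def by (rule field_subset_adjoin)
  have N_gen: "fixed_field M \<subseteq> N" "\<theta> \<in> N" unfolding N_def using adjoin_superset by blast+
  have mono: "a * u ^ i \<in> N" if "inv_mono i a" for i a
  proof (cases "a = 0")
    case False
    \<comment> \<open>Dividing by \<open>\<theta> ^ q\<close> leaves an invariant monomial of degree
      \<open>r < d\<close>. By minimality of \<open>d\<close> its degree is 0, so its coefficient
      lies in the fixed field of \<open>M\<close>.\<close>
    define q r where "q = i div d" and "r = i mod d"
    have i: "i = d * q + r" by (simp add: q_def r_def)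
    have \<theta>0: "\<theta> \<noteq> 0" using b u0 by (simp add: \<theta>_def)
    define a' where "a' = a / b ^ q"
    have eq: "a * u ^ i = a' * u ^ r * \<theta> ^ q"
      using b by (simp add: a'_def \<theta>_def i power_add power_mult power_mult_distrib)
    have a'M: "a' \<in> M" using that b_M by (auto simp: a'_def inv_mono_def intro: M.divide M.power)
    have "\<sigma> t (a' * u ^ r) = a' * u ^ r" if t: "t \<in> carrier H" for t
    proof -
      interpret t: field_hom UNIV "\<sigma> t" by (rule action_hom[OF t])
      have "\<sigma> t (a' * u ^ r * \<theta> ^ q) = a' * u ^ r * \<theta> ^ q"
        using \<open>inv_mono i a\<close> t unfolding eq[symmetric] by (simp add: inv_mono_def)
      then have "\<sigma> t (a' * u ^ r) * \<theta> ^ q = a' * u ^ r * \<theta> ^ q"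
        using \<theta>_fixed[OF t] t.mult[of "a' * u ^ r" "\<theta> ^ q"] t.power[of \<theta> q] by simp
      then show ?thesis using \<theta>0 by simp
    qed
    then have r: "inv_mono r a'" using a'M by (simp add: inv_mono_def)
    moreover have "a' \<noteq> 0" using False b by (simp add: a'_def)
    moreover have "r < d" using d by (simp add: r_def)
    ultimately have "r = 0" using d_min[of r] by auto
    then have "a' \<in> fixed_field M" using r by (simp add: inv_mono_def fixed_field_def)
    then show ?thesis
      unfolding eq using \<open>r = 0\<close> N_gen by (auto intro: N.mult N.power)
  qed (simp add: N.zero)
  have inv_R: "x \<in> N" if x: "x \<in> R" "\<And>t. t \<in> carrier H \<Longrightarrow> \<sigma> t x = x" for x
  proof -
    obtain P where P: "x = poly P u" "\<And>i. coeff P i \<in> M" using x(1) by (auto simp: R_def)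
    have "inv_mono i (coeff P i)" for i
      unfolding inv_mono_def
    proof (intro conjI ballI P(2))
      fix t assume t: "t \<in> carrier H"
      interpret t: field_hom UNIV "\<sigma> t" by (rule action_hom[OF t])
      \<comment> \<open>\<open>Q\<close> expresses the difference of \<open>\<sigma> t x\<close> and
        \<open>x\<close> as a polynomial in \<open>u\<close>. Transcendence of \<open>u\<close>
        turns invariance of \<open>x\<close> into invariance of each single term.\<close>
      define Q where "Q = (\<Sum>i\<le>degree P. monom (\<sigma> t (coeff P i) * \<chi> t ^ i - coeff P i) i)"
      have co_Q: "coeff Q i = \<sigma> t (coeff P i) * \<chi> t ^ i - coeff P i" for i
      proof (cases "i \<le> degree P")
        case True
        then show ?thesis by (simp add: Q_def coeff_sum)
      next
        case False
        then have "coeff P i = 0" by (simp add: coeff_eq_0)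
        with False show ?thesis by (simp add: Q_def coeff_sum t.zero)
      qed
      have "poly Q u = \<sigma> t (poly P u) - poly P u"
        by (simp add: Q_def poly_sum poly_monom \<sigma>_poly[OF t] left_diff_distrib sum_subtractf)
          (simp add: poly_altdef)
      then have "poly Q u = 0" using x(2)[OF t] P(1) by simp
      moreover have "coeff Q i \<in> M" for i
        unfolding co_Q by (intro M.minus M.mult M.power stable \<chi> P t)
      ultimately have "Q = 0" using u by (simp add: transcendental_over_def)
      then have "\<sigma> t (coeff P i) * \<chi> t ^ i = coeff P i" using co_Q[of i] by simp
      then show "\<sigma> t (coeff P i * u ^ i) = coeff P i * u ^ i"
        by (simp add: t.mult t.power semi[OF t] power_mult_distrib flip: mult.assoc)
    qed
    then show ?thesis
      unfolding P(1) poly_altdef by (intro N.sum mono)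
  qed
  have "fixed_field Mu = N"
  proof
    have "fixed_field M \<union> {\<theta>} \<subseteq> fixed_field Mu"
      using M_Mu \<theta>_Mu \<theta>_fixed by (auto simp: fixed_field_def)
    then show "N \<subseteq> fixed_field Mu"
      unfolding N_def by (intro adjoin_least field_subset_fixed_field Mu.field_subset_axioms)
    show "fixed_field Mu \<subseteq> N"
    proof
      fix z assume z: "z \<in> fixed_field Mu"
      then obtain x y where xy: "x \<in> R" "y \<in> R" "y \<noteq> 0" "z = x / y"
        using frac unfolding fixed_field_def by blast
      \<comment> \<open>Splitting off the factor at the unit shows that the norm is \<open>y\<close>
        times an element of M[u], so \<open>z * n\<close> is again in M[u].\<close>
      define n where "n = (\<Prod>t\<in>carrier H. \<sigma> t y)"
      have n: "n = y * (\<Prod>t\<in>carrier H - {\<one>}. \<sigma> t y)"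
        using prod.remove[OF finite_group one_closed, of "\<lambda>t. \<sigma> t y"] by (simp add: n_def action_one)
      have n0: "n \<noteq> 0"
        unfolding n_def using finite_group xy field_hom.eq_0_iff[OF action_hom, of _ y] by auto
      have n_fix: "\<sigma> t n = n" if "t \<in> carrier H" for t
        unfolding n_def using that by (rule norm_fixed)
      have nR: "n \<in> R" unfolding n_def by (intro R_prod R_\<sigma> xy)
      have "z * n = x * (\<Prod>t\<in>carrier H - {\<one>}. \<sigma> t y)" using xy n by simp
      then have "z * n \<in> R" using xy by (auto intro: R_mult R_prod R_\<sigma>)
      moreover have "\<sigma> t (z * n) = z * n" if "t \<in> carrier H" for t
        using z n_fix[OF that] that field_hom.mult[OF action_hom[OF that], of z n]
        by (simp add: fixed_field_def)
      ultimately have "z * n \<in> N" by (intro inv_R)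
      moreover have "n \<in> N" by (intro inv_R nR n_fix)
      ultimately have "(z * n) / n \<in> N" by (rule N.divide)
      then show "z \<in> N" using n0 by simp
    qed
  qed
  then show ?thesis
    using that[of \<theta>] \<theta>_Mu transcendental_over_monomial[OF M u b_M b(1) d(1)]
    by (simp add: Mu_def N_def \<theta>_def)
qed

text \<open>Transcendence of each \<open>f i\<close> over the field generated by all the others
  serves every order of adjunction, since the field \<open>M\<close> reached before
  \<open>f i\<close> lies in that one. \<open>M\<close> stays stable because the action multiplies
  its generators \<open>f j\<close> by scalars from \<open>L\<close>.\<close>

theorem (in field_action) rational_over_semi_invariants:
  assumes L: "field_subset L" and stable: "\<And>t x. t \<in> carrier H \<Longrightarrow> x \<in> L \<Longrightarrow> \<sigma> t x \<in> L"
    and I: "finite I"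
    and trans: "\<And>i. i \<in> I \<Longrightarrow> transcendental_over (adjoin (L \<union> f ` (I - {i}))) (f i)"
    and semi: "\<And>i t. i \<in> I \<Longrightarrow> t \<in> carrier H \<Longrightarrow> \<sigma> t (f i) = \<chi> i t * f i"
    and \<chi>: "\<And>i t. i \<in> I \<Longrightarrow> t \<in> carrier H \<Longrightarrow> \<chi> i t \<in> L"
  shows "rational_over (fixed_field (adjoin (L \<union> f ` I))) (fixed_field L)"
proof -
  have fL: "field_subset (fixed_field L)" by (rule field_subset_fixed_field[OF L])
  \<comment> \<open>The inclusion of \<open>B\<close> in the current field is carried along because
    the next \<theta> is transcendental over that field and can therefore be joined to
    \<open>B\<close>.\<close>
  have "\<exists>B. alg_independent (fixed_field L) B \<and> B \<subseteq> adjoin (L \<union> f ` J) \<and>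
      fixed_field (adjoin (L \<union> f ` J)) = adjoin (fixed_field L \<union> B)" if "J \<subseteq> I" for J
    using finite_subset[OF that I] that
  proof (induction J)
    case empty
    have "alg_independent (fixed_field L) {}"
      unfolding alg_independent_def
    proof (intro allI impI)
      fix q :: "('a, 'a) mpoly"
      assume q: "mp_coeffs q \<subseteq> fixed_field L \<and> mp_vars q \<subseteq> {} \<and> mp_eval id id q = 0"
      have id: "ring_hom_type (id :: 'a \<Rightarrow> 'a)" "ring_hom_type (\<lambda>q :: ('a, 'a) mpoly. q)"
        by (simp_all add: ring_hom_type_def)
      \<comment> \<open>Without variables \<open>q\<close> is a constant, and its value is that
        constant.\<close>
      have "q = mp_const (mp_eval id id q)"
        by (rule mpoly_hom_eqI[of q "{}", OF _ id(2)
              ring_hom_type_comp[OF ring_hom_type_mp_eval[OF id(1)] ring_hom_type_mp_const]])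
          (use q in \<open>auto simp: mp_eval_mp_const[OF id(1)]\<close>)
      then show "q = 0" using q by (simp add: ring_hom_typeD(4)[OF ring_hom_type_mp_const])
    qed
    then show ?case by (intro exI[of _ "{}"]) (simp add: adjoin_eq L fL)
  next
    case (insert i J)
    then obtain B where B: "alg_independent (fixed_field L) B" "B \<subseteq> adjoin (L \<union> f ` J)"
      "fixed_field (adjoin (L \<union> f ` J)) = adjoin (fixed_field L \<union> B)" by blast
    define M where "M = adjoin (L \<union> f ` J)"
    have M: "field_subset M" unfolding M_def by (rule field_subset_adjoin)
    have LM: "L \<subseteq> M" and fM: "f ` J \<subseteq> M"
      unfolding M_def using adjoin_superset[of "L \<union> f ` J"] by auto
    have "M \<subseteq> adjoin (L \<union> f ` (I - {i}))"
      unfolding M_def using insert(2,4) by (intro adjoin_mono) auto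
    then have "transcendental_over M (f i)"
      using trans[of i] insert(4) transcendental_over_subset by blast
    moreover have "\<sigma> t x \<in> M" if t: "t \<in> carrier H" and x: "x \<in> M" for t x
    proof -
      have "L \<union> f ` J \<subseteq> {x \<in> UNIV. \<sigma> t x \<in> M}"
      proof
        fix y assume "y \<in> L \<union> f ` J"
        then consider "y \<in> L" | j where "j \<in> J" "y = f j" by blast
        then show "y \<in> {x \<in> UNIV. \<sigma> t x \<in> M}"
        proof cases
          case 1
          then show ?thesis using stable[OF t] LM by blast
        next
          case 2
          then have "\<chi> j t \<in> M" "f j \<in> M" "j \<in> I" using \<chi>[OF _ t] LM fM insert(4) by blast+
          then show ?thesis using semi[OF _ t] 2 field_subset.mult[OF M] by simp
        qed
      qed
      then have "M \<subseteq> {x \<in> UNIV. \<sigma> t x \<in> M}"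
        using adjoin_least[OF field_hom.field_subset_vimage[OF action_hom[OF t] M]]
        unfolding M_def by blast
      then show ?thesis using x by blast
    qed
    moreover have "\<sigma> t (f i) = \<chi> i t * f i" "\<chi> i t \<in> M" if "t \<in> carrier H" for t
      using semi[of i t] \<chi>[of i t] LM insert(4) that by auto
    ultimately obtain \<theta> where \<theta>: "\<theta> \<in> adjoin (M \<union> {f i})" "transcendental_over M \<theta>"
      "fixed_field (adjoin (M \<union> {f i})) = adjoin (fixed_field M \<union> {\<theta>})"
      using fixed_field_semi_invariant[OF M, of "f i" "\<chi> i"] by metis
    have eq: "adjoin (M \<union> {f i}) = adjoin (L \<union> f ` insert i J)"
      using adjoin_adjoin_Un[of "L \<union> f ` J" "{f i}"] by (simp add: M_def)
    have "alg_independent (fixed_field L) (insert \<theta> B)"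
      using alg_independent_insert[OF B(1) M _ _ \<theta>(2) fL] LM B(2)
      unfolding M_def by (auto simp: fixed_field_def)
    moreover have "fixed_field (adjoin (L \<union> f ` insert i J)) = adjoin (fixed_field L \<union> insert \<theta> B)"
      using \<theta>(3) adjoin_adjoin_Un[of "fixed_field L \<union> B" "{\<theta>}"]
      by (simp only: eq B(3)[folded M_def]) simp
    moreover have "insert \<theta> B \<subseteq> adjoin (L \<union> f ` insert i J)"
      using \<theta>(1)[unfolded eq] B(2) adjoin_mono[of "L \<union> f ` J" "L \<union> f ` insert i J"] by auto
    ultimately show ?case by (intro exI[of _ "insert \<theta> B"] conjI)
  qed
  from this[of I] obtain B where "alg_independent (fixed_field L) B"
    "fixed_field (adjoin (L \<union> f ` I)) = adjoin (fixed_field L \<union> B)" by blast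
  then show ?thesis
    unfolding rational_over_def subfield_iff_field_subset by (intro conjI exI[of _ B] fL)
qed

section \<open>Interpolation\<close>

text \<open>Taken over \<open>I - {g}\<close>, this is the numerator of a Lagrange basis
  polynomial.\<close>

definition node_poly :: "('i \<Rightarrow> 'a::idom) \<Rightarrow> 'i set \<Rightarrow> 'a poly" where
  "node_poly y J = (\<Prod>g\<in>J. [:- y g, 1:])"

lemma poly_node_poly: "poly (node_poly y J) x = (\<Prod>g\<in>J. x - y g)"
  by (simp add: node_poly_def poly_prod)

lemma degree_node_poly: "degree (node_poly y J) = card J"
proof (induction J rule: infinite_finite_induct)
  case (insert g J)
  have "node_poly y J \<noteq> 0"
    using insert(1) by (auto simp: node_poly_def)
  with insert show ?case by (simp add: node_poly_def degree_mult_eq del: mult_pCons_left)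
qed (simp_all add: node_poly_def)

text \<open>The coefficients are, up to sign, elementary symmetric polynomials in the nodes, so a
  homomorphism fixing the nodes fixes them. The induction multiplies by one linear factor at a
  time.\<close>

lemma coeff_node_poly_fixed:
  assumes \<phi>: "ring_hom_type \<phi>" "\<And>g. g \<in> J \<Longrightarrow> \<phi> (y g) = y g"
  shows "\<phi> (coeff (node_poly y J) i) = coeff (node_poly y J) i"
  using assms(2)
proof (induction J arbitrary: i rule: infinite_finite_induct)
  case (insert g J)
  have "node_poly y (insert g J) = pCons 0 (node_poly y J) - smult (y g) (node_poly y J)"
    using insert(1,2) by (simp add: node_poly_def)
  then show ?case
    using insert by (simp add: coeff_pCons ring_hom_typeD[OF \<phi>(1)] split: nat.split)
qed (simp_all add: node_poly_def coeff_pCons ring_hom_typeD[OF \<phi>(1)] split: nat.splits)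

lemma coeff_node_poly_in_subset:
  assumes N: "field_subset N" and "\<And>g. g \<in> J \<Longrightarrow> y g \<in> N"
  shows "coeff (node_poly y J) i \<in> N"
  using assms(2)
proof (induction J arbitrary: i rule: infinite_finite_induct)
  case (insert g J)
  have "node_poly y (insert g J) = pCons 0 (node_poly y J) - smult (y g) (node_poly y J)"
    using insert(1,2) by (simp add: node_poly_def)
  then show ?case
    using insert field_subset.zero[OF N]
    by (auto simp: coeff_pCons intro!: field_subset.minus[OF N] field_subset.mult[OF N] field_subset.uminus[OF N] split: nat.split)
qed (simp_all add: node_poly_def coeff_pCons field_subset.zero[OF N] field_subset.one[OF N] split: nat.splits)

text \<open>
  Up to the factor \<open>d\<close>, the witness \<open>a\<close> is a column of the inverse of the Vandermonde matrix of \<open>y\<close>.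
\<close>

lemma vandermonde_dual:
  fixes y :: "'i \<Rightarrow> 'a::idom"
  assumes I: "finite I" "inj_on y I" and i: "i < card I"
  obtains a d where "d \<noteq> 0"
    "\<forall>j < card I. (\<Sum>g\<in>I. y g ^ j * a g) = (if j = i then d else 0)"
    "\<forall>\<phi>. ring_hom_type \<phi> \<longrightarrow> (\<forall>g\<in>I. \<phi> (y g) = y g) \<longrightarrow> (\<forall>g\<in>I. \<phi> (a g) = a g)"
proof -
  define l where "l g = node_poly y (I - {g})" for g
  define \<epsilon> where "\<epsilon> g = (\<Prod>g'\<in>I - {g}. y g - y g')" for g
  define E where "E g = (\<Prod>g'\<in>I - {g}. \<epsilon> g')" for g
  define d where "d = prod \<epsilon> I"
  have l_eval: "poly (l g) (y g') = (if g = g' then \<epsilon> g else 0)" if "g \<in> I" "g' \<in> I" for g g'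
    using that I by (auto simp: l_def \<epsilon>_def poly_node_poly)
  have \<epsilon>0: "\<epsilon> g \<noteq> 0" if "g \<in> I" for g
    using that I by (auto simp: \<epsilon>_def dest: inj_onD)
  then have "d \<noteq> 0" using I(1) by (simp add: d_def)
  have E: "E g * \<epsilon> g = d" if "g \<in> I" for g
    using prod.remove[OF I(1) that, of \<epsilon>] by (simp add: E_def d_def mult.commute)
  \<comment> \<open>Lagrange interpolation of the monomial of degree \<open>j\<close>, scaled by
    \<open>d\<close>: two polynomials of degree below \<open>card I\<close> agree at
    \<open>card I\<close> nodes. Its coefficient at \<open>i\<close> is the required
    identity.\<close>
  have "(\<Sum>g\<in>I. smult (y g ^ j * E g) (l g)) = smult d (monom 1 j)" (is "?p = ?q") if j: "j < card I" for j
  proof (rule ccontr)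
    assume "?p \<noteq> ?q"
    then have p0: "?p - ?q \<noteq> 0" by simp
    have "degree (l g) < card I" if "g \<in> I" for g
      unfolding l_def degree_node_poly by (rule card_Diff1_less[OF I(1) that])
    then have "degree (smult (y g ^ j * E g) (l g)) < card I" if "g \<in> I" for g
      using that by (meson degree_smult_le le_less_trans)
    then have "degree ?p < card I"
      using i by (intro degree_sum_less) auto
    moreover have "degree ?q < card I"
      using degree_smult_le[of d "monom 1 j"] degree_monom_le[of "1::'a" j] j by linarith
    ultimately have "degree (?p - ?q) < card I" by (rule degree_diff_less)
    moreover have "y ` I \<subseteq> {x. poly (?p - ?q) x = 0}"
    proof
      fix x assume "x \<in> y ` I"
      then obtain g0 where g0: "g0 \<in> I" "x = y g0" by blast
      have "poly ?p x = (\<Sum>g\<in>I. if g = g0 then y g0 ^ j * E g0 * \<epsilon> g0 else 0)"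
        unfolding poly_sum g0(2) using g0(1) by (intro sum.cong) (auto simp: l_eval)
      also have "\<dots> = y g0 ^ j * d" using g0(1) I(1) E[OF g0(1)] by (simp add: mult.assoc)
      finally show "x \<in> {x. poly (?p - ?q) x = 0}" by (simp add: poly_monom g0(2))
    qed
    then have "card (y ` I) \<le> card {x. poly (?p - ?q) x = 0}"
      using poly_roots_finite[OF p0] by (rule card_mono[rotated])
    ultimately show False
      using card_poly_roots_bound[OF p0] card_image[OF I(2)] by linarith
  qed
  note eq = this
  show thesis
  proof (rule that[OF \<open>d \<noteq> 0\<close>])
    have "(\<Sum>g\<in>I. y g ^ j * (E g * coeff (l g) i)) = (if j = i then d else 0)" if "j < card I" for j
      using arg_cong[OF eq[OF that], of "\<lambda>p. coeff p i"] by (simp add: coeff_sum mult.assoc)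
    then show "\<forall>j < card I. (\<Sum>g\<in>I. y g ^ j * (E g * coeff (l g) i)) = (if j = i then d else 0)"
      by blast
  next
    show "\<forall>\<phi>. ring_hom_type \<phi> \<longrightarrow> (\<forall>g\<in>I. \<phi> (y g) = y g) \<longrightarrow>
        (\<forall>g\<in>I. \<phi> (E g * coeff (l g) i) = E g * coeff (l g) i)"
    proof (intro allI impI ballI)
      fix \<phi> :: "'a \<Rightarrow> 'a" and g
      assume \<phi>: "ring_hom_type \<phi>" "\<forall>g\<in>I. \<phi> (y g) = y g" and g: "g \<in> I"
      have "\<phi> (\<epsilon> g') = \<epsilon> g'" if "g' \<in> I" for g'
        unfolding \<epsilon>_def ring_hom_typeD(9)[OF \<phi>(1)]
        by (intro prod.cong refl) (use that in \<open>simp add: ring_hom_typeD[OF \<phi>(1)] \<phi>(2)\<close>)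
      then have "\<phi> (E g) = E g"
        unfolding E_def ring_hom_typeD(9)[OF \<phi>(1)] by (intro prod.cong refl) simp
      moreover have "\<phi> (coeff (l g) i) = coeff (l g) i"
        unfolding l_def by (rule coeff_node_poly_fixed[OF \<phi>(1)]) (simp add: \<phi>(2))
      ultimately show "\<phi> (E g * coeff (l g) i) = E g * coeff (l g) i"
        by (simp add: ring_hom_typeD[OF \<phi>(1)])
    qed
  qed
qed

text \<open>Combining the weighted sums with the coefficients of a Lagrange numerator leaves a
  nonzero multiple of \<open>z g\<close> alone.\<close>

lemma interpolation_in_field_subset:
  fixes y :: "'i \<Rightarrow> 'a::field"
  assumes N: "field_subset N" and I: "finite I" "inj_on y I" "g \<in> I"
    and y: "\<And>g. g \<in> I \<Longrightarrow> y g \<in> N"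
    and f: "\<And>j. j < card I \<Longrightarrow> (\<Sum>g\<in>I. y g ^ j * z g) \<in> N"
  shows "z g \<in> N"
proof -
  interpret N: field_subset N by fact
  define l where "l = node_poly y (I - {g})"
  define \<epsilon> where "\<epsilon> = (\<Prod>g'\<in>I - {g}. y g - y g')"
  have co: "coeff l j \<in> N" for j
    unfolding l_def by (rule coeff_node_poly_in_subset[OF N]) (simp add: y)
  \<comment> \<open>\<open>l\<close> has degree \<open>card I - 1\<close>, so the exponents in use
    are exactly the \<open>j < card I\<close> of the hypothesis.\<close>
  have "card I > 0" using I by (auto simp: card_gt_0_iff)
  then have deg: "{..degree l} = {..<card I}"
    using I by (auto simp: l_def degree_node_poly)
  have "(\<Sum>j<card I. coeff l j * (\<Sum>g\<in>I. y g ^ j * z g)) = (\<Sum>g'\<in>I. poly l (y g') * z g')"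
    unfolding poly_altdef deg sum_distrib_left sum_distrib_right
    by (subst sum.swap) (simp add: mult.assoc)
  also have "\<dots> = (\<Sum>g'\<in>I. if g' = g then \<epsilon> * z g else 0)"
    using I by (intro sum.cong) (auto simp: l_def \<epsilon>_def poly_node_poly)
  also have "\<dots> = \<epsilon> * z g" using I by simp
  finally have "\<epsilon> * z g \<in> N" by (metis (no_types, lifting) N.sum N.mult co f lessThan_iff)
  moreover have "\<epsilon> \<in> N" unfolding \<epsilon>_def by (intro N.prod N.minus y) (use I in auto)
  ultimately have "\<epsilon> * z g / \<epsilon> \<in> N" by (rule N.divide)
  moreover have "\<epsilon> \<noteq> 0" using I by (auto simp: \<epsilon>_def dest: inj_onD)
  ultimately show ?thesis by simp
qed

section \<open>Characters and semi-invariants\<close>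

text \<open>Relative to a subset so that characters can be extended from subgroup to subgroup.
  Values outside \<open>T\<close> are free, so different functions may describe the same
  character.\<close>

definition character_on :: "('a, 'b) monoid_scheme \<Rightarrow> 'a set \<Rightarrow> ('a \<Rightarrow> 'k::field) \<Rightarrow> bool" where
  "character_on A T \<chi> \<longleftrightarrow> \<chi> \<one>\<^bsub>A\<^esub> = 1 \<and> (\<forall>a\<in>T. \<forall>b\<in>T. \<chi> (a \<otimes>\<^bsub>A\<^esub> b) = \<chi> a * \<chi> b)"

abbreviation linear_character :: "('h, 'b) monoid_scheme \<Rightarrow> ('h \<Rightarrow> 'k::field) \<Rightarrow> bool" where
  "linear_character H \<equiv> character_on H (carrier H)"

lemma rf_const_eq_0_iff:
  fixes a :: "'k::field"
  shows "rf_const a = (0 :: ('v, 'k) ratfun) \<longleftrightarrow> a = 0"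
proof
  assume "rf_const a = (0 :: ('v, 'k) ratfun)"
  then have "rf_const (inverse a * a) = (0 :: ('v, 'k) ratfun)" by (simp add: rf_const_mult)
  then show "a = 0" by (cases "a = 0") (simp_all add: rf_const_1)
qed (simp add: rf_const_0)

text \<open>\<open>Ch\<close> stands for the dual of the kernel, each element being represented by
  one extension to \<open>H\<close>. The trivial character must be the constant function itself,
  since \<open>semi_index\<close> singles it out by equality. Fourier inversion divides by
  \<open>card Ch\<close>.\<close>

locale noether_extension = H: group H + G: group G
  for H :: "'h monoid" and G :: "'g monoid" +
  fixes \<pi> :: "'h \<Rightarrow> 'g" and Ch :: "('h \<Rightarrow> 'k::field) set"
  assumes finite_H: "finite (carrier H)"
    and epi: "\<pi> \<in> epi H G"
    and finite_X: "finite Ch"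
    and characters: "\<chi> \<in> Ch \<Longrightarrow> linear_character H \<chi>"
    and trivial_character: "(\<lambda>_. 1) \<in> Ch"
    and characters_differ: "\<chi> \<in> Ch \<Longrightarrow> \<psi> \<in> Ch \<Longrightarrow> \<chi> \<noteq> \<psi> \<Longrightarrow> \<exists>c\<in>kernel H G \<pi>. \<chi> c \<noteq> \<psi> c"
    and column_sum: "c \<in> kernel H G \<pi> \<Longrightarrow> c \<noteq> \<one>\<^bsub>H\<^esub> \<Longrightarrow> (\<Sum>\<chi>\<in>Ch. \<chi> c) = 0"
    and card_X: "of_nat (card Ch) \<noteq> (0::'k)"
    and card_kernel: "of_nat (card (kernel H G \<pi>)) \<noteq> (0::'k)"
    and infinite_K: "infinite (UNIV :: 'k set)"
begin

section \<open>Fibres of \<pi> and orthogonality of characters on them\<close>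

lemma \<pi>_closed [simp]: "h \<in> carrier H \<Longrightarrow> \<pi> h \<in> carrier G"
  and \<pi>_mult [simp]: "h \<in> carrier H \<Longrightarrow> h' \<in> carrier H \<Longrightarrow> \<pi> (h \<otimes>\<^bsub>H\<^esub> h') = \<pi> h \<otimes>\<^bsub>G\<^esub> \<pi> h'"
  and \<pi>_surj: "\<pi> ` carrier H = carrier G"
  using epi by (auto simp: epi_def hom_def)

lemma finite_G: "finite (carrier G)"
  using finite_H \<pi>_surj by (metis finite_imageI)

lemma character_mult: "\<chi> \<in> Ch \<Longrightarrow> a \<in> carrier H \<Longrightarrow> b \<in> carrier H \<Longrightarrow> \<chi> (a \<otimes>\<^bsub>H\<^esub> b) = \<chi> a * \<chi> b"
  using characters by (simp add: character_on_def)

lemma character_inv: "\<chi> \<in> Ch \<Longrightarrow> a \<in> carrier H \<Longrightarrow> \<chi> (inv\<^bsub>H\<^esub> a) * \<chi> a = 1"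
  using characters[of \<chi>] character_mult[of \<chi> "inv\<^bsub>H\<^esub> a" a] by (simp add: character_on_def)

lemma character_nonzero: "\<chi> \<in> Ch \<Longrightarrow> a \<in> carrier H \<Longrightarrow> \<chi> a \<noteq> 0"
  using character_inv[of \<chi> a] by auto

lemma kernel_closed: "c \<in> kernel H G \<pi> \<Longrightarrow> c \<in> carrier H"
  and kernel_\<pi>: "c \<in> kernel H G \<pi> \<Longrightarrow> \<pi> c = \<one>\<^bsub>G\<^esub>"
  by (auto simp: kernel_def)

definition fibre :: "'g \<Rightarrow> 'h set" where
  "fibre g = {h \<in> carrier H. \<pi> h = g}"

lemma finite_fibre: "finite (fibre g)"
  using finite_H by (simp add: fibre_def)

lemma fibre_translate:
  assumes "c \<in> kernel H G \<pi>" "g \<in> carrier G"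
  shows "(\<Sum>h\<in>fibre g. w (c \<otimes>\<^bsub>H\<^esub> h)) = (\<Sum>h\<in>fibre g. w h :: 'x::comm_monoid_add)"
proof -
  have "\<pi> (inv\<^bsub>H\<^esub> c) = \<one>\<^bsub>G\<^esub>"
    using \<pi>_mult[of "inv\<^bsub>H\<^esub> c" c] kernel_closed[OF assms(1)] kernel_\<pi>[OF assms(1)]
      \<pi>_mult[of "\<one>\<^bsub>H\<^esub>" "\<one>\<^bsub>H\<^esub>"] by (simp add: G.l_cancel_one')
  then show ?thesis
    using kernel_closed[OF assms(1)] kernel_\<pi>[OF assms(1)] assms(2)
    by (intro sum.reindex_bij_witness[of _ "\<lambda>h. inv\<^bsub>H\<^esub> c \<otimes>\<^bsub>H\<^esub> h" "\<lambda>h. c \<otimes>\<^bsub>H\<^esub> h"])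
      (auto simp: fibre_def H.m_assoc[symmetric])
qed

lemma card_fibre:
  assumes "g \<in> carrier G"
  shows "card (fibre g) = card (kernel H G \<pi>)"
proof -
  have "g \<in> \<pi> ` carrier H" using assms \<pi>_surj by simp
  then obtain h where h: "h \<in> carrier H" "\<pi> h = g" by blast
  interpret group_hom H G \<pi>
    using epi by unfold_locales (simp add: epi_def)
  have "bij_betw (\<lambda>c. c \<otimes>\<^bsub>H\<^esub> h) (kernel H G \<pi>) (fibre g)"
    by (rule bij_betw_byWitness[of _ "\<lambda>x. x \<otimes>\<^bsub>H\<^esub> inv\<^bsub>H\<^esub> h"])
      (use h in \<open>auto simp: fibre_def kernel_def H.m_assoc\<close>)
  then show ?thesis by (metis bij_betw_same_card)
qed

text \<open>Translation by a kernel element that separates \<chi> and \<psi> permutes the fibre and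
  multiplies the sum by a factor other than 1.\<close>

lemma row_sum:
  assumes "\<chi> \<in> Ch" "\<psi> \<in> Ch" "g \<in> carrier G"
  shows "(\<Sum>h\<in>fibre g. inverse (\<chi> h) * \<psi> h) = (if \<chi> = \<psi> then of_nat (card (kernel H G \<pi>)) else 0)"
proof (cases "\<chi> = \<psi>")
  case True
  have "(\<Sum>h\<in>fibre g. inverse (\<chi> h) * \<psi> h) = (\<Sum>h\<in>fibre g. 1)"
    using character_nonzero[OF assms(1)] True by (intro sum.cong) (auto simp: fibre_def)
  then show ?thesis using True card_fibre[OF assms(3)] by simp
next
  case False
  then obtain c where c: "c \<in> kernel H G \<pi>" "\<chi> c \<noteq> \<psi> c"
    using characters_differ assms by blast
  define r where "r = inverse (\<chi> c) * \<psi> c"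
  have cH: "c \<in> carrier H" by (rule kernel_closed[OF c(1)])
  let ?S = "\<Sum>h\<in>fibre g. inverse (\<chi> h) * \<psi> h"
  have "?S = (\<Sum>h\<in>fibre g. inverse (\<chi> (c \<otimes>\<^bsub>H\<^esub> h)) * \<psi> (c \<otimes>\<^bsub>H\<^esub> h))"
    using fibre_translate[OF c(1) assms(3), of "\<lambda>h. inverse (\<chi> h) * \<psi> h"] by simp
  also have "\<dots> = r * ?S"
    unfolding sum_distrib_left r_def
    using assms cH by (intro sum.cong) (auto simp: fibre_def character_mult)
  finally have "(r - 1) * ?S = 0" by (simp add: algebra_simps)
  moreover have "r \<noteq> 1"
    using c(2) character_nonzero[OF assms(1) cH] by (auto simp: r_def field_simps)
  ultimately show ?thesis using False by simp
qed

lemma sum_fibres: "(\<Sum>h\<in>carrier H. w h) = (\<Sum>g\<in>carrier G. \<Sum>h\<in>fibre g. w h :: 'x::comm_monoid_add)"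
  unfolding fibre_def by (rule sum.group[symmetric]) (use finite_H finite_G in auto)

section \<open>The polynomials y(g) and f(\<chi>, j), and the action of H on them\<close>

definition Y :: "'g \<Rightarrow> ('h, 'k) mpoly" where
  "Y g = (\<Sum>h\<in>fibre g. mp_var h)"

text \<open>The f(\<chi>, j) of the overview. They are kept as polynomials, like \<open>Y\<close>,
  so that substitutions can be computed without denominators.\<close>

definition S :: "('h \<Rightarrow> 'k) \<Rightarrow> nat \<Rightarrow> ('h, 'k) mpoly" where
  "S \<chi> j = (\<Sum>h\<in>carrier H. Y (\<pi> h) ^ j * (mp_const (inverse (\<chi> h)) * mp_var h))"

definition L :: "('h, 'k) ratfun set" where
  "L = adjoin (range rf_const \<union> (\<lambda>g. of_mpoly (Y g)) ` carrier G)"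

text \<open>Variables outside the carrier are left alone. The substitution then permutes all
  variables of the type and acts on the whole ambient field, although the product is unspecified off
  the carrier.\<close>

definition act :: "'h \<Rightarrow> ('h, 'k) ratfun \<Rightarrow> ('h, 'k) ratfun" where
  "act t = rf_subst (\<lambda>h. rf_var (if h \<in> carrier H then t \<otimes>\<^bsub>H\<^esub> h else h))"

definition act_poly :: "'h \<Rightarrow> ('h, 'k) mpoly \<Rightarrow> ('h, 'k) mpoly" where
  "act_poly t = mp_eval mp_const (\<lambda>h. mp_var (if h \<in> carrier H then t \<otimes>\<^bsub>H\<^esub> h else h))"

lemmas const_hom = ring_hom_typeD[OF ring_hom_type_mp_const]

lemma Y_inj: "inj_on Y (carrier G)"
proof (rule inj_onI, rule ccontr)
  fix g g' assume g: "g \<in> carrier G" "g' \<in> carrier G" "Y g = Y g'" "g \<noteq> g'"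
  have "g \<in> \<pi> ` carrier H" using g(1) \<pi>_surj by simp
  then obtain h where h: "h \<in> carrier H" "\<pi> h = g" by blast
  \<comment> \<open>Setting one variable over \<open>g\<close> to 1 and all others to 0 tells
    \<open>Y g\<close> from every other \<open>Y a\<close>.\<close>
  define \<phi> where "\<phi> = mp_eval mp_const (\<lambda>v. if v = h then 1 else 0 :: ('h, 'k) mpoly)"
  have "\<phi> (Y a) = (if a = g then 1 else 0)" for a
  proof -
    have "\<phi> (Y a) = (\<Sum>v\<in>fibre a. if v = h then 1 else 0)"
      by (simp add: \<phi>_def Y_def ring_hom_typeD[OF mp_eval_mp_hom] mp_eval_simps)
    also have "\<dots> = (if a = g then 1 else 0)"
      using finite_fibre h by (auto simp: fibre_def)
    finally show ?thesis .
  qed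
  then show False using g by (metis zero_neq_one)
qed

lemma independent_act:
  assumes t: "t \<in> carrier H"
  shows "independent_values (\<lambda>h. rf_var (if h \<in> carrier H then t \<otimes>\<^bsub>H\<^esub> h else h) :: ('h, 'k) ratfun) UNIV"
proof (rule independent_valuesI[where P = "\<lambda>h. mp_var (if h \<in> carrier H then t \<otimes>\<^bsub>H\<^esub> h else h)"
    and s' = "\<lambda>h. rf_var (if h \<in> carrier H then inv\<^bsub>H\<^esub> t \<otimes>\<^bsub>H\<^esub> h else h)"])
qed (use t in \<open>auto simp: rf_var_def[symmetric] mp_eval_simps H.m_assoc[symmetric]\<close>)

lemma act_hom: "t \<in> carrier H \<Longrightarrow> field_hom UNIV (act t)"
  using field_hom_rf_subst[OF independent_act] by (simp add: act_def rf_field_UNIV)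

lemma act_of_mpoly: "act t (of_mpoly p) = of_mpoly (act_poly t p)"
  by (simp add: act_def rf_subst_of_mpoly act_poly_def rf_var_def mp_eval_of_mpoly)

lemma act_const: "act t (rf_const a) = rf_const a"
  by (simp add: act_def rf_subst_const)

lemma act_var: "act t (rf_var h) = rf_var (if h \<in> carrier H then t \<otimes>\<^bsub>H\<^esub> h else h)"
  by (simp add: act_def rf_subst_var)

sublocale action: field_action H act
proof (intro field_action.intro field_action_axioms.intro H.group_axioms)
  show "finite (carrier H)" by (rule finite_H)
  show "field_hom UNIV (act t)" if "t \<in> carrier H" for t by (rule act_hom[OF that])
  show "act s (act t x) = act (s \<otimes>\<^bsub>H\<^esub> t) x" if "s \<in> carrier H" "t \<in> carrier H" for s t x
    by (rule rf_field_hom_eqI[of UNIV "\<lambda>x. act s (act t x)"])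
      (use that in \<open>simp_all add: rf_field_UNIV act_hom act_const act_var H.m_assoc
        field_hom_comp[OF act_hom act_hom]\<close>)
  show "act \<one>\<^bsub>H\<^esub> x = x" for x
    by (rule rf_field_hom_eqI[of UNIV "act \<one>\<^bsub>H\<^esub>" "\<lambda>x. x"])
      (simp_all add: rf_field_UNIV act_hom act_const act_var field_hom_id field_subset_UNIV)
qed

lemma act_poly_hom: "ring_hom_type (act_poly t)"
  unfolding act_poly_def by (rule mp_eval_mp_hom)

lemma act_poly_Y:
  assumes t: "t \<in> carrier H" and g: "g \<in> carrier G"
  shows "act_poly t (Y g) = Y (\<pi> t \<otimes>\<^bsub>G\<^esub> g)"
proof -
  have \<pi>_inv: "\<pi> (inv\<^bsub>H\<^esub> t) = inv\<^bsub>G\<^esub> (\<pi> t)"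
    using t epi group_hom.hom_inv[of H G \<pi> t]
    by (simp add: group_hom_def group_hom_axioms_def epi_def H.group_axioms G.group_axioms)
  have "act_poly t (Y g) = (\<Sum>h\<in>fibre g. mp_var (t \<otimes>\<^bsub>H\<^esub> h))"
    unfolding Y_def ring_hom_typeD(8)[OF act_poly_hom]
    by (intro sum.cong) (auto simp: act_poly_def mp_eval_simps fibre_def)
  also have "\<dots> = Y (\<pi> t \<otimes>\<^bsub>G\<^esub> g)"
    unfolding Y_def
    by (rule sum.reindex_bij_witness[of _ "\<lambda>h. inv\<^bsub>H\<^esub> t \<otimes>\<^bsub>H\<^esub> h" "\<lambda>h. t \<otimes>\<^bsub>H\<^esub> h"])
      (use t g in \<open>auto simp: fibre_def H.m_assoc[symmetric] G.m_assoc[symmetric] \<pi>_inv\<close>)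
  finally show ?thesis .
qed

text \<open>After reindexing by \<open>t\<close>, the weight \<open>Y (\<pi> h) ^ j\<close> has
  moved along with \<open>h\<close>, and the only trace left is the factor by which the inverse
  character value changes.\<close>

lemma act_poly_S:
  assumes t: "t \<in> carrier H" and \<chi>: "\<chi> \<in> Ch"
  shows "act_poly t (S \<chi> j) = mp_const (\<chi> t) * S \<chi> j"
proof -
  have "act_poly t (S \<chi> j)
      = (\<Sum>h\<in>carrier H. Y (\<pi> (t \<otimes>\<^bsub>H\<^esub> h)) ^ j * (mp_const (inverse (\<chi> h)) * mp_var (t \<otimes>\<^bsub>H\<^esub> h)))"
    unfolding S_def ring_hom_typeD(8)[OF act_poly_hom]
    using t by (intro sum.cong refl)
      (simp add: ring_hom_typeD[OF act_poly_hom] act_poly_Y, simp add: act_poly_def mp_eval_simps)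
  also have "\<dots> = (\<Sum>h\<in>carrier H. mp_const (\<chi> t) *
      (Y (\<pi> (t \<otimes>\<^bsub>H\<^esub> h)) ^ j * (mp_const (inverse (\<chi> (t \<otimes>\<^bsub>H\<^esub> h))) * mp_var (t \<otimes>\<^bsub>H\<^esub> h))))"
  proof (intro sum.cong refl)
    fix h assume h: "h \<in> carrier H"
    have "inverse (\<chi> h) = \<chi> t * inverse (\<chi> (t \<otimes>\<^bsub>H\<^esub> h))"
      using character_mult[OF \<chi> t h] character_nonzero[OF \<chi> t] by simp
    then show "Y (\<pi> (t \<otimes>\<^bsub>H\<^esub> h)) ^ j * (mp_const (inverse (\<chi> h)) * mp_var (t \<otimes>\<^bsub>H\<^esub> h)) = mp_const (\<chi> t) *
      (Y (\<pi> (t \<otimes>\<^bsub>H\<^esub> h)) ^ j * (mp_const (inverse (\<chi> (t \<otimes>\<^bsub>H\<^esub> h))) * mp_var (t \<otimes>\<^bsub>H\<^esub> h)))"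
      by (simp only: mp_const_mult mult_ac)
  qed
  also have "\<dots> = mp_const (\<chi> t) * S \<chi> j"
    unfolding S_def sum_distrib_left[symmetric]
    by (intro arg_cong[of _ _ "(*) (mp_const (\<chi> t))"]
        sum.reindex_bij_witness[of _ "\<lambda>h. inv\<^bsub>H\<^esub> t \<otimes>\<^bsub>H\<^esub> h" "\<lambda>h. t \<otimes>\<^bsub>H\<^esub> h"])
      (use t in \<open>auto simp: H.m_assoc[symmetric]\<close>)
  finally show ?thesis .
qed

lemma field_subset_L: "field_subset L"
  unfolding L_def by (rule field_subset_adjoin)

lemma const_in_L: "rf_const a \<in> L" and Y_in_L: "g \<in> carrier G \<Longrightarrow> of_mpoly (Y g) \<in> L"
  unfolding L_def by (auto intro: generate_field.incl)

lemma L_stable: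
  assumes t: "t \<in> carrier H" and x: "x \<in> L"
  shows "act t x \<in> L"
proof -
  have "adjoin (range rf_const \<union> (\<lambda>g. of_mpoly (Y g)) ` carrier G) \<subseteq> {x \<in> UNIV. act t x \<in> L}"
    by (rule adjoin_least[OF field_hom.field_subset_vimage[OF act_hom[OF t] field_subset_L]])
      (use t in \<open>auto simp: act_const act_of_mpoly act_poly_Y const_in_L Y_in_L\<close>)
  then have "L \<subseteq> {x \<in> UNIV. act t x \<in> L}" by (simp only: L_def)
  then show ?thesis using x by blast
qed

text \<open>The sums for the trivial character are polynomials in the \<open>Y g\<close> and lie in
  \<open>L\<close> already. There are as many exponents as interpolation nodes
  \<open>Y g\<close>.\<close>

definition semi_index :: "(('h \<Rightarrow> 'k) \<times> nat) set" where
  "semi_index = (Ch - {\<lambda>_. 1}) \<times> {..<card (carrier G)}"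

definition semi :: "('h \<Rightarrow> 'k) \<times> nat \<Rightarrow> ('h, 'k) ratfun" where
  "semi i = of_mpoly (S (fst i) (snd i))"

text \<open>
  With \<open>a\<close> the witness of \<open>vandermonde_dual\<close>, the substitution \<open>x(h) \<mapsto> x(h) + c \<psi>(h) a(\<pi> h)\<close> fixes
  \<open>L\<close> and all semi-invariants but one, which is translated by a multiple of \<open>c\<close>.
\<close>

lemma transcendental_semi:
  assumes "i \<in> semi_index"
  shows "transcendental_over (adjoin (L \<union> semi ` (semi_index - {i}))) (semi i)"
proof -
  define \<psi> k where "\<psi> = fst i" and "k = snd i"
  have i: "i = (\<psi>, k)" "\<psi> \<in> Ch" "\<psi> \<noteq> (\<lambda>_. 1)" "k < card (carrier G)"
    using assms by (simp_all add: semi_index_def \<psi>_def k_def mem_Times_iff)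
  obtain a d where d: "d \<noteq> 0"
    and a: "\<forall>j < card (carrier G). (\<Sum>g\<in>carrier G. Y g ^ j * a g) = (if j = k then d else 0)"
    and a_fixed: "\<forall>\<phi>. ring_hom_type \<phi> \<longrightarrow> (\<forall>g\<in>carrier G. \<phi> (Y g) = Y g) \<longrightarrow>
      (\<forall>g\<in>carrier G. \<phi> (a g) = a g)"
    by (rule vandermonde_dual[OF finite_G Y_inj i(4)])
  define P where "P c h = mp_var h + (if h \<in> carrier H then mp_const (c * \<psi> h) * a (\<pi> h) else 0)" for c h
  define e where "e c = mp_eval mp_const (P c)" for c
  define s where "s c h = of_mpoly (P c h)" for c h
  define \<tau> where "\<tau> c = rf_subst (s c)" for c
  have e_hom: "ring_hom_type (e c)" for c unfolding e_def by (rule mp_eval_mp_hom)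
  note e = ring_hom_typeD[OF e_hom]
  have e_var: "e c (mp_var h) = P c h" and e_const: "e c (mp_const b) = mp_const b" for c h b
    by (simp_all add: e_def mp_eval_simps)
  \<comment> \<open>On a fibre \<open>a (\<pi> h)\<close> is constant, so the correction is a
    multiple of the sum of \<psi> over the fibre, which vanishes because \<psi> is
    nontrivial.\<close>
  have e_Y: "e c (Y g) = Y g" if g: "g \<in> carrier G" for c g
  proof -
    have "e c (Y g) = (\<Sum>h\<in>fibre g. mp_var h + a g * mp_const c * mp_const (\<psi> h))"
      unfolding Y_def e(8)
      by (intro sum.cong) (auto simp: e_var P_def fibre_def mp_const_mult mult_ac)
    also have "\<dots> = Y g + a g * mp_const c * mp_const (\<Sum>h\<in>fibre g. \<psi> h)"
      by (simp add: sum.distrib sum_distrib_left Y_def const_hom(8))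
    also have "(\<Sum>h\<in>fibre g. \<psi> h) = 0"
      using row_sum[OF trivial_character i(2) g] i(3) by auto
    finally show ?thesis by (simp add: const_hom(4))
  qed
  have e_a: "e c (a g) = a g" if "g \<in> carrier G" for c g
    using a_fixed[rule_format, OF e_hom e_Y that] .
  \<comment> \<open>As the \<open>a g\<close> are fixed, translating by \<open>- c\<close> undoes
    translating by \<open>c\<close>; this gives the independence of the substituted values.\<close>
  have e_inv: "e (- c) (P c h) = mp_var h" for c h
    by (simp add: P_def e e_var e_const e_a mp_const_mult const_hom(5))
  have indep: "independent_values (s c) UNIV" for c
  proof (rule independent_valuesI[where P = "P c" and s' = "\<lambda>h. of_mpoly (P (- c) h)"])
    show "mp_eval rf_const (\<lambda>h. of_mpoly (P (- c) h)) (P c v) = rf_var v" for v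
      using e_inv[of c v] by (simp add: mp_eval_of_mpoly e_def rf_var_def)
  qed (simp add: s_def)
  have \<tau>_hom: "field_hom UNIV (\<tau> c)" for c
    using field_hom_rf_subst[OF indep] by (simp add: \<tau>_def rf_field_UNIV)
  have \<tau>_poly: "\<tau> c (of_mpoly p) = of_mpoly (e c p)" for c p
    unfolding \<tau>_def s_def e_def rf_subst_of_mpoly mp_eval_of_mpoly ..
  define m where "m = (of_nat (card (kernel H G \<pi>)) :: 'k)"
  \<comment> \<open>Summed fibre by fibre, the correction vanishes for
    \<open>\<chi> \<noteq> \<psi>\<close> by orthogonality and for \<open>j \<noteq> k\<close> by
    the choice of \<open>a\<close>.\<close>
  have e_S: "e c (S \<chi> j) = S \<chi> j + (if (\<chi>, j) = i then mp_const (c * m) * d else 0)"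
    if \<chi>: "\<chi> \<in> Ch" and j: "j < card (carrier G)" for c \<chi> j
  proof -
    have "e c (S \<chi> j) = (\<Sum>h\<in>carrier H. Y (\<pi> h) ^ j * (mp_const (inverse (\<chi> h)) * mp_var h)
        + mp_const c * (Y (\<pi> h) ^ j * a (\<pi> h) * mp_const (inverse (\<chi> h) * \<psi> h)))"
      unfolding S_def e(8)
      by (intro sum.cong refl) (simp add: e e_Y e_var e_const P_def mp_const_mult algebra_simps)
    also have "\<dots> = S \<chi> j + mp_const c *
        (\<Sum>h\<in>carrier H. Y (\<pi> h) ^ j * a (\<pi> h) * mp_const (inverse (\<chi> h) * \<psi> h))"
      by (simp add: sum.distrib S_def sum_distrib_left)
    also have "(\<Sum>h\<in>carrier H. Y (\<pi> h) ^ j * a (\<pi> h) * mp_const (inverse (\<chi> h) * \<psi> h))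
        = (\<Sum>g\<in>carrier G. \<Sum>h\<in>fibre g. Y g ^ j * a g * mp_const (inverse (\<chi> h) * \<psi> h))"
      unfolding sum_fibres by (intro sum.cong refl) (simp add: fibre_def)
    also have "\<dots> = (\<Sum>g\<in>carrier G. Y g ^ j * a g * mp_const (\<Sum>h\<in>fibre g. inverse (\<chi> h) * \<psi> h))"
      by (simp add: sum_distrib_left const_hom(8))
    also have "\<dots> = (\<Sum>g\<in>carrier G. Y g ^ j * a g) * mp_const (if \<chi> = \<psi> then m else 0)"
      unfolding sum_distrib_right
      by (intro sum.cong refl) (simp add: row_sum[OF \<chi> i(2)] m_def)
    also have "(\<Sum>g\<in>carrier G. Y g ^ j * a g) = (if j = k then d else 0)" using a j by blast
    finally show ?thesis
      by (simp add: i(1) mp_const_mult const_hom(4) mult_ac)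
  qed
  have "transcendental_over (adjoin (range rf_const \<union> (\<lambda>g. of_mpoly (Y g)) ` carrier G
      \<union> semi ` (semi_index - {i}))) (semi i)"
  proof (rule transcendental_over_if_conjugates[OF \<tau>_hom])
    show "infinite (UNIV :: 'k set)" by (rule infinite_K)
    show "\<tau> c x = x" if x: "x \<in> range rf_const \<union> (\<lambda>g. of_mpoly (Y g)) ` carrier G
      \<union> semi ` (semi_index - {i})" for c x
    proof -
      consider "x \<in> range rf_const" | "x \<in> (\<lambda>g. of_mpoly (Y g)) ` carrier G"
        | "x \<in> semi ` (semi_index - {i})"
        using x by (elim UnE)
      then show ?thesis
      proof cases
        case 1
        then show ?thesis by (elim imageE) (simp add: \<tau>_def rf_subst_const)
      next
        case 2
        then show ?thesis by (elim imageE) (simp add: \<tau>_poly e_Y)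
      next
        case 3
        then obtain l where "l \<in> semi_index - {i}" "x = semi l" by (elim imageE)
        then have l: "l \<in> semi_index" "l \<noteq> i" "x = of_mpoly (S (fst l) (snd l))"
          by (simp_all add: semi_def)
        then show ?thesis
          using e_S[of "fst l" "snd l" c] by (simp add: \<tau>_poly semi_index_def mem_Times_iff)
      qed
    qed
    show "inj_on (\<lambda>c. \<tau> c (semi i)) UNIV"
    proof (rule inj_onI)
      fix c c' assume "\<tau> c (semi i) = \<tau> c' (semi i)"
      then have "mp_const (c * m) * d = mp_const (c' * m) * d"
        using e_S[OF i(2,4)] by (simp add: semi_def \<tau>_poly of_mpoly_eq_iff i(1))
      then have "mp_const (c * m) = (mp_const (c' * m) :: ('h, 'k) mpoly)" using d by simp
      then have "c * m = c' * m" by transfer (metis lookup_single_eq)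
      then show "c = c'" using card_kernel by (simp add: m_def)
    qed
  qed
  then show ?thesis by (simp only: L_def adjoin_adjoin_Un)
qed

section \<open>Generation of K(x(h) : h in H) over L\<close>

lemma rf_field_eq_adjoin_semi: "rf_field (carrier H) = adjoin (L \<union> semi ` semi_index)"
proof
  let ?N = "adjoin (L \<union> semi ` semi_index)"
  interpret N: field_subset ?N by (rule field_subset_adjoin)
  have LN: "L \<subseteq> ?N" and SN: "semi ` semi_index \<subseteq> ?N"
    using adjoin_superset[of "L \<union> semi ` semi_index"] by auto
  \<comment> \<open>\<open>z \<chi> g\<close> is the \<chi>-component of the variables over
    \<open>g\<close>, and \<open>S \<chi> j\<close> sums these components against j-th powers of the
    nodes. Interpolation recovers them; for the trivial character the component is
    \<open>Y g\<close> itself.\<close>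
  define z where "z \<chi> g = (\<Sum>h\<in>fibre g. rf_const (inverse (\<chi> h)) * rf_var h)" for \<chi> :: "'h \<Rightarrow> 'k" and g
  have S_z: "of_mpoly (S \<chi> j) = (\<Sum>g\<in>carrier G. of_mpoly (Y g) ^ j * z \<chi> g)" for \<chi> j
  proof -
    have "of_mpoly (S \<chi> j)
        = (\<Sum>h\<in>carrier H. of_mpoly (Y (\<pi> h)) ^ j * (rf_const (inverse (\<chi> h)) * rf_var h))"
      by (simp only: S_def of_mpoly_hom of_mpoly_const of_mpoly_var)
    also have "\<dots> = (\<Sum>g\<in>carrier G. of_mpoly (Y g) ^ j * z \<chi> g)"
      unfolding sum_fibres z_def sum_distrib_left by (intro sum.cong refl) (simp add: fibre_def)
    finally show ?thesis .
  qed
  have Y_inj': "inj_on (\<lambda>g. of_mpoly (Y g)) (carrier G)"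
    using Y_inj by (simp add: inj_on_def of_mpoly_eq_iff)
  have z_N: "z \<chi> g \<in> ?N" if \<chi>: "\<chi> \<in> Ch" and g: "g \<in> carrier G" for \<chi> g
  proof (cases "\<chi> = (\<lambda>_. 1)")
    case True
    then have "z \<chi> g = of_mpoly (Y g)"
      by (simp only: z_def Y_def of_mpoly_hom of_mpoly_var rf_const_1 inverse_1 mult_1)
    then show ?thesis using Y_in_L[OF g] LN by auto
  next
    case False
    show ?thesis
    proof (rule interpolation_in_field_subset[OF N.field_subset_axioms finite_G Y_inj' g])
      show "of_mpoly (Y g) \<in> ?N" if "g \<in> carrier G" for g using Y_in_L[OF that] LN by blast
      show "(\<Sum>g\<in>carrier G. of_mpoly (Y g) ^ j * z \<chi> g) \<in> ?N" if "j < card (carrier G)" for j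
      proof -
        have "(\<chi>, j) \<in> semi_index" using that \<chi> False by (simp add: semi_index_def)
        then have "semi (\<chi>, j) \<in> ?N" using SN by blast
        then show ?thesis by (simp add: semi_def S_z)
      qed
    qed
  qed
  have "rf_var h \<in> ?N" if h: "h \<in> carrier H" for h
  proof -
    \<comment> \<open>Fourier inversion on the fibre returns \<open>card Ch\<close> times the
      variable \<open>h\<close>. Any other point of the fibre differs from \<open>h\<close> by a
      nontrivial kernel element and cancels by \<open>column_sum\<close>.\<close>
    have "(\<Sum>\<chi>\<in>Ch. rf_const (\<chi> h) * z \<chi> (\<pi> h))
        = (\<Sum>h'\<in>fibre (\<pi> h). rf_const (\<Sum>\<chi>\<in>Ch. \<chi> h * inverse (\<chi> h')) * rf_var h')"
      unfolding z_def sum_distrib_left ring_hom_typeD(8)[OF ring_hom_type_rf_const] sum_distrib_right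
      by (subst sum.swap) (simp add: rf_const_mult mult.assoc)
    also have "\<dots> = (\<Sum>h'\<in>fibre (\<pi> h). if h' = h then rf_const (of_nat (card Ch)) * rf_var h else 0)"
    proof (intro sum.cong refl)
      fix h' assume "h' \<in> fibre (\<pi> h)"
      then have h': "h' \<in> carrier H" "\<pi> h' = \<pi> h" by (auto simp: fibre_def)
      show "rf_const (\<Sum>\<chi>\<in>Ch. \<chi> h * inverse (\<chi> h')) * rf_var h'
          = (if h' = h then rf_const (of_nat (card Ch)) * rf_var h else 0)"
      proof (cases "h' = h")
        case True
        then have "(\<Sum>\<chi>\<in>Ch. \<chi> h * inverse (\<chi> h')) = (\<Sum>\<chi>\<in>Ch. 1)"
          using character_nonzero[OF _ h] by (intro sum.cong) auto
        then show ?thesis using True by simp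
      next
        case False
        define c where "c = h \<otimes>\<^bsub>H\<^esub> inv\<^bsub>H\<^esub> h'"
        have cH: "c \<in> carrier H" "c \<otimes>\<^bsub>H\<^esub> h' = h" using h h' by (auto simp: c_def H.m_assoc)
        then have "\<pi> c \<otimes>\<^bsub>G\<^esub> \<pi> h' = \<pi> h'" using \<pi>_mult[of c h'] h' by simp
        then have "\<pi> c = \<one>\<^bsub>G\<^esub>" using cH(1) h'(1) G.r_cancel_one[of "\<pi> h'" "\<pi> c"] by simp
        then have ck: "c \<in> kernel H G \<pi>" using cH by (simp add: kernel_def)
        have "c \<noteq> \<one>\<^bsub>H\<^esub>" using cH h' False by auto
        have "(\<Sum>\<chi>\<in>Ch. \<chi> h * inverse (\<chi> h')) = (\<Sum>\<chi>\<in>Ch. \<chi> c)"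
        proof (intro sum.cong refl)
          fix \<chi> assume "\<chi> \<in> Ch"
          then show "\<chi> h * inverse (\<chi> h') = \<chi> c"
            using character_mult[of \<chi> c h'] cH h' character_nonzero[of \<chi> h'] by simp
        qed
        then show ?thesis
          using column_sum[OF ck \<open>c \<noteq> \<one>\<^bsub>H\<^esub>\<close>] False by (simp add: rf_const_0)
      qed
    qed
    also have "\<dots> = rf_const (of_nat (card Ch)) * rf_var h"
      using h finite_fibre[of "\<pi> h"] by (simp add: fibre_def)
    finally have eq: "(\<Sum>\<chi>\<in>Ch. rf_const (\<chi> h) * z \<chi> (\<pi> h)) = rf_const (of_nat (card Ch)) * rf_var h" .
    have "(\<Sum>\<chi>\<in>Ch. rf_const (\<chi> h) * z \<chi> (\<pi> h)) \<in> ?N"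
      using h const_in_L LN by (intro N.sum N.mult z_N) auto
    then have "rf_const (of_nat (card Ch)) * rf_var h / rf_const (of_nat (card Ch)) \<in> ?N"
      unfolding eq using const_in_L LN by (intro N.divide) auto
    moreover have "rf_const (of_nat (card Ch)) \<noteq> (0 :: ('h, 'k) ratfun)"
      using card_X by (simp add: rf_const_eq_0_iff)
    ultimately show ?thesis by simp
  qed
  then show "rf_field (carrier H) \<subseteq> ?N"
    unfolding rf_field_def using const_in_L LN by (intro adjoin_least N.field_subset_axioms) auto
  let ?R = "rf_field (carrier H) :: ('h, 'k) ratfun set"
  interpret R: field_subset ?R by (rule field_subset_rf_field)
  have const_R: "rf_const a \<in> ?R" and var_R: "h \<in> carrier H \<Longrightarrow> rf_var h \<in> ?R" for a h
    unfolding rf_field_def by (auto intro: generate_field.incl)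
  have Y_R: "of_mpoly (Y g) \<in> ?R" for g
    unfolding Y_def of_mpoly_hom of_mpoly_var by (intro R.sum var_R) (simp add: fibre_def)
  have "of_mpoly (S \<chi> j) \<in> ?R" for \<chi> j
    unfolding S_def of_mpoly_hom of_mpoly_const of_mpoly_var
    by (intro R.sum R.mult R.power Y_R const_R var_R)
  moreover have "L \<subseteq> ?R"
    unfolding L_def using const_R Y_R by (intro adjoin_least R.field_subset_axioms) auto
  ultimately show "?N \<subseteq> ?R"
    by (intro adjoin_least R.field_subset_axioms) (auto simp: semi_def)
qed

lemma rational_over_fixed_L:
  "rational_over (action.fixed_field (rf_field (carrier H))) (action.fixed_field L)"
  unfolding rf_field_eq_adjoin_semi
proof (rule action.rational_over_semi_invariants[where \<chi> = "\<lambda>i t. rf_const (fst i t)"])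
  show "finite semi_index" using finite_X by (simp add: semi_index_def)
  show "act t (semi i) = rf_const (fst i t) * semi i" if "i \<in> semi_index" "t \<in> carrier H" for i t
    using that
    by (auto simp: semi_def act_of_mpoly act_poly_S semi_index_def of_mpoly_const[symmetric])
qed (use field_subset_L L_stable transcendental_semi const_in_L in auto)

text \<open>\<open>act\<close> can differ from the substitution in the definition only at variables
  outside the carrier, and elements of \<open>rf_field (carrier H)\<close> are fractions free of
  these.\<close>

lemma noether_field_eq_fixed_field: "noether_field H = action.fixed_field (rf_field (carrier H))"
proof -
  have "rf_subst (\<lambda>g. rf_var (t \<otimes>\<^bsub>H\<^esub> g)) x = act t x"
    if "t \<in> carrier H" "x \<in> rf_field (carrier H)" for t and x :: "('h, 'k) ratfun"
  proof -
    have "independent_values (\<lambda>h. rf_var (if h \<in> carrier H then t \<otimes>\<^bsub>H\<^esub> h else h) :: ('h, 'k) ratfun) (carrier H)"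
      using independent_act[OF that(1)] by (simp add: independent_values_def)
    then show ?thesis
      unfolding act_def by (rule rf_subst_cong[symmetric]) (use that in auto)
  qed
  then show ?thesis by (auto simp: noether_field_def action.fixed_field_def)
qed

text \<open>Sending one chosen variable of each fibre to the variable of its image, and the others
  to 0, maps \<open>Y g\<close> back to the variable \<open>g\<close>.\<close>

lemma independent_Y: "independent_values (\<lambda>g. of_mpoly (Y g)) (carrier G)"
proof -
  define r where "r g = (SOME h. h \<in> fibre g)" for g
  have r: "r g \<in> fibre g" if "g \<in> carrier G" for g
  proof -
    have "g \<in> \<pi> ` carrier H" using that \<pi>_surj by simp
    then have "\<exists>h. h \<in> fibre g" by (auto simp: fibre_def)
    then show ?thesis unfolding r_def by (rule someI_ex)
  qed
  show ?thesis
  proof (rule independent_valuesI[where P = Y and s' = "\<lambda>h. if h = r (\<pi> h) then rf_var (\<pi> h) else 0"])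
    fix g assume g: "g \<in> carrier G"
    have "mp_eval rf_const (\<lambda>h. if h = r (\<pi> h) then rf_var (\<pi> h) else 0) (Y g)
        = (\<Sum>h\<in>fibre g. if h = r (\<pi> h) then rf_var (\<pi> h) else (0 :: ('g, 'k) ratfun))"
      by (simp add: Y_def ring_hom_typeD[OF mp_eval_rf_hom] mp_eval_simps)
    also have "\<dots> = (\<Sum>h\<in>fibre g. if h = r g then rf_var g else 0)"
      by (intro sum.cong) (auto simp: fibre_def)
    also have "\<dots> = rf_var g" using r[OF g] finite_fibre by simp
    finally show "mp_eval rf_const (\<lambda>h. if h = r (\<pi> h) then rf_var (\<pi> h) else 0) (Y g)
      = (rf_var g :: ('g, 'k) ratfun)" .
  qed simp
qed

lemma noether_embedding_eq: "noether_embedding H \<pi> = rf_subst (\<lambda>g. of_mpoly (Y g))"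
  unfolding noether_embedding_def Y_def of_mpoly_hom of_mpoly_var fibre_def ..

text \<open>The embedding carries the action of \<open>\<pi> t\<close> to that of \<open>t\<close>.
  As \<pi> is onto and the embedding injective, invariance under \<open>G\<close> before it is
  invariance under \<open>H\<close> after it.\<close>

lemma noether_embedding_image: "noether_embedding H \<pi> ` noether_field G = action.fixed_field L"
proof -
  let ?R = "rf_field (carrier G) :: ('g, 'k) ratfun set"
  define \<iota> where "\<iota> = (noether_embedding H \<pi> :: ('g, 'k) ratfun \<Rightarrow> _)"
  define \<gamma> where "\<gamma> u = rf_subst (\<lambda>g. rf_var (u \<otimes>\<^bsub>G\<^esub> g) :: ('g, 'k) ratfun)" for u
  have \<iota>: "field_hom ?R \<iota>"
    unfolding \<iota>_def noether_embedding_eq by (rule field_hom_rf_subst[OF independent_Y])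
  have L: "\<iota> ` ?R = L"
    unfolding \<iota>_def noether_embedding_eq rf_subst_image[OF independent_Y] L_def ..
  have \<iota>_var: "\<iota> (rf_var g) = of_mpoly (Y g)" and \<iota>_const: "\<iota> (rf_const b) = rf_const b" for g b
    by (simp_all add: \<iota>_def noether_embedding_eq rf_subst_var rf_subst_const)
  have ind: "independent_values (\<lambda>g. rf_var (u \<otimes>\<^bsub>G\<^esub> g) :: ('g, 'k) ratfun) (carrier G)" if "u \<in> carrier G" for u
    by (rule independent_valuesI[where P = "\<lambda>g. mp_var (u \<otimes>\<^bsub>G\<^esub> g)" and s' = "\<lambda>g. rf_var (inv\<^bsub>G\<^esub> u \<otimes>\<^bsub>G\<^esub> g)"])
      (use that in \<open>auto simp: rf_var_def[symmetric] mp_eval_simps G.m_assoc[symmetric]\<close>)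
  have \<gamma>: "field_hom ?R (\<gamma> u)" and \<gamma>_R: "\<gamma> u ` ?R \<subseteq> ?R" if u: "u \<in> carrier G" for u
  proof -
    show "field_hom ?R (\<gamma> u)" unfolding \<gamma>_def by (rule field_hom_rf_subst[OF ind[OF u]])
    have "(\<lambda>g. rf_var (u \<otimes>\<^bsub>G\<^esub> g)) ` carrier G \<subseteq> rf_var ` carrier G" using u by auto
    then show "\<gamma> u ` ?R \<subseteq> ?R"
      unfolding \<gamma>_def rf_subst_image[OF ind[OF u]] unfolding rf_field_def by (intro adjoin_mono) auto
  qed
  have equi: "\<iota> (\<gamma> (\<pi> t) x) = act t (\<iota> x)" if t: "t \<in> carrier H" and x: "x \<in> ?R" for t x
  proof -
    have "field_hom ?R (\<lambda>x. \<iota> (\<gamma> (\<pi> t) x))" "field_hom ?R (\<lambda>x. act t (\<iota> x))"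
      using field_hom_comp[OF \<gamma> \<iota> \<gamma>_R] field_hom_comp[OF \<iota> act_hom[OF t]] t by auto
    then show ?thesis
      by (rule rf_field_hom_eqI)
        (use t x in \<open>auto simp: \<gamma>_def rf_subst_const rf_subst_var \<iota>_var \<iota>_const act_const act_of_mpoly act_poly_Y\<close>)
  qed
  have fix_iff: "(\<forall>u\<in>carrier G. \<gamma> u x = x) \<longleftrightarrow> (\<forall>t\<in>carrier H. act t (\<iota> x) = \<iota> x)" if x: "x \<in> ?R" for x
  proof -
    have "(\<forall>u\<in>carrier G. \<gamma> u x = x) \<longleftrightarrow> (\<forall>t\<in>carrier H. \<gamma> (\<pi> t) x = x)"
      unfolding \<pi>_surj[symmetric] by simp
    also have "\<dots> \<longleftrightarrow> (\<forall>t\<in>carrier H. \<iota> (\<gamma> (\<pi> t) x) = \<iota> x)"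
      using inj_on_eq_iff[OF field_hom.inj_on[OF \<iota>], of _ x] \<gamma>_R x by (metis \<pi>_closed image_subset_iff)
    finally show ?thesis using equi x by simp
  qed
  have "noether_field G = {x \<in> ?R. \<forall>u\<in>carrier G. \<gamma> u x = x}"
    by (simp add: noether_field_def \<gamma>_def)
  then have "\<iota> ` noether_field G = {y \<in> \<iota> ` ?R. \<forall>t\<in>carrier H. act t y = y}"
    using fix_iff by auto
  then have "\<iota> ` noether_field G = action.fixed_field L"
    by (simp add: L action.fixed_field_def)
  then show ?thesis by (simp add: \<iota>_def)
qed

theorem rational_over_noether_field:
  "rational_over (noether_field H :: ('h, 'k) ratfun set) (noether_embedding H \<pi> ` noether_field G)"
  using rational_over_fixed_L by (simp add: noether_field_eq_fixed_field noether_embedding_image)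

end

section \<open>Existence of characters\<close>

text \<open>The powers of \<zeta> below \<open>k\<close> are \<open>k\<close> distinct roots of X^k
  - 1, which has no more than that.\<close>

lemma root_of_unity_eq_power:
  fixes \<zeta> :: "'k::field"
  assumes \<zeta>: "primitive_root_of_unity k \<zeta>" and w: "w ^ k = 1"
  obtains i where "w = \<zeta> ^ i"
proof -
  have k: "k > 0" "\<zeta> ^ k = 1" "\<And>j. 0 < j \<Longrightarrow> j < k \<Longrightarrow> \<zeta> ^ j \<noteq> 1"
    using \<zeta> by (auto simp: primitive_root_of_unity_def)
  then have "\<zeta> \<noteq> 0" by (auto simp: power_0_left)
  have inj: "inj_on (\<lambda>i. \<zeta> ^ i) {..<k}"
  proof (rule linorder_inj_onI')
    fix i j assume ij: "i \<in> {..<k}" "j \<in> {..<k}" "i < j"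
    show "\<zeta> ^ i \<noteq> \<zeta> ^ j"
    proof
      assume "\<zeta> ^ i = \<zeta> ^ j"
      also have "\<zeta> ^ j = \<zeta> ^ i * \<zeta> ^ (j - i)" using ij by (simp flip: power_add)
      finally have "\<zeta> ^ (j - i) = 1" using \<open>\<zeta> \<noteq> 0\<close> by simp
      moreover have "0 < j - i" "j - i < k" using ij by auto
      ultimately show False using k(3) by blast
    qed
  qed
  define P where "P = monom (1::'k) k - 1"
  have deg: "degree P \<le> k" unfolding P_def by (intro degree_diff_le degree_monom_le) simp
  have "coeff P k = 1" using k(1) by (simp add: P_def)
  then have P0: "P \<noteq> 0" by auto
  have roots: "poly P x = 0 \<longleftrightarrow> x ^ k = 1" for x by (simp add: P_def poly_monom)
  have fin: "finite {x. poly P x = 0}" by (rule poly_roots_finite[OF P0])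
  have "(\<lambda>i. \<zeta> ^ i) ` {..<k} = {x. poly P x = 0}"
  proof (rule card_seteq[OF fin])
    have "(\<zeta> ^ i) ^ k = 1" for i using k(2) by (metis mult.commute power_mult power_one)
    then show "(\<lambda>i. \<zeta> ^ i) ` {..<k} \<subseteq> {x. poly P x = 0}" by (auto simp: roots)
    show "card {x. poly P x = 0} \<le> card ((\<lambda>i. \<zeta> ^ i) ` {..<k})"
      using card_poly_roots_bound[OF P0] deg by (simp add: card_image[OF inj])
  qed
  then have "w \<in> (\<lambda>i. \<zeta> ^ i) ` {..<k}" using w by (simp add: roots)
  then show ?thesis using that by blast
qed

lemma primitive_root_dvd:
  assumes \<zeta>: "primitive_root_of_unity k \<zeta>" and "\<zeta> ^ j = 1"
  shows "k dvd j"
proof -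
  have k: "k > 0" "\<zeta> ^ k = 1" "\<And>j. 0 < j \<Longrightarrow> j < k \<Longrightarrow> \<zeta> ^ j \<noteq> 1"
    using \<zeta> by (auto simp: primitive_root_of_unity_def)
  have "\<zeta> ^ j = (\<zeta> ^ k) ^ (j div k) * \<zeta> ^ (j mod k)"
    by (simp flip: power_mult power_add)
  then have "\<zeta> ^ (j mod k) = 1" using k assms(2) by simp
  then show ?thesis using k(1) k(3)[of "j mod k"] by (auto simp: dvd_eq_mod_eq_0)
qed

lemma character_on_pow:
  assumes "group A" "subgroup T A" "character_on A T \<chi>" "a \<in> T"
  shows "a [^]\<^bsub>A\<^esub> (i::nat) \<in> T \<and> \<chi> (a [^]\<^bsub>A\<^esub> i) = \<chi> a ^ i"
proof -
  interpret group A by fact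
  interpret subgroup T A by fact
  show ?thesis
    by (induction i) (use assms(3,4) in \<open>auto simp: character_on_def\<close>)
qed

lemma (in group) subgroup_nat_pow_closed:
  assumes "subgroup T G" "a \<in> T"
  shows "a [^] (i::nat) \<in> T"
  by (induction i) (auto intro: subgroup.one_closed[OF assms(1)] subgroup.m_closed[OF assms(1)] assms(2))

text \<open>\<open>d\<close> is the order of \<open>x\<close> modulo \<open>T\<close>. The relations
  between \<open>x\<close> and \<open>T\<close> all come from \<open>x [^] d\<close>, so the
  condition on \<eta> is the only constraint on the new value.\<close>

lemma (in comm_group) extend_character:
  fixes \<chi> :: "'a \<Rightarrow> 'k::field"
  assumes T: "subgroup T G" and \<chi>: "character_on G T \<chi>" and x: "x \<in> carrier G"
    and d: "d > 0" "x [^] d \<in> T" "\<And>i. 0 < i \<Longrightarrow> i < d \<Longrightarrow> x [^] i \<notin> T"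
    and \<eta>: "\<eta> ^ d = \<chi> (x [^] d)"
  obtains T' \<chi>' where "subgroup T' G" "T \<subseteq> T'" "x \<in> T'" "character_on G T' \<chi>'"
    "\<And>a. a \<in> T \<Longrightarrow> \<chi>' a = \<chi> a" "\<chi>' x = \<eta>"
proof -
  interpret T: subgroup T G by fact
  have \<chi>m: "\<chi> (a \<otimes> b) = \<chi> a * \<chi> b" if "a \<in> T" "b \<in> T" for a b
    using \<chi> that by (simp add: character_on_def)
  have dvd: "x [^] i \<in> T \<Longrightarrow> d dvd i" for i :: nat
  proof -
    assume i: "x [^] i \<in> T"
    define q r where "q = i div d" and "r = i mod d"
    have "x [^] i = (x [^] d) [^] q \<otimes> x [^] r"
      using x by (simp add: nat_pow_pow nat_pow_mult q_def r_def)
    moreover have "(x [^] d) [^] q \<in> T" by (rule subgroup_nat_pow_closed[OF T d(2)])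
    ultimately have "x [^] r = inv ((x [^] d) [^] q) \<otimes> x [^] i"
      using x by (simp add: inv_solve_left)
    then have "x [^] r \<in> T"
      using i \<open>(x [^] d) [^] q \<in> T\<close> by simp
    then have "r = 0" using d(1) d(3)[of r] by (auto simp: r_def)
    then show "d dvd i" by (simp add: r_def dvd_eq_mod_eq_0)
  qed
  have \<chi>pow: "\<chi> (x [^] i) = \<eta> ^ i" if i: "x [^] i \<in> T" for i :: nat
  proof -
    obtain q where q: "i = d * q" using dvd[OF i] by (rule dvdE)
    have "\<chi> ((x [^] d) [^] q) = \<chi> (x [^] d) ^ q"
      using character_on_pow[OF group_axioms T \<chi> d(2)] by blast
    then show ?thesis using x by (simp add: q nat_pow_pow \<eta>[symmetric] power_mult)
  qed
  have wd: "\<chi> a * \<eta> ^ i = \<chi> b * \<eta> ^ j"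
    if ab: "a \<in> T" "b \<in> T" "a \<otimes> x [^] i = b \<otimes> x [^] j" "i \<le> j" for a b and i j :: nat
  proof -
    have "a \<otimes> x [^] i = (b \<otimes> x [^] (j - i)) \<otimes> x [^] i"
      using ab x by (simp add: m_assoc nat_pow_mult)
    then have eq: "a = b \<otimes> x [^] (j - i)" using ab x by simp
    then have "x [^] (j - i) = inv b \<otimes> a" using ab x by (simp add: m_assoc[symmetric])
    then have "x [^] (j - i) \<in> T" using ab by simp
    then have "\<chi> a = \<chi> b * \<eta> ^ (j - i)" using eq \<chi>m[OF ab(2)] \<chi>pow by simp
    then show ?thesis using ab(4) by (simp add: mult.assoc flip: power_add)
  qed
  \<comment> \<open>\<open>R\<close> collects the values from all representations of
    \<open>y\<close>; by \<open>wd\<close> they agree, so \<open>SOME\<close> has only one choice on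
    \<open>T'\<close>.\<close>
  define R where "R y v \<longleftrightarrow> (\<exists>a\<in>T. \<exists>i::nat. y = a \<otimes> x [^] i \<and> v = \<chi> a * \<eta> ^ i)" for y v
  define T' where "T' = {a \<otimes> x [^] i | a i. a \<in> T \<and> (i::nat) \<in> UNIV}"
  define \<chi>' where "\<chi>' y = (SOME v. R y v)" for y
  have \<chi>': "\<chi>' (a \<otimes> x [^] i) = \<chi> a * \<eta> ^ i" if "a \<in> T" for a and i :: nat
  proof -
    have "R (a \<otimes> x [^] i) (\<chi> a * \<eta> ^ i)" using that by (auto simp: R_def)
    moreover have "v = \<chi> a * \<eta> ^ i" if "R (a \<otimes> x [^] i) v" for v
    proof -
      obtain b j where b: "b \<in> T" "a \<otimes> x [^] i = b \<otimes> x [^] j" "v = \<chi> b * \<eta> ^ j"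
        using \<open>R _ v\<close> unfolding R_def by (elim bexE exE conjE)
      show ?thesis
        using wd[of a b i j] wd[of b a j i] b \<open>a \<in> T\<close> by (cases "i \<le> j") auto
    qed
    ultimately show ?thesis unfolding \<chi>'_def by (rule some_equality)
  qed
  have T'I: "a \<otimes> x [^] i \<in> T'" if "a \<in> T" for a and i :: nat
    using that by (auto simp: T'_def)
  have \<chi>'T: "\<chi>' a = \<chi> a" and T_T': "a \<in> T'" if "a \<in> T" for a
    using \<chi>'[OF that, of 0] T'I[OF that, of 0] that by simp_all
  have xT': "x \<in> T'" and \<chi>'x: "\<chi>' x = \<eta>"
    using T'I[OF T.one_closed, of 1] \<chi>'[OF T.one_closed, of 1] x \<chi> by (simp_all add: character_on_def)
  have m: "(a \<otimes> x [^] i) \<otimes> (b \<otimes> x [^] j) = (a \<otimes> b) \<otimes> x [^] (i + j)"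
    if "a \<in> T" "b \<in> T" for a b and i j :: nat
    using that x by (simp add: nat_pow_mult[symmetric] m_ac)
  have "subgroup T' G"
  proof
    show "T' \<subseteq> carrier G" using x by (auto simp: T'_def)
    show "\<one> \<in> T'" by (rule T_T'[OF T.one_closed])
    fix y assume "y \<in> T'"
    then obtain a i where y: "a \<in> T" "y = a \<otimes> x [^] (i::nat)" unfolding T'_def by blast
    \<comment> \<open>Exponents are natural numbers, so the inverse of \<open>x [^] i\<close> is
      written with exponent \<open>d * i - i\<close>, corrected by the inverse of
      \<open>x [^] (d * i)\<close>, which lies in \<open>T\<close>.\<close>
    have "i \<le> d * i" using d(1) by simp
    then have e: "d * i - i + i = d * i" by simp
    have xd: "x [^] (d * i) \<in> T"
      using subgroup_nat_pow_closed[OF T d(2), of i] x by (simp add: nat_pow_pow)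
    have swap: "(p \<otimes> q) \<otimes> u \<otimes> (r \<otimes> v) = (p \<otimes> r) \<otimes> (q \<otimes> (u \<otimes> v))"
      if "p \<in> carrier G" "q \<in> carrier G" "u \<in> carrier G" "r \<in> carrier G" "v \<in> carrier G" for p q u r v
      using that by (simp add: m_ac)
    have "inv y = (inv a \<otimes> inv (x [^] (d * i))) \<otimes> x [^] (d * i - i)"
    proof (rule inv_equality)
      have "(inv a \<otimes> inv (x [^] (d * i))) \<otimes> x [^] (d * i - i) \<otimes> (a \<otimes> x [^] i)
          = (inv a \<otimes> a) \<otimes> (inv (x [^] (d * i)) \<otimes> (x [^] (d * i - i) \<otimes> x [^] i))"
        using x y by (intro swap) auto
      also have "x [^] (d * i - i) \<otimes> x [^] i = x [^] (d * i)" using x by (simp only: nat_pow_mult e)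
      finally show "(inv a \<otimes> inv (x [^] (d * i))) \<otimes> x [^] (d * i - i) \<otimes> y = \<one>"
        using x y by simp
    qed (use x y in auto)
    moreover have "inv a \<otimes> inv (x [^] (d * i)) \<in> T" using y xd by simp
    ultimately show "inv y \<in> T'" using T'I by simp
    fix z assume "z \<in> T'"
    then obtain b j where z: "b \<in> T" "z = b \<otimes> x [^] (j::nat)" unfolding T'_def by blast
    have "y \<otimes> z = (a \<otimes> b) \<otimes> x [^] (i + j)" unfolding y(2) z(2) by (rule m[OF y(1) z(1)])
    moreover have "a \<otimes> b \<in> T" using y z by simp
    ultimately show "y \<otimes> z \<in> T'" using T'I by simp
  qed
  moreover have "character_on G T' \<chi>'"
    unfolding character_on_def
  proof (intro conjI ballI)
    show "\<chi>' \<one> = 1" using \<chi>'T[OF T.one_closed] \<chi> by (simp add: character_on_def)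
    fix y z assume "y \<in> T'" "z \<in> T'"
    then obtain a b i j where y: "a \<in> T" "y = a \<otimes> x [^] (i::nat)" and z: "b \<in> T" "z = b \<otimes> x [^] (j::nat)"
      unfolding T'_def by blast
    show "\<chi>' (y \<otimes> z) = \<chi>' y * \<chi>' z"
      unfolding y(2) z(2) m[OF y(1) z(1)] \<chi>'[OF y(1)] \<chi>'[OF z(1)] \<chi>'[OF T.m_closed[OF y(1) z(1)]]
      by (simp add: \<chi>m y z power_add mult_ac)
  qed
  ultimately show ?thesis
    using that[of T' \<chi>'] T_T' xT' \<chi>'T \<chi>'x by blast
qed

text \<open>Only characters trivial on the subgroup \<open>N\<close> of k-th powers are extended.
  Modulo \<open>N\<close> the exponent divides \<open>k\<close>, so the roots required at each
  extension are powers of \<zeta>.\<close>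

theorem (in comm_group) exists_separating_character:
  fixes \<zeta> :: "'k::field"
  assumes fin: "finite (carrier G)" and \<zeta>: "primitive_root_of_unity k \<zeta>"
    and c: "c \<in> carrier G" and not_power: "\<And>a. a \<in> carrier G \<Longrightarrow> a [^] k \<noteq> c"
  obtains \<chi> :: "'a \<Rightarrow> 'k" where "linear_character G \<chi>" "\<chi> c \<noteq> 1"
proof -
  have k: "k > 0" using \<zeta> by (simp add: primitive_root_of_unity_def)
  define N where "N = (\<lambda>a. a [^] k) ` carrier G"
  have N: "subgroup N G"
  proof
    show "N \<subseteq> carrier G" by (auto simp: N_def)
    show "\<one> \<in> N" unfolding N_def by (rule image_eqI[of _ _ \<one>]) auto
    fix x assume "x \<in> N"
    then obtain a where a: "a \<in> carrier G" "x = a [^] k" by (auto simp: N_def)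
    have "inv x = (inv a) [^] k" using a by (simp add: nat_pow_inv)
    then show "inv x \<in> N" unfolding N_def by (rule image_eqI) (use a in simp)
    fix y assume "y \<in> N"
    then obtain b where b: "b \<in> carrier G" "y = b [^] k" by (auto simp: N_def)
    have "x \<otimes> y = (a \<otimes> b) [^] k" using a b by (simp add: nat_pow_distrib)
    then show "x \<otimes> y \<in> N" unfolding N_def by (rule image_eqI) (use a b in simp)
  qed
  have cN: "c \<notin> N" using not_power by (auto simp: N_def)
  define Good where "Good T \<longleftrightarrow> (\<exists>\<chi> :: 'a \<Rightarrow> 'k. subgroup T G \<and> N \<subseteq> T \<and> c \<in> T \<and>
      character_on G T \<chi> \<and> (\<forall>a\<in>N. \<chi> a = 1) \<and> \<chi> c \<noteq> 1)" for T
  have least: "\<exists>d>0. x [^] d \<in> T \<and> (\<forall>i. 0 < i \<longrightarrow> i < d \<longrightarrow> x [^] i \<notin> T) \<and> d dvd k"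
    if T: "subgroup T G" "N \<subseteq> T" and x: "x \<in> carrier G" for T x
  proof -
    define d where "d = (LEAST d::nat. d > 0 \<and> x [^] d \<in> T)"
    have "k > 0 \<and> x [^] k \<in> T" using k T x by (auto simp: N_def)
    then have d: "d > 0 \<and> x [^] d \<in> T"
      unfolding d_def by (rule LeastI[where P = "\<lambda>d::nat. d > 0 \<and> x [^] d \<in> T"])
    have min: "x [^] i \<notin> T" if "0 < i" "i < d" for i
      using not_less_Least[of i "\<lambda>d::nat. d > 0 \<and> x [^] d \<in> T"] that unfolding d_def by blast
    have "x [^] k = (x [^] d) [^] (k div d) \<otimes> x [^] (k mod d)"
      using x by (simp add: nat_pow_pow nat_pow_mult)
    moreover have pT: "(x [^] d) [^] (k div d) \<in> T"
      by (rule subgroup_nat_pow_closed[OF T(1)]) (use d in blast)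
    ultimately have "x [^] (k mod d) = inv ((x [^] d) [^] (k div d)) \<otimes> x [^] k"
      using x by (simp add: inv_solve_left)
    moreover have "x [^] k \<in> T" using T(2) x by (auto simp: N_def)
    ultimately have "x [^] (k mod d) \<in> T"
      using pT subgroup.m_closed[OF T(1)] subgroup.m_inv_closed[OF T(1)] by simp
    then have "k mod d = 0" using min[of "k mod d"] d by auto
    then show ?thesis using d min by (auto simp: dvd_eq_mod_eq_0)
  qed
  have "\<exists>T. Good T"
  proof -
    obtain d where d: "d > 0" "c [^] d \<in> N" "\<And>i. 0 < i \<Longrightarrow> i < d \<Longrightarrow> c [^] i \<notin> N" "d dvd k"
      using least[OF N subset_refl c] by blast
    \<comment> \<open>As \<open>c\<close> is outside \<open>N\<close>, its order \<open>d\<close>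
      modulo \<open>N\<close> exceeds 1, and \<open>\<zeta> ^ (k div d)\<close> is an admissible
      value at \<open>c\<close> other than 1.\<close>
    have "d \<noteq> 1" using d(2) cN c by auto
    then have d2: "d \<ge> 2" using d(1) by simp
    have "k div d < k" "0 < k div d" using d d2 k by (auto simp: div_greater_zero_iff dvd_imp_le)
    then have ne: "\<zeta> ^ (k div d) \<noteq> 1" using \<zeta> by (simp add: primitive_root_of_unity_def)
    have "(\<zeta> ^ (k div d)) ^ d = (\<lambda>_. 1::'k) (c [^] d)"
      using d(4) \<zeta> by (simp add: primitive_root_of_unity_def flip: power_mult)
    moreover have "character_on G N (\<lambda>_. 1::'k)" by (simp add: character_on_def)
    ultimately obtain T \<chi> where "subgroup T G" "N \<subseteq> T" "c \<in> T" "character_on G T \<chi>"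
      "\<And>a. a \<in> N \<Longrightarrow> \<chi> a = (1::'k)" "\<chi> c = \<zeta> ^ (k div d)"
      using extend_character[OF N _ c d(1-3), of "\<lambda>_. 1"] by metis
    then show ?thesis unfolding Good_def using ne by metis
  qed
  then obtain T0 where "Good T0" by blast
  \<comment> \<open>Sizes are bounded in a finite group, so a domain of largest cardinality takes
    the place of Zorn's lemma.\<close>
  have "\<exists>T. Good T \<and> (\<forall>T'. Good T' \<longrightarrow> card T' \<le> card T)"
  proof (rule ex_has_greatest_nat[where P = Good and f = card])
    show "Good T0" by fact
    show "\<forall>T. Good T \<longrightarrow> card T < Suc (card (carrier G))"
      unfolding Good_def using fin by (auto simp: less_Suc_eq_le intro!: card_mono dest: subgroup.subset)
  qed
  then obtain T where T: "Good T" and max: "\<And>T'. Good T' \<Longrightarrow> card T' \<le> card T" by blast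
  obtain \<chi> :: "'a \<Rightarrow> 'k" where \<chi>: "subgroup T G" "N \<subseteq> T" "c \<in> T" "character_on G T \<chi>"
    "\<forall>a\<in>N. \<chi> a = 1" "\<chi> c \<noteq> 1"
    using T unfolding Good_def by (elim exE conjE)
  have "T = carrier G"
  proof (rule ccontr)
    assume "T \<noteq> carrier G"
    then obtain x where x: "x \<in> carrier G" "x \<notin> T" using subgroup.subset[OF \<chi>(1)] by auto
    obtain d where d: "d > 0" "x [^] d \<in> T" "\<And>i. 0 < i \<Longrightarrow> i < d \<Longrightarrow> x [^] i \<notin> T" "d dvd k"
      using least[OF \<chi>(1,2) x(1)] by blast
    have kd: "d * (k div d) = k" using d(4) by simp
    define w where "w = \<chi> (x [^] d)"
    \<comment> \<open>\<open>x [^] k\<close> lies in \<open>N\<close>, where \<chi> is trivial.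
      Hence \<open>w\<close> is a power of \<zeta> with exponent divisible by \<open>d\<close> and
      has a \<open>d\<close>-th root in the field.\<close>
    have "\<chi> ((x [^] d) [^] (k div d)) = w ^ (k div d)"
      unfolding w_def using character_on_pow[OF group_axioms \<chi>(1,4) d(2)] by blast
    moreover have "(x [^] d) [^] (k div d) \<in> N" using x kd by (auto simp: nat_pow_pow N_def)
    ultimately have wk: "w ^ (k div d) = 1" using \<chi>(5) by simp
    then have "w ^ k = 1" by (metis kd mult.commute power_mult power_one)
    then obtain i where i: "w = \<zeta> ^ i" using root_of_unity_eq_power[OF \<zeta>] by metis
    have "k dvd i * (k div d)"
      using primitive_root_dvd[OF \<zeta>] wk by (simp add: i flip: power_mult)
    then have "d * (k div d) dvd i * (k div d)" by (simp only: kd)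
    moreover have "k div d \<noteq> 0" using kd k by (intro notI) simp
    ultimately have "d dvd i" by simp
    then obtain j where j: "i = d * j" by (rule dvdE)
    have "(\<zeta> ^ j) ^ d = \<chi> (x [^] d)"
      unfolding w_def[symmetric] i j by (simp add: mult.commute flip: power_mult)
    then obtain T' \<chi>' where T': "subgroup T' G" "T \<subseteq> T'" "x \<in> T'" "character_on G T' \<chi>'"
      "\<And>a. a \<in> T \<Longrightarrow> \<chi>' a = \<chi> a"
      using extend_character[OF \<chi>(1,4) x(1) d(1-3)] by metis
    have "Good T'"
      unfolding Good_def using T' \<chi> by (intro exI[of _ \<chi>'] conjI) (auto simp: subset_iff)
    moreover have "card T < card T'"
      using T' x fin by (intro psubset_card_mono) (auto dest: subgroup.subset intro: finite_subset)
    ultimately show False using max[of T'] by simp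
  qed
  then show ?thesis
    using that[of \<chi>] \<chi> by (simp add: character_on_def)
qed

lemma linear_character_mult:
  "linear_character H \<chi> \<Longrightarrow> linear_character H \<psi> \<Longrightarrow> linear_character H (\<lambda>x. \<chi> x * \<psi> x)"
  by (simp add: character_on_def)

lemma linear_character_inverse:
  "linear_character H \<chi> \<Longrightarrow> linear_character H (\<lambda>x. inverse (\<chi> x))"
  by (simp add: character_on_def)

text \<open>The restrictions to the kernel of characters of \<open>H\<close> form a group under
  multiplication, and by \<open>sep\<close> they distinguish every nontrivial kernel element from
  the unit. Both orthogonality relations follow.\<close>

lemma noether_extensionI:
  fixes H :: "'h monoid" and G :: "'g monoid"
  assumes H: "group H" "finite (carrier H)" and G: "group G" and epi: "\<pi> \<in> epi H G"
    and sep: "\<And>c. c \<in> kernel H G \<pi> \<Longrightarrow> c \<noteq> \<one>\<^bsub>H\<^esub> \<Longrightarrow> \<exists>\<chi> :: 'h \<Rightarrow> 'k::field. linear_character H \<chi> \<and> \<chi> c \<noteq> 1"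
    and card: "of_nat (card (kernel H G \<pi>)) \<noteq> (0::'k)"
    and inf: "infinite (UNIV :: 'k set)"
  shows "\<exists>Ch :: ('h \<Rightarrow> 'k) set. noether_extension H G \<pi> Ch"
proof -
  interpret H: group H by fact
  interpret \<pi>: group_hom H G \<pi>
    using H G epi by (simp add: group_hom_def group_hom_axioms_def epi_def)
  define C where "C = kernel H G \<pi>"
  interpret C: subgroup C H unfolding C_def by (rule \<pi>.subgroup_kernel)
  have CH: "C \<subseteq> carrier H" by (rule C.subset)
  have finC: "finite C" using CH H(2) finite_subset by blast
  define D where "D = (\<lambda>\<chi>. restrict \<chi> C) ` {\<chi> :: 'h \<Rightarrow> 'k. linear_character H \<chi>}"
  define one where "one = restrict (\<lambda>_. 1 :: 'k) C"
  have triv: "linear_character H (\<lambda>_. 1 :: 'k)" by (simp add: character_on_def)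
  then have one_D: "one \<in> D" unfolding D_def one_def by (intro image_eqI[of _ _ "\<lambda>_. 1"]) auto
  have nz: "\<chi> c \<noteq> 0" if "linear_character H \<chi>" "c \<in> carrier H" for \<chi> :: "'h \<Rightarrow> 'k" and c
  proof -
    have "\<chi> c * \<chi> (inv\<^bsub>H\<^esub> c) = \<chi> (c \<otimes>\<^bsub>H\<^esub> inv\<^bsub>H\<^esub> c)"
      using that unfolding character_on_def by (metis H.inv_closed)
    also have "\<dots> = 1" using that by (simp add: character_on_def)
    finally show ?thesis by auto
  qed
  have finD: "finite D"
  proof -
    \<comment> \<open>Character values are roots of X^N - 1, so only finitely many functions on
      \<open>C\<close> arise.\<close>
    define N where "N = Coset.order H"
    have N: "N > 0" using H(2) H.order_gt_0_iff_finite by (simp add: N_def)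
    define R where "R = {v :: 'k. v ^ N = 1}"
    define P where "P = monom (1::'k) N - 1"
    have "coeff P N = 1" using N by (simp add: P_def)
    then have "P \<noteq> 0" by auto
    moreover have "R = {v. poly P v = 0}" by (simp add: R_def P_def poly_monom)
    ultimately have "finite R" by (simp add: poly_roots_finite)
    have "D \<subseteq> PiE C (\<lambda>_. R)"
    proof
      fix \<psi> assume "\<psi> \<in> D"
      then obtain \<chi> where \<chi>: "linear_character H \<chi>" "\<psi> = restrict \<chi> C" by (auto simp: D_def)
      have "\<chi> c \<in> R" if "c \<in> C" for c
        using character_on_pow[OF H(1) H.subgroup_self \<chi>(1), of c N] H.pow_order_eq_1[of c] that CH \<chi>(1)
        by (auto simp: R_def N_def character_on_def)
      then show "\<psi> \<in> PiE C (\<lambda>_. R)" using \<chi>(2) by auto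
    qed
    then show ?thesis
      by (rule finite_subset) (intro finite_PiE finC \<open>finite R\<close>)
  qed
  \<comment> \<open>One extension to \<open>H\<close> per restriction. The exception at
    \<open>one\<close> makes the constant function represent the trivial restriction.\<close>
  define rep where "rep \<psi> = (if \<psi> = one then (\<lambda>_. 1) else SOME \<chi>. linear_character H \<chi> \<and> restrict \<chi> C = \<psi>)" for \<psi>
  have rep: "linear_character H (rep \<psi>) \<and> restrict (rep \<psi>) C = \<psi>" if "\<psi> \<in> D" for \<psi>
  proof (cases "\<psi> = one")
    case True
    then show ?thesis using triv by (simp add: rep_def one_def)
  next
    case False
    have "\<exists>\<chi>. linear_character H \<chi> \<and> restrict \<chi> C = \<psi>" using \<open>\<psi> \<in> D\<close> by (auto simp: D_def)
    then have "linear_character H (SOME \<chi>. linear_character H \<chi> \<and> restrict \<chi> C = \<psi>) \<and>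
        restrict (SOME \<chi>. linear_character H \<chi> \<and> restrict \<chi> C = \<psi>) C = \<psi>"
      by (rule someI_ex[of "\<lambda>\<chi>. linear_character H \<chi> \<and> restrict \<chi> C = \<psi>"])
    then show ?thesis using False by (simp add: rep_def)
  qed
  have rep_C: "rep \<psi> c = \<psi> c" if "\<psi> \<in> D" "c \<in> C" for \<psi> c
    using rep[OF that(1)] that(2) by (metis restrict_apply')
  have inj: "inj_on rep D" by (rule inj_onI) (metis rep)
  define Ch where "Ch = rep ` D"
  have col: "(\<Sum>\<chi>\<in>Ch. \<chi> c) = 0" if c: "c \<in> C" "c \<noteq> \<one>\<^bsub>H\<^esub>" for c
  proof -
    obtain \<chi>0 :: "'h \<Rightarrow> 'k" where \<chi>0: "linear_character H \<chi>0" "\<chi>0 c \<noteq> 1"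
      using sep[of c] c unfolding C_def by blast
    \<comment> \<open>Multiplication by \<open>\<chi>0\<close> permutes \<open>D\<close>, so the sum
      equals \<open>\<chi>0 c\<close> times itself, and \<open>\<chi>0 c \<noteq> 1\<close>.\<close>
    have "(\<Sum>\<psi>\<in>D. \<psi> c) = (\<Sum>\<psi>\<in>D. restrict (\<lambda>x. \<chi>0 x * \<psi> x) C c)"
    proof (rule sum.reindex_bij_witness[of _ "\<lambda>\<psi>. restrict (\<lambda>x. \<chi>0 x * \<psi> x) C"
          "\<lambda>\<psi>. restrict (\<lambda>x. inverse (\<chi>0 x) * \<psi> x) C"])
      have closed: "restrict (\<lambda>x. \<xi> x * \<psi> x) C \<in> D" if "linear_character H \<xi>" "\<psi> \<in> D" for \<xi> \<psi>
        unfolding D_def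
        by (rule image_eqI[of _ _ "\<lambda>x. \<xi> x * rep \<psi> x"])
          (use that rep_C[OF that(2)] rep[OF that(2)] in \<open>auto simp: linear_character_mult\<close>)
      fix \<psi> assume \<psi>: "\<psi> \<in> D"
      show "restrict (\<lambda>x. \<chi>0 x * \<psi> x) C \<in> D" by (rule closed[OF \<chi>0(1) \<psi>])
      show "restrict (\<lambda>x. inverse (\<chi>0 x) * \<psi> x) C \<in> D"
        by (rule closed[OF linear_character_inverse[OF \<chi>0(1)] \<psi>])
      have ext: "restrict \<psi> C = \<psi>" using rep[OF \<psi>] by (metis restrict_restrict Int_absorb)
      have nz': "\<chi>0 x \<noteq> 0" if "x \<in> C" for x using nz[OF \<chi>0(1)] CH that by blast
      have "restrict (\<lambda>x. \<chi>0 x * restrict (\<lambda>x. inverse (\<chi>0 x) * \<psi> x) C x) C = restrict \<psi> C"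
        "restrict (\<lambda>x. inverse (\<chi>0 x) * restrict (\<lambda>x. \<chi>0 x * \<psi> x) C x) C = restrict \<psi> C"
        using nz' by (auto simp: restrict_def)
      then show 1: "restrict (\<lambda>x. \<chi>0 x * restrict (\<lambda>x. inverse (\<chi>0 x) * \<psi> x) C x) C = \<psi>"
        and "restrict (\<lambda>x. inverse (\<chi>0 x) * restrict (\<lambda>x. \<chi>0 x * \<psi> x) C x) C = \<psi>"
        by (simp_all only: ext)
      show "restrict (\<lambda>x. \<chi>0 x * restrict (\<lambda>x. inverse (\<chi>0 x) * \<psi> x) C x) C c = \<psi> c" by (simp only: 1)
    qed
    also have "\<dots> = \<chi>0 c * (\<Sum>\<psi>\<in>D. \<psi> c)" using c(1) by (simp add: sum_distrib_left)
    finally have "(1 - \<chi>0 c) * (\<Sum>\<psi>\<in>D. \<psi> c) = 0" by (simp add: algebra_simps)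
    then have "(\<Sum>\<psi>\<in>D. \<psi> c) = 0" using \<chi>0(2) by simp
    then show ?thesis unfolding Ch_def using rep_C c(1) by (simp add: sum.reindex[OF inj])
  qed
  have char: "linear_character H \<chi>" if "\<chi> \<in> Ch" for \<chi> using that rep by (auto simp: Ch_def)
  have differ: "\<exists>c\<in>C. \<chi> c \<noteq> \<psi> c" if "\<chi> \<in> Ch" "\<psi> \<in> Ch" "\<chi> \<noteq> \<psi>" for \<chi> \<psi>
  proof (rule ccontr)
    assume "\<not> ?thesis"
    then have "restrict \<chi> C = restrict \<psi> C" by (auto simp: restrict_def)
    moreover obtain \<chi>' \<psi>' where "\<chi> = rep \<chi>'" "\<chi>' \<in> D" "\<psi> = rep \<psi>'" "\<psi>' \<in> D"
      using \<open>\<chi> \<in> Ch\<close> \<open>\<psi> \<in> Ch\<close> by (auto simp: Ch_def)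
    ultimately show False using rep \<open>\<chi> \<noteq> \<psi>\<close> by metis
  qed
  have triv_Ch: "(\<lambda>_. 1) \<in> Ch"
    unfolding Ch_def by (rule image_eqI[OF _ one_D]) (simp add: rep_def)
  have row: "(\<Sum>c\<in>C. \<chi> c) = (if \<chi> = (\<lambda>_. 1) then of_nat (card C) else 0)" if \<chi>: "\<chi> \<in> Ch" for \<chi>
  proof (cases "\<chi> = (\<lambda>_. 1)")
    case False
    then obtain b where b: "b \<in> C" "\<chi> b \<noteq> 1" using differ[OF \<chi> triv_Ch] by auto
    have "(\<Sum>c\<in>C. \<chi> c) = (\<Sum>c\<in>C. \<chi> (b \<otimes>\<^bsub>H\<^esub> c))"
      by (rule sum.reindex_bij_witness[of _ "\<lambda>c. b \<otimes>\<^bsub>H\<^esub> c" "\<lambda>c. inv\<^bsub>H\<^esub> b \<otimes>\<^bsub>H\<^esub> c"])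
        (use b C.mem_carrier in \<open>auto simp: H.m_assoc[symmetric]\<close>)
    also have "\<dots> = \<chi> b * (\<Sum>c\<in>C. \<chi> c)"
      unfolding sum_distrib_left using char[OF \<chi>] b CH
      by (intro sum.cong refl) (auto simp: character_on_def)
    finally have "(1 - \<chi> b) * (\<Sum>c\<in>C. \<chi> c) = 0" by (simp add: algebra_simps)
    then show ?thesis using b False by simp
  qed simp
  have finCh: "finite Ch" using finD by (simp add: Ch_def)
  text \<open>Summing all the values \<open>\<chi> c\<close> by rows and by columns compares the two cardinalities in the field.\<close>
  have "\<chi> \<one>\<^bsub>H\<^esub> = 1" if "\<chi> \<in> Ch" for \<chi> using char[OF that] by (simp add: character_on_def)
  then have "(\<Sum>\<chi>\<in>Ch. \<chi> \<one>\<^bsub>H\<^esub>) = (\<Sum>\<chi>\<in>Ch. 1)" by (rule sum.cong[OF refl])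
  then have "(\<Sum>c\<in>C. \<Sum>\<chi>\<in>Ch. \<chi> c) = (\<Sum>c\<in>C. if c = \<one>\<^bsub>H\<^esub> then of_nat (card Ch) else 0)"
    using col by (intro sum.cong) auto
  also have "\<dots> = of_nat (card Ch)" using finC C.one_closed by simp
  finally have "of_nat (card Ch) = (\<Sum>\<chi>\<in>Ch. \<Sum>c\<in>C. \<chi> c)" by (subst sum.swap) simp
  also have "\<dots> = (\<Sum>\<chi>\<in>Ch. if \<chi> = (\<lambda>_. 1) then of_nat (card C) else 0)"
    by (intro sum.cong refl row)
  also have "\<dots> = of_nat (card C)" using finCh triv_Ch by simp
  finally have "of_nat (card Ch) \<noteq> (0::'k)" using card by (simp add: C_def)
  then have "noether_extension H G \<pi> Ch"
    using H G epi finCh char triv_Ch differ col card inf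
    by (simp add: noether_extension_def noether_extension_axioms_def C_def)
  then show ?thesis by blast
qed

section \<open>Central extensions of finite p-groups\<close>

text \<open>The group order is a candidate, so the minimum in \<open>group_exponent\<close> is
  attained.\<close>

lemma exists_group_exponent:
  assumes "group G" "finite (carrier G)"
  shows "0 < group_exponent G \<and> (\<forall>x\<in>carrier G. x [^]\<^bsub>G\<^esub> group_exponent G = \<one>\<^bsub>G\<^esub>)"
proof -
  interpret group G by fact
  show ?thesis
    unfolding group_exponent_def
    by (rule LeastI[of _ "Coset.order G"])
      (use assms(2) order_gt_0_iff_finite pow_order_eq_1 in auto)
qed

theorem theorem2p8:
  fixes p n e :: nat
    and H :: "'h monoid" and G :: "'g monoid" and \<pi> :: "'h \<Rightarrow> 'g" and C :: "'h set"
  assumes "Factorial_Ring.prime p"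
    and "finite_p_group p H" and "finite_p_group p G"
    and "\<pi> \<in> epi H G" and "C = kernel H G \<pi>" and "C \<subseteq> group_center H"
    and "group_exponent (H\<lparr>carrier := C\<rparr>) = p ^ n"
    and "group_exponent (abelianization G) = p ^ e"
    and "derived_subgroup H \<inter> C = {\<one>\<^bsub>H\<^esub>}"
    and "infinite (UNIV :: 'k::field set)" and "CHAR('k) \<noteq> p"
  shows "(1 \<le> n \<longrightarrow> cyclic_group (H\<lparr>carrier := C\<rparr>) \<longrightarrow> card C = p ^ n \<longrightarrow>
           (\<forall>m. m = Max {i. \<exists>D. subgroup D (abelianization H) \<and>
                              cyclic_group ((abelianization H)\<lparr>carrier := D\<rparr>) \<and>
                              card D = p ^ i \<and>
                              D \<inter> abelianization_image H C \<noteq> {\<one>\<^bsub>abelianization H\<^esub>}} \<longrightarrow>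
              (\<exists>\<zeta>::'k. primitive_root_of_unity (p ^ m) \<zeta>) \<longrightarrow>
              rational_over (noether_field H :: ('h, 'k) ratfun set)
                (noether_embedding H \<pi> ` noether_field G)))
       \<and> ((\<exists>\<zeta>::'k. primitive_root_of_unity (p ^ (n + e)) \<zeta>) \<longrightarrow>
              rational_over (noether_field H :: ('h, 'k) ratfun set)
                (noether_embedding H \<pi> ` noether_field G))"
proof -
  note prime = assms(1)
  interpret H: group H using assms(2) by (simp add: finite_p_group_def)
  interpret G: group G using assms(3) by (simp add: finite_p_group_def)
  obtain a where a: "Coset.order H = p ^ a" using assms(2) by (auto simp: finite_p_group_def)
  have p0: "p > 0" using prime by (simp add: prime_gt_0_nat)
  have finH: "finite (carrier H)" using a p0 H.order_gt_0_iff_finite by simp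
  have \<pi>: "\<pi> \<in> hom H G" "\<pi> ` carrier H = carrier G" using assms(4) by (auto simp: epi_def)
  have finG: "finite (carrier G)" using finH \<pi>(2) by (metis finite_imageI)
  interpret \<pi>: group_hom H G \<pi> using \<pi>(1) by unfold_locales
  have C: "subgroup C H" unfolding assms(5) by (rule \<pi>.subgroup_kernel)
  interpret C: subgroup C H by fact
  define A where "A = abelianization H"
  define q where "q = (\<lambda>x. derived_subgroup H #>\<^bsub>H\<^esub> x)"
  have normal: "derived_subgroup H \<lhd> H" by (rule H.derived_self_is_normal)
  interpret A: comm_group A unfolding A_def by (rule H.derived_quot_is_comm_group)
  have q: "q \<in> hom H A" unfolding q_def A_def by (rule normal.r_coset_hom_Mod[OF normal])
  interpret q: group_hom H A q using q by unfold_locales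
  have carrierA: "carrier A = q ` carrier H"
    unfolding A_def q_def FactGroup_def RCOSETS_def by auto
  have finA: "finite (carrier A)" using finH by (simp add: carrierA)
  have q_one: "q x = \<one>\<^bsub>A\<^esub> \<longleftrightarrow> x \<in> derived_subgroup H" if "x \<in> carrier H" for x
  proof -
    have "\<one>\<^bsub>A\<^esub> = derived_subgroup H" by (simp add: A_def)
    then show ?thesis
      using that H.coset_join1 H.coset_join2 normal_imp_subgroup[OF normal]
      unfolding q_def by (metis subgroup.subset)
  qed
  \<comment> \<open>Here the trivial intersection of H' and \<open>C\<close> enters:
    \<open>C\<close> embeds into \<open>A\<close>.\<close>
  have q_ne: "q c \<noteq> \<one>\<^bsub>A\<^esub>" if "c \<in> C" "c \<noteq> \<one>\<^bsub>H\<^esub>" for c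
    using q_one[of c] that assms(9) C.mem_carrier by blast
  \<comment> \<open>Common reduction of (i) and (ii) to a statement on k-th powers in
    \<open>A\<close>: characters of \<open>A\<close> separating \<open>C\<close> pull back to
    \<open>H\<close> along \<open>q\<close>.\<close>
  have key: "rational_over (noether_field H :: ('h, 'k) ratfun set) (noether_embedding H \<pi> ` noether_field G)"
    if \<zeta>: "primitive_root_of_unity k (\<zeta>::'k)"
      and np: "\<And>c x. c \<in> C \<Longrightarrow> c \<noteq> \<one>\<^bsub>H\<^esub> \<Longrightarrow> x \<in> carrier A \<Longrightarrow> x [^]\<^bsub>A\<^esub> k \<noteq> q c" for k \<zeta>
  proof -
    have sep: "\<exists>\<chi> :: 'h \<Rightarrow> 'k. linear_character H \<chi> \<and> \<chi> c \<noteq> 1"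
      if ck: "c \<in> kernel H G \<pi>" "c \<noteq> \<one>\<^bsub>H\<^esub>" for c
    proof -
      have c: "c \<in> C" "c \<in> carrier H" "q c \<in> carrier A" using ck C.mem_carrier by (auto simp: assms(5))
      obtain \<chi> :: "'h set \<Rightarrow> 'k" where \<chi>: "linear_character A \<chi>" "\<chi> (q c) \<noteq> 1"
        using A.exists_separating_character[OF finA \<zeta> c(3)] np[OF c(1) ck(2)] by metis
      have "linear_character H (\<lambda>x. \<chi> (q x))"
        using \<chi>(1) by (simp add: character_on_def)
      then show ?thesis using \<chi>(2) by blast
    qed
    have dvd: "card C dvd p ^ a"
      using H.lagrange[OF C] by (metis a dvd_triv_right)
    have "of_nat (card C) \<noteq> (0::'k)"
    proof
      assume "of_nat (card C) = (0::'k)"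
      then have "CHAR('k) dvd p ^ a"
        using dvd dvd_trans by (auto simp: of_nat_eq_0_iff_char_dvd)
      \<comment> \<open>\<open>CHAR\<close> is 0 in characteristic zero. A divisor of
        \<open>p ^ a\<close> is nonzero, so here it would be a prime dividing a power of
        \<open>p\<close>, that is \<open>p\<close> itself.\<close>
      moreover from this have "CHAR('k) > 0" using p0 by (auto intro: Nat.gr0I)
      then have "Factorial_Ring.prime CHAR('k)" by (rule prime_CHAR_semidom)
      ultimately show False
        using prime assms(11) by (metis prime_dvd_power primes_dvd_imp_eq)
    qed
    then obtain Ch :: "('h \<Rightarrow> 'k) set" where "noether_extension H G \<pi> Ch"
      using noether_extensionI[OF H.group_axioms finH G.group_axioms assms(4) sep _ assms(10)]
      unfolding assms(5) by metis
    then show ?thesis by (rule noether_extension.rational_over_noether_field)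
  qed
  show ?thesis
  proof (intro conjI impI allI)
    fix m
    define I where "I = {i. \<exists>D. subgroup D A \<and> cyclic_group (A\<lparr>carrier := D\<rparr>) \<and>
        card D = p ^ i \<and> D \<inter> abelianization_image H C \<noteq> {\<one>\<^bsub>A\<^esub>}}"
    assume "m = Max {i. \<exists>D. subgroup D (abelianization H) \<and>
        cyclic_group ((abelianization H)\<lparr>carrier := D\<rparr>) \<and> card D = p ^ i \<and>
        D \<inter> abelianization_image H C \<noteq> {\<one>\<^bsub>abelianization H\<^esub>}}"
    then have m: "m = Max I" by (simp only: I_def A_def)
    assume "\<exists>\<zeta>::'k. primitive_root_of_unity (p ^ m) \<zeta>"
    then obtain \<zeta> :: 'k where \<zeta>: "primitive_root_of_unity (p ^ m) \<zeta>" by blast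
    \<comment> \<open>\<open>Max\<close> is an upper bound only for a finite set; here
      \<open>p ^ i\<close> is at most the order of \<open>A\<close>.\<close>
    have finI: "finite I"
    proof (rule finite_subset)
      show "I \<subseteq> {..card (carrier A)}"
      proof
        fix i assume "i \<in> I"
        then obtain D where "subgroup D A" "card D = p ^ i" by (auto simp: I_def)
        then have "p ^ i \<le> card (carrier A)"
          using card_mono[OF finA] subgroup.subset by metis
        moreover have "i < p ^ i" using prime by (intro power_gt_expt prime_gt_Suc_0_nat)
        ultimately show "i \<in> {..card (carrier A)}" by simp
      qed
    qed simp
    show "rational_over (noether_field H :: ('h, 'k) ratfun set) (noether_embedding H \<pi> ` noether_field G)"
    proof (rule key[OF \<zeta>], rule notI)
      fix c x assume c: "c \<in> C" "c \<noteq> \<one>\<^bsub>H\<^esub>" and x: "x \<in> carrier A" and eq: "x [^]\<^bsub>A\<^esub> (p ^ m) = q c"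
      \<comment> \<open>The cyclic group of \<open>x\<close> contains \<open>q c\<close>, so its
        order \<open>p ^ i\<close> takes part in the maximum. Then \<open>i \<le> m\<close> makes
        the p^m-th power of \<open>x\<close> trivial, against \<open>q c\<close> being
        nontrivial.\<close>
      define D where "D = generate A {x}"
      have D: "subgroup D A" unfolding D_def using x by (intro A.generate_is_subgroup) simp
      have cyc: "cyclic_group (A\<lparr>carrier := D\<rparr>)"
        using A.cyclic_group_generated[of x] x by (simp add: subgroup_generated_def D_def)
      have card_D: "card D = A.ord x" unfolding D_def using A.generate_pow_card[OF x] by simp
      have "card (derived_subgroup H) * card (carrier A) = p ^ a"
        using H.lagrange[OF normal_imp_subgroup[OF normal]] a
        by (simp add: A_def FactGroup_def mult.commute)
      then have "A.ord x dvd p ^ a"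
        using A.ord_dvd_group_order[OF x] by (metis Coset.order_def dvd_mult)
      then obtain i where i: "A.ord x = p ^ i" using divides_primepow_nat[OF prime] by blast
      have "q c \<in> D"
        unfolding D_def A.generate_pow_on_finite_carrier[OF finA x] eq[symmetric] by blast
      moreover have "q c \<in> abelianization_image H C"
        using c(1) by (simp add: abelianization_image_def q_def)
      ultimately have "D \<inter> abelianization_image H C \<noteq> {\<one>\<^bsub>A\<^esub>}" using q_ne[OF c] by blast
      then have "i \<in> I" using D cyc card_D i by (auto simp: I_def)
      then have "i \<le> m" using finI by (simp add: m)
      then have "A.ord x dvd p ^ m" by (simp add: i le_imp_power_dvd)
      then have "x [^]\<^bsub>A\<^esub> (p ^ m) = \<one>\<^bsub>A\<^esub>" using A.pow_eq_id[OF x] by simp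
      then show False using eq q_ne[OF c] by simp
    qed
  next
    assume "\<exists>\<zeta>::'k. primitive_root_of_unity (p ^ (n + e)) \<zeta>"
    then obtain \<zeta> :: 'k where \<zeta>: "primitive_root_of_unity (p ^ (n + e)) \<zeta>" by blast
    show "rational_over (noether_field H :: ('h, 'k) ratfun set) (noether_embedding H \<pi> ` noether_field G)"
    proof (rule key[OF \<zeta>])
      fix c x assume c: "c \<in> C" "c \<noteq> \<one>\<^bsub>H\<^esub>" and x: "x \<in> carrier A"
      obtain h where h: "h \<in> carrier H" "x = q h" using x carrierA by blast
      have normalG: "derived_subgroup G \<lhd> G" by (rule G.derived_self_is_normal)
      have dG: "subgroup (derived_subgroup G) G" by (rule normal_imp_subgroup[OF normalG])
      have "group (abelianization G)" by (rule G.derived_quot_is_group)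
      moreover have "finite (carrier (abelianization G))"
        using finG by (simp add: FactGroup_def RCOSETS_def)
      ultimately have expG: "\<forall>y\<in>carrier (abelianization G). y [^]\<^bsub>abelianization G\<^esub> (p ^ e) = \<one>\<^bsub>abelianization G\<^esub>"
        using exists_group_exponent[of "abelianization G"] by (simp add: assms(8))
      have "derived_subgroup G #>\<^bsub>G\<^esub> \<pi> h \<in> carrier (abelianization G)"
        using h by (auto simp: FactGroup_def RCOSETS_def)
      then have "derived_subgroup G #>\<^bsub>G\<^esub> (\<pi> h [^]\<^bsub>G\<^esub> (p ^ e)) = derived_subgroup G"
        using expG normal.FactGroup_pow[OF normalG, of "\<pi> h" "p ^ e"] h by simp
      then have "\<pi> h [^]\<^bsub>G\<^esub> (p ^ e) \<in> derived_subgroup G"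
        using G.coset_join1[OF _ _ dG] h by simp
      \<comment> \<open>G' is the image of H', so the p^e-th power of \<open>h\<close> can be
        corrected by an element of H' to an element \<open>b\<close> of the kernel, without changing
        its class in \<open>A\<close>.\<close>
      moreover have "derived_subgroup G = \<pi> ` derived_subgroup H"
        using \<pi>.derived_img[of "carrier H"] \<pi>(2) by simp
      ultimately obtain h' where h': "h' \<in> derived_subgroup H" "\<pi> (h [^]\<^bsub>H\<^esub> (p ^ e)) = \<pi> h'"
        using h \<pi>.hom_nat_pow[of h "p ^ e"] by auto
      have h'H: "h' \<in> carrier H" using h'(1) H.derived_in_carrier[of "carrier H"] by blast
      define b where "b = inv\<^bsub>H\<^esub> h' \<otimes>\<^bsub>H\<^esub> h [^]\<^bsub>H\<^esub> (p ^ e)"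
      have bH: "b \<in> carrier H" using h h'H by (simp add: b_def)
      have "\<pi> b = \<one>\<^bsub>G\<^esub>" using h h'H h'(2) by (simp add: b_def)
      then have bC: "b \<in> C" unfolding assms(5) kernel_def using bH by blast
      have "h' \<otimes>\<^bsub>H\<^esub> b = (h' \<otimes>\<^bsub>H\<^esub> inv\<^bsub>H\<^esub> h') \<otimes>\<^bsub>H\<^esub> h [^]\<^bsub>H\<^esub> (p ^ e)"
        unfolding b_def by (rule H.m_assoc[symmetric]) (use h h'H in auto)
      then have "h [^]\<^bsub>H\<^esub> (p ^ e) = h' \<otimes>\<^bsub>H\<^esub> b" using h h'H by simp
      moreover have "q h' = \<one>\<^bsub>A\<^esub>" using q_one[OF h'H] h'(1) by simp
      ultimately have "x [^]\<^bsub>A\<^esub> (p ^ e) = q b"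
        using h h'H bH q.hom_nat_pow[of h "p ^ e"] by simp
      moreover have "b [^]\<^bsub>H\<^esub> (p ^ n) = \<one>\<^bsub>H\<^esub>"
      proof -
        have "group (H\<lparr>carrier := C\<rparr>)" by (rule H.subgroup_imp_group[OF C])
        moreover have "finite (carrier (H\<lparr>carrier := C\<rparr>))"
          using finite_subset[OF C.subset finH] by simp
        ultimately have "b [^]\<^bsub>H\<lparr>carrier := C\<rparr>\<^esub> (p ^ n) = \<one>\<^bsub>H\<^esub>"
          using exists_group_exponent[of "H\<lparr>carrier := C\<rparr>"] bC by (simp add: assms(7))
        then show ?thesis using H.nat_pow_consistent[of b "p ^ n" C] by simp
      qed
      ultimately have "(x [^]\<^bsub>A\<^esub> (p ^ e)) [^]\<^bsub>A\<^esub> (p ^ n) = \<one>\<^bsub>A\<^esub>"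
        using q.hom_nat_pow[OF bH, of "p ^ n"] by simp
      then have "x [^]\<^bsub>A\<^esub> (p ^ (n + e)) = \<one>\<^bsub>A\<^esub>"
        using x by (simp add: A.nat_pow_pow power_add mult.commute)
      then show "x [^]\<^bsub>A\<^esub> (p ^ (n + e)) \<noteq> q c" using q_ne[OF c] by simp
    qed
  qed
qed

end
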